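(* Let a natural number $s\le N$ be given. Assume that $\Phi_N=\{\varphi_j\}_{j=1}^N$ belongs to $\mathcal{R}(s,R_1,R_2)$ (in $L_2(\Omega,\mu)$) for some constants $0<R_1\le R_2<\infty$ and is a uniformly bounded system satisfying $\sup_{x\in\Omega}|\varphi_j(x)|\le 1$, $1\le j\le N$. For given parameters $t\in(0,1]$ and $R_1$, $R_2$ and some $c:=c(t,R_2/R_1)$ the following holds. Let $\xi^1,\dots,\xi^m$ be i.i.d. random points with common distribution $\mu$ on $\Omega$. Then there exists an absolute constant $C_0$ such that with high probability for $$ m\ge C_0\,Ks\log N\cdot(\log(2Ks))^2\cdot(\log(2Ks)+\log\log N),\qquad K:=R_1^{-2}, $$ we have the following properties: for any integer $v$ such that $(1+c)v\le s$ and any $f_0\in\mathcal{C}(\Omega)$, the WOMP algorithm with weakness parameter $t$ applied to $f_0$ with respect to $\Phi_N(\Omega_m)$ in the space $L_2(\Omega_m,\mu_m)$ provides $$ \|f_{cv}\|_{L_2(\Omega_m,\mu_m)}\le C\,\sigma_v(f_0,\Phi_N(\Omega_m))_{L_2(\Omega_m,\mu_m)}, $$ and $$ \|f_{cv}\|_{L_2(\Omega,\mu)}\le C'\,\sigma_v(f_0,\Phi_N)_\infty $$ with absolute constants $C$ and $C'$. Moreover, we have $$ \|f_{cv}\|_{L_2(\Omega,\mu)}\le C''\,\sigma_v(f_0,\Phi_N)_{L_2(\Omega,\mu_\xi)} $$ with an absolute constant $C''$ and $$ \mu_\xi:=\frac12\mu+\frac1{2m}\sum_{j=1}^m\delta_{\xi^j}.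 $$
   Context: $\Omega\subset\mathbb{R}^d$ is a nonempty set (usually compact) equipped with a probability measure $\mu$; $\Phi_N$ is a system of $N$ functions on $\Omega$; $\mathcal{C}(\Omega)$ is the space of continuous functions on $\Omega$; $\delta_x$ is the Dirac measure at $x$. Riesz dictionaries: a system $\mathcal{D}$ in a Hilbert space $\mathcal{H}$ belongs to $\mathcal{R}(u,R_1,R_2)$ if for any $u$ distinct elements $g_1,\dots,g_u$ of the system and any coefficients $a=(a_1,\dots,a_u)$ one has $R_1\|a\|_2\le\|\sum_{i=1}^u a_ig_i\|_{\mathcal{H}}\le R_2\|a\|_2$. Discrete space: $\Omega_m=\{\xi^\nu\}_{\nu=1}^m$ with the measure $\mu_m=\frac1m\sum_{\nu=1}^m\delta_{\xi^\nu}$, so $\|f\|^2_{L_2(\Omega_m,\mu_m)}=\frac1m\sum_{\nu=1}^m|f(\xi^\nu)|^2$; $\Phi_N(\Omega_m)$ is the restriction of the system $\Phi_N$ to $\Omega_m$. Sparse approximation: $\Sigma_v(\mathcal{D})$ is the set of all linear combinations of at most $v$ elements of $\mathcal{D}$, and $\sigma_v(f,\mathcal{D})_Y:=\inf_{g\in\Sigma_v(\mathcal{D})}\|f-g\|_Y$. The subscript $\infty$ refers to $\|f\|_\infty=\sup_{x\in\Omega}|f(x)|$. Weak Orthogonal Matching Pursuit (WOMP) with weakness parameter $t\in(0,1]$, with respect to a system $\mathcal{D}$ in a Hilbert space $\mathcal{H}$: given $f_0\in\mathcal{H}$, for $n=1,2,\dots$ inductively (1) choose any $\psi_n\in\mathcal{D}$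 with $|\langle f_{n-1},\psi_n\rangle|\ge t\sup_{g\in\mathcal{D}}|\langle f_{n-1},g\rangle|$; (2) let $G_n$ be the orthogonal projection of $f_0$ onto $\operatorname{span}(\psi_1,\dots,\psi_n)$; (3) set $f_n:=f_0-G_n$. Results apply for any realization (any choice of the $\psi_n$). The algorithm is run in $L_2(\Omega_m,\mu_m)$; the approximant $G_n$ is a linear combination of restrictions of elements of $\Phi_N$ to $\Omega_m$, and it is identified with the function on $\Omega$ given by the same linear combination of the corresponding elements of $\Phi_N$. In this sense $f_n=f_0-G_n$ is a function on $\Omega$, and $\|f_n\|_{L_2(\Omega,\mu)}$ is its norm. *)

theory Defs
  imports "HOL-Probability.Probability"
begin

text \<open>
  Functions on \<open>\<Omega>\<close> are total functions into \<^typ>\<open>complex\<close> whose values outside \<open>\<Omega>\<close> are never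
  looked at.  To cover the real and the complex theory at once, a set \<open>F\<close> of scalars, which is
  \<open>\<real>\<close> or the whole of \<open>\<complex>\<close>, is carried along; functions and coefficients take their values in \<open>F\<close>.
  Systems \<open>\<phi> 1, \<dots>, \<phi> N\<close> are indexed families, and ``distinct elements'' are elements with
  distinct indices.
\<close>

text \<open>Norms live in \<^typ>\<open>ennreal\<close>: for a noncompact \<open>\<Omega>\<close> a continuous function may have infinite
  \<open>L\<^sub>2\<close> norm or supremum norm.\<close>

definition L2_norm :: "'a measure \<Rightarrow> ('a \<Rightarrow> complex) \<Rightarrow> ennreal" where
  "L2_norm M f = (let I = (\<integral>\<^sup>+ x. ennreal ((cmod (f x))\<^sup>2) \<partial>M)
     in if I = \<infinity> then \<infinity> else ennreal (sqrt (enn2real I)))"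

definition L2_inner :: "'a measure \<Rightarrow> ('a \<Rightarrow> complex) \<Rightarrow> ('a \<Rightarrow> complex) \<Rightarrow> complex" where
  "L2_inner M f g = (\<integral>x. f x * cnj (g x) \<partial>M)"

definition sup_norm :: "'a set \<Rightarrow> ('a \<Rightarrow> complex) \<Rightarrow> ennreal" where
  "sup_norm \<Omega> f = (SUP x\<in>\<Omega>. ennreal (cmod (f x)))"

definition lin_span :: "complex set \<Rightarrow> (nat \<Rightarrow> 'a \<Rightarrow> complex) \<Rightarrow> nat set \<Rightarrow> ('a \<Rightarrow> complex) set" where
  "lin_span F \<phi> J = {(\<lambda>x. \<Sum>j\<in>J. a j * \<phi> j x) | a. \<forall>j\<in>J. a j \<in> F}"

definition sparse :: "complex set \<Rightarrow> (nat \<Rightarrow> 'a \<Rightarrow> complex) \<Rightarrow> nat \<Rightarrow> nat \<Rightarrow> ('a \<Rightarrow> complex) set" where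
  "sparse F \<phi> N v = (\<Union>J\<in>{J. J \<subseteq> {1..N} \<and> card J \<le> v}. lin_span F \<phi> J)"

text \<open>Best \<open>v\<close>-term approximation error in the space with norm \<open>nrm\<close>.\<close>

definition sigma_best ::
    "complex set \<Rightarrow> (nat \<Rightarrow> 'a \<Rightarrow> complex) \<Rightarrow> nat \<Rightarrow> (('a \<Rightarrow> complex) \<Rightarrow> ennreal) \<Rightarrow>
     nat \<Rightarrow> ('a \<Rightarrow> complex) \<Rightarrow> ennreal" where
  "sigma_best F \<phi> N nrm v f = (INF g\<in>sparse F \<phi> N v. nrm (\<lambda>x. f x - g x))"

text \<open>The class \<open>\<R>(u, R\<^sub>1, R\<^sub>2)\<close> in the Hilbert space \<open>L\<^sub>2(M)\<close>.\<close>

definition riesz ::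
    "complex set \<Rightarrow> 'a measure \<Rightarrow> (nat \<Rightarrow> 'a \<Rightarrow> complex) \<Rightarrow> nat \<Rightarrow> nat \<Rightarrow> real \<Rightarrow> real \<Rightarrow> bool" where
  "riesz F M \<phi> N u R\<^sub>1 R\<^sub>2 \<longleftrightarrow>
     (\<forall>J a. J \<subseteq> {1..N} \<and> card J = u \<and> (\<forall>j\<in>J. a j \<in> F) \<longrightarrow>
        ennreal (R\<^sub>1 * sqrt (\<Sum>j\<in>J. (cmod (a j))\<^sup>2)) \<le> L2_norm M (\<lambda>x. \<Sum>j\<in>J. a j * \<phi> j x) \<and>
        L2_norm M (\<lambda>x. \<Sum>j\<in>J. a j * \<phi> j x) \<le> ennreal (R\<^sub>2 * sqrt (\<Sum>j\<in>J. (cmod (a j))\<^sup>2)))"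

text \<open>
  The measure \<open>\<mu>\<^sub>m\<close>, regarded as a measure on \<open>\<Omega>\<close> concentrated on \<open>\<Omega>\<^sub>m = {\<xi> 1, \<dots>, \<xi> m}\<close>
  (repeated points count with multiplicity).  Since \<open>L2_norm\<close> and \<open>L2_inner\<close> for it depend only on
  the values at the points \<open>\<xi> \<nu>\<close>, the system \<open>\<Phi>\<^sub>N(\<Omega>\<^sub>m)\<close> is represented by \<open>\<phi>\<close> itself.
\<close>

definition emp_measure :: "'a measure \<Rightarrow> nat \<Rightarrow> (nat \<Rightarrow> 'a) \<Rightarrow> 'a measure" where
  "emp_measure \<mu> m \<xi> = measure_of (space \<mu>) (sets \<mu>)
     (\<lambda>A. ennreal (1 / real m) * (\<Sum>\<nu>=1..m. emeasure (return \<mu> (\<xi> \<nu>)) A))"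

definition mix_measure :: "'a measure \<Rightarrow> nat \<Rightarrow> (nat \<Rightarrow> 'a) \<Rightarrow> 'a measure" where
  "mix_measure \<mu> m \<xi> = measure_of (space \<mu>) (sets \<mu>)
     (\<lambda>A. ennreal (1 / 2) * emeasure \<mu> A +
          ennreal (1 / (2 * real m)) * (\<Sum>j=1..m. emeasure (return \<mu> (\<xi> j)) A))"

definition is_orth_proj ::
    "'a measure \<Rightarrow> ('a \<Rightarrow> complex) set \<Rightarrow> ('a \<Rightarrow> complex) \<Rightarrow> ('a \<Rightarrow> complex) \<Rightarrow> bool" where
  "is_orth_proj M S f g \<longleftrightarrow> g \<in> S \<and> (\<forall>h\<in>S. L2_inner M (\<lambda>x. f x - g x) h = 0)"

text \<open>
  \<open>womp F M \<phi> N t f\<^sub>0 k f\<close>: the residuals \<open>f 1, f 2, \<dots>\<close> together with the selected elements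
  \<open>\<psi>\<^sub>n = \<phi> (k n)\<close> are a realization of the algorithm in \<open>L\<^sub>2(M)\<close> started at \<open>f 0 = f\<^sub>0\<close>.
  The approximants \<open>G\<^sub>n = f\<^sub>0 - f\<^sub>n\<close> are linear combinations of \<open>\<phi> (k 1), \<dots>, \<phi> (k n)\<close> as functions
  on all of \<open>\<Omega>\<close>, also when \<open>M\<close> only sees finitely many points; when the \<open>L\<^sub>2(M)\<close> projection has
  several such representations, each of them is a realization.
\<close>

definition womp ::
    "complex set \<Rightarrow> 'a measure \<Rightarrow> (nat \<Rightarrow> 'a \<Rightarrow> complex) \<Rightarrow> nat \<Rightarrow> real \<Rightarrow> ('a \<Rightarrow> complex) \<Rightarrow>
     (nat \<Rightarrow> nat) \<Rightarrow> (nat \<Rightarrow> 'a \<Rightarrow> complex) \<Rightarrow> bool" where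
  "womp F M \<phi> N t f\<^sub>0 k f \<longleftrightarrow> f 0 = f\<^sub>0 \<and>
     (\<forall>n\<ge>1. k n \<in> {1..N} \<and>
        cmod (L2_inner M (f (n - 1)) (\<phi> (k n)))
          \<ge> t * (SUP j\<in>{1..N}. cmod (L2_inner M (f (n - 1)) (\<phi> j))) \<and>
        (\<exists>G. is_orth_proj M (lin_span F \<phi> (k ` {1..n})) f\<^sub>0 G \<and> f n = (\<lambda>x. f\<^sub>0 x - G x)))"

end

theory Submission
  imports Defs
begin

text \<open>
  Two independent facts are combined: a restricted isometry property of random samples, and a
  deterministic bound for WOMP under such a property.

  Restricted isometry: after scaling, an \<open>s\<close>-sparse \<open>f\<close> with \<open>\<parallel>f\<parallel>\<^sub>2 = 1\<close> becomes \<open>h = f / sqrt (K s)\<close> in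
  the absolutely convex hull of the system.  By Maurey's empirical method \<open>h\<close> is approximated up to
  \<open>2\<^sup>-\<^sup>i / 4\<close>, off a set that is small for \<open>\<mu>\<close> and for \<open>\<mu>\<^sub>m\<close> simultaneously, by an average of about
  \<open>4\<^sup>i log (K s)\<close> elements of the system.  Hence the level set \<open>{|h| > 2\<^sup>-\<^sup>i}\<close> is essentially one of
  \<open>N\<close> to the power \<open>O(4\<^sup>i log (K s))\<close> sets.  For each of these the Chernoff bound compares \<open>\<mu>\<close> and \<open>\<mu>\<^sub>m\<close> up to a factor
  \<open>2\<close> and an additive error proportional to \<open>4\<^sup>i\<close>, which the weight \<open>4\<^sup>-\<^sup>i\<close> of the level in \<open>\<integral>|h|\<^sup>2\<close> cancels.
  Only the \<open>O(log (K s))\<close> levels above \<open>(K s)\<^sup>-\<^sup>1\<^sup>/\<^sup>2\<close> matter.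

  WOMP: as long as the residual is large compared with the part of the target that is not yet
  captured, one step decreases its square by a fixed proportion divided by the number of missing
  coefficients under consideration.  Treating the missing coefficients in blocks of doubling size,
  \<open>O(u)\<close> steps either reach the error bound or capture about \<open>u\<close> missing coefficients.
\<close>

section \<open>Empirical and mixed measures\<close>

text \<open>Only an equivalence of norms up to fixed factors is aimed at, not a near-isometry. This
  tolerates the loss of a factor 2 at each level and Chernoff bounds with fixed exponents, so that
  the additive error enters the tail linearly. The approximating average has to be good for
  \<open>\<mu>\<close> and for the random \<open>\<mu>\<^sub>m\<close>. It is chosen after the
  sample is known, for the mixture of the two. This is legitimate because the union bound has run
  over all averages of the given length, a finite family fixed before sampling. The isometry
  property says nothing about a residual, since \<open>f\<^sub>0\<close> is arbitrary. It is applied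
  to the difference between the residual and the error of a competitor, a combination of at most
  \<open>(1 + c) * v\<close> elements. The competitor's error itself is measured in the norm on the
  right-hand side, which explains the supremum norm and the mixed measure in the bounds over all of
  \<open>\<Omega>\<close>. If \<open>s = 1\<close>, then \<open>v = 0\<close> and the residual in
  question is \<open>f\<^sub>0\<close> itself. The probabilistic part therefore starts from
  \<open>s \<ge> 2\<close>, where \<open>ln N\<close> and \<open>ln (2 * K * s)\<close> are bounded
  away from zero.\<close>

definition emp_avg :: "nat \<Rightarrow> (nat \<Rightarrow> 'a) \<Rightarrow> ('a \<Rightarrow> 'b::real_normed_field) \<Rightarrow> 'b" where
  "emp_avg m \<xi> g = (\<Sum>\<nu>=1..m. g (\<xi> \<nu>)) / of_nat m"

text \<open>Nothing is known about \<open>\<xi> \<nu>\<close> for \<open>\<nu> \<notin> {1..m}\<close>; redirecting the index makes the map measurable.\<close>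

definition emp_dist :: "'a measure \<Rightarrow> nat \<Rightarrow> (nat \<Rightarrow> 'a) \<Rightarrow> 'a measure" where
  "emp_dist \<mu> m \<xi> = distr (measure_pmf (pmf_of_set {1..m})) \<mu> (\<lambda>\<nu>. \<xi> (if \<nu> \<in> {1..m} then \<nu> else 1))"

context
  fixes \<mu> :: "'a measure" and m :: nat and \<xi> :: "nat \<Rightarrow> 'a"
  assumes m: "1 \<le> m" and \<xi>: "\<xi> \<in> {1..m} \<rightarrow> space \<mu>"
begin

lemma emp_dist_measurable:
  "(\<lambda>\<nu>. \<xi> (if \<nu> \<in> {1..m} then \<nu> else 1)) \<in> measure_pmf (pmf_of_set {1..m}) \<rightarrow>\<^sub>M \<mu>"
  using m \<xi> by (auto simp: Pi_iff)

lemma emeasure_emp_dist: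
  assumes "A \<in> sets \<mu>"
  shows "emeasure (emp_dist \<mu> m \<xi>) A = ennreal (emp_avg m \<xi> (indicator A))"
proof -
  have "emeasure (emp_dist \<mu> m \<xi>) A = emeasure (measure_pmf (pmf_of_set {1..m})) ((\<lambda>\<nu>. \<xi> (if \<nu> \<in> {1..m} then \<nu> else 1)) -` A)"
    unfolding emp_dist_def by (subst emeasure_distr[OF emp_dist_measurable assms]) auto
  also have "\<dots> = ennreal (real (card ({1..m} \<inter> (\<lambda>\<nu>. \<xi> (if \<nu> \<in> {1..m} then \<nu> else 1)) -` A)) / real m)"
    using m by (subst emeasure_pmf_of_set) auto
  also have "{1..m} \<inter> (\<lambda>\<nu>. \<xi> (if \<nu> \<in> {1..m} then \<nu> else 1)) -` A = {\<nu>\<in>{1..m}. \<xi> \<nu> \<in> A}" by auto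
  also have "real (card {\<nu>\<in>{1..m}. \<xi> \<nu> \<in> A}) = (\<Sum>\<nu>=1..m. indicator A (\<xi> \<nu>))"
    by (simp add: indicator_def sum.If_cases Int_def del: One_nat_def)
  finally show ?thesis by (simp add: emp_avg_def)
qed

text \<open>A push-forward is a measure by construction. Identifying it with
  \<open>emp_measure\<close> on measurable sets spares a check of countable additivity, and
  integrals follow by change of variables from the uniform distribution on the indices.\<close>

lemma emp_measure_eq: "emp_measure \<mu> m \<xi> = emp_dist \<mu> m \<xi>"
proof -
  have sp: "space (emp_dist \<mu> m \<xi>) = space \<mu>" "sets (emp_dist \<mu> m \<xi>) = sets \<mu>"
    by (auto simp: emp_dist_def)
  have "emp_measure \<mu> m \<xi> = measure_of (space \<mu>) (sets \<mu>) (emeasure (emp_dist \<mu> m \<xi>))"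
    unfolding emp_measure_def
  proof (rule measure_of_eq[OF sets.space_closed])
    fix A assume "A \<in> sigma_sets (space \<mu>) (sets \<mu>)"
    then have A: "A \<in> sets \<mu>" by (simp add: sets.sigma_sets_eq)
    have "(\<Sum>\<nu>=1..m. emeasure (return \<mu> (\<xi> \<nu>)) A) = ennreal (\<Sum>\<nu>=1..m. indicator A (\<xi> \<nu>))"
      using A by (simp add: ennreal_indicator flip: sum_ennreal)
    then show "ennreal (1 / real m) * (\<Sum>\<nu>=1..m. emeasure (return \<mu> (\<xi> \<nu>)) A) = emeasure (emp_dist \<mu> m \<xi>) A"
      by (simp add: emeasure_emp_dist[OF A] emp_avg_def ennreal_mult'[symmetric] sum_nonneg)
  qed
  then show ?thesis using measure_of_of_measure[of "emp_dist \<mu> m \<xi>"] by (simp add: sp)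
qed

lemma sets_emp: "sets (emp_measure \<mu> m \<xi>) = sets \<mu>"
  by (simp add: emp_measure_eq emp_dist_def)

lemma integral_emp:
  fixes g :: "'a \<Rightarrow> 'b :: {real_normed_field, banach, second_countable_topology}"
  assumes [measurable]: "g \<in> borel_measurable \<mu>"
  shows "(\<integral>x. g x \<partial>emp_measure \<mu> m \<xi>) = emp_avg m \<xi> g"
proof -
  have "(\<integral>x. g x \<partial>emp_measure \<mu> m \<xi>) =
     (\<integral>\<nu>. g (\<xi> (if \<nu> \<in> {1..m} then \<nu> else 1)) \<partial>measure_pmf (pmf_of_set {1..m}))"
    unfolding emp_measure_eq emp_dist_def by (subst integral_distr[OF emp_dist_measurable]) auto
  also have "\<dots> = (\<Sum>\<nu>=1..m. pmf (pmf_of_set {1..m}) \<nu> *\<^sub>R g (\<xi> (if \<nu> \<in> {1..m} then \<nu> else 1)))"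
    using m by (intro integral_measure_pmf) auto
  also have "\<dots> = (\<Sum>\<nu>=1..m. g (\<xi> \<nu>) / of_nat m)"
    using m by (intro sum.cong) (auto simp: scaleR_conv_of_real)
  finally show ?thesis by (simp add: emp_avg_def sum_divide_distrib)
qed

lemma nn_integral_emp:
  assumes [measurable]: "g \<in> borel_measurable \<mu>" and g: "\<And>x. 0 \<le> g x"
  shows "(\<integral>\<^sup>+x. ennreal (g x) \<partial>emp_measure \<mu> m \<xi>) = ennreal (emp_avg m \<xi> g)"
proof -
  have "(\<integral>\<^sup>+x. ennreal (g x) \<partial>emp_measure \<mu> m \<xi>) =
     (\<integral>\<^sup>+\<nu>. ennreal (g (\<xi> (if \<nu> \<in> {1..m} then \<nu> else 1))) \<partial>measure_pmf (pmf_of_set {1..m}))"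
    unfolding emp_measure_eq emp_dist_def by (subst nn_integral_distr[OF emp_dist_measurable]) auto
  also have "\<dots> = (\<Sum>\<nu>=1..m. ennreal (g (\<xi> \<nu>))) / of_nat m"
    using m by (subst nn_integral_pmf_of_set) (auto intro!: arg_cong2[where f = "(/)"] sum.cong simp del: One_nat_def)
  also have "\<dots> = ennreal (emp_avg m \<xi> g)"
    using m g by (simp add: emp_avg_def sum_ennreal divide_ennreal sum_nonneg ennreal_of_nat_eq_real_of_nat)
  finally show ?thesis .
qed

lemma prob_space_emp: "prob_space (emp_measure \<mu> m \<xi>)"
  unfolding emp_measure_eq emp_dist_def
  by (intro prob_space.prob_space_distr prob_space_measure_pmf emp_dist_measurable)

lemma measure_emp:
  assumes "A \<in> sets \<mu>" shows "measure (emp_measure \<mu> m \<xi>) A = emp_avg m \<xi> (indicator A)"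
  using emeasure_emp_dist[OF assms] by (simp add: measure_def emp_measure_eq emp_avg_def sum_nonneg)

section \<open>The mixture of the distribution and the empirical measure\<close>

lemma emeasure_mix:
  assumes A: "A \<in> sets \<mu>"
  shows "emeasure (mix_measure \<mu> m \<xi>) A
    = ennreal (1 / 2) * emeasure \<mu> A + ennreal (1 / 2) * emeasure (emp_measure \<mu> m \<xi>) A"
proof -
  define \<nu>' where "\<nu>' A = ennreal (1 / 2) * emeasure \<mu> A + ennreal (1 / 2) * emeasure (emp_measure \<mu> m \<xi>) A" for A
  have "mix_measure \<mu> m \<xi> = measure_of (space \<mu>) (sets \<mu>) \<nu>'"
    unfolding mix_measure_def
  proof (rule measure_of_eq[OF sets.space_closed])
    fix A assume "A \<in> sigma_sets (space \<mu>) (sets \<mu>)"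
    then have A: "A \<in> sets \<mu>" by (simp add: sets.sigma_sets_eq)
    have "(\<Sum>\<nu>=1..m. emeasure (return \<mu> (\<xi> \<nu>)) A) = ennreal (\<Sum>\<nu>=1..m. indicator A (\<xi> \<nu>))"
      using A by (simp add: ennreal_indicator flip: sum_ennreal)
    then have "ennreal (1 / (2 * real m)) * (\<Sum>\<nu>=1..m. emeasure (return \<mu> (\<xi> \<nu>)) A)
        = ennreal (1 / 2) * emeasure (emp_measure \<mu> m \<xi>) A"
      by (simp add: emp_measure_eq emeasure_emp_dist[OF A] emp_avg_def ennreal_mult'[symmetric] sum_nonneg
        del: ennreal_half)
    then show "ennreal (1 / 2) * emeasure \<mu> A + ennreal (1 / (2 * real m)) * (\<Sum>\<nu>=1..m. emeasure (return \<mu> (\<xi> \<nu>)) A) = \<nu>' A"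
      by (simp add: \<nu>'_def)
  qed
  moreover have "emeasure (measure_of (space \<mu>) (sets \<mu>) \<nu>') A = \<nu>' A"
  proof (rule emeasure_measure_of_sigma)
    show "sigma_algebra (space \<mu>) (sets \<mu>)" by (rule sets.sigma_algebra_axioms)
    show "positive (sets \<mu>) \<nu>'" by (simp add: positive_def \<nu>'_def)
    \<comment> \<open>\<open>measure_of\<close> keeps the given set function only if it is countably
      additive; here this is inherited from the two summands.\<close>
    show "countably_additive (sets \<mu>) \<nu>'"
    proof (rule countably_additiveI)
      fix B :: "nat \<Rightarrow> 'a set" assume B: "range B \<subseteq> sets \<mu>" "disjoint_family B"
      then show "(\<Sum>i. \<nu>' (B i)) = \<nu>' (\<Union> (range B))"
        unfolding \<nu>'_def by (simp add: suminf_add[symmetric] suminf_emeasure sets_emp)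
    qed
  qed (rule A)
  ultimately show ?thesis by (simp add: \<nu>'_def)
qed

lemma sets_mix: "sets (mix_measure \<mu> m \<xi>) = sets \<mu>"
  by (simp add: mix_measure_def)

lemma space_mix: "space (mix_measure \<mu> m \<xi>) = space \<mu>"
  by (simp add: mix_measure_def sets.space_closed)

text \<open>Each of the two measures is dominated by twice the mixture. This brings the error in
  \<open>mix_measure\<close> into the last estimate of the theorem.\<close>

lemma nn_integral_le_mix:
  assumes "g \<in> borel_measurable \<mu>"
  shows "(\<integral>\<^sup>+x. g x \<partial>\<mu>) \<le> 2 * (\<integral>\<^sup>+x. g x \<partial>mix_measure \<mu> m \<xi>)"
    and "(\<integral>\<^sup>+x. g x \<partial>emp_measure \<mu> m \<xi>) \<le> 2 * (\<integral>\<^sup>+x. g x \<partial>mix_measure \<mu> m \<xi>)"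
proof -
  have *: "(\<integral>\<^sup>+x. g x \<partial>\<nu>) \<le> 2 * (\<integral>\<^sup>+x. g x \<partial>mix_measure \<mu> m \<xi>)"
    if sets: "sets \<nu> = sets \<mu>" and le: "\<And>A. A \<in> sets \<mu> \<Longrightarrow> ennreal (1/2) * emeasure \<nu> A \<le> emeasure (mix_measure \<mu> m \<xi>) A" for \<nu>
  proof -
    have "(\<integral>\<^sup>+x. g x \<partial>\<nu>) \<le> (\<integral>\<^sup>+x. g x \<partial>scale_measure 2 (mix_measure \<mu> m \<xi>))"
    proof (rule nn_integral_mono_measure)
      show "sets \<nu> = sets (scale_measure 2 (mix_measure \<mu> m \<xi>))" by (simp add: sets sets_mix)
      show "\<nu> \<le> scale_measure 2 (mix_measure \<mu> m \<xi>)"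
      proof -
        have "emeasure \<nu> \<le> emeasure (scale_measure 2 (mix_measure \<mu> m \<xi>))"
        proof (rule le_funI)
          fix A
          show "emeasure \<nu> A \<le> emeasure (scale_measure 2 (mix_measure \<mu> m \<xi>)) A"
          proof (cases "A \<in> sets \<mu>")
            case True
            have "emeasure \<nu> A = 2 * (ennreal (1/2) * emeasure \<nu> A)"
              by (simp add: mult.assoc[symmetric] ennreal_mult'[symmetric] flip: ennreal_numeral del: ennreal_half)
            also have "\<dots> \<le> 2 * emeasure (mix_measure \<mu> m \<xi>) A" using le[OF True] by (intro mult_left_mono) auto
            finally show ?thesis by simp
          qed (simp add: emeasure_notin_sets sets)
        qed
        then show ?thesis
          using sets_eq_imp_space_eq[OF sets] by (simp add: le_measure_iff sets sets_mix space_mix space_scale_measure)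
      qed
    qed
    also have "\<dots> = 2 * (\<integral>\<^sup>+x. g x \<partial>mix_measure \<mu> m \<xi>)"
      using assms by (intro nn_integral_scale_measure) (simp cong: measurable_cong_sets add: sets_mix)
    finally show ?thesis .
  qed
  show "(\<integral>\<^sup>+x. g x \<partial>\<mu>) \<le> 2 * (\<integral>\<^sup>+x. g x \<partial>mix_measure \<mu> m \<xi>)"
    by (rule *) (auto simp: emeasure_mix)
  show "(\<integral>\<^sup>+x. g x \<partial>emp_measure \<mu> m \<xi>) \<le> 2 * (\<integral>\<^sup>+x. g x \<partial>mix_measure \<mu> m \<xi>)"
    by (rule *) (auto simp: emeasure_mix sets_emp)
qed

lemma prob_space_mix:
  assumes "prob_space \<mu>" shows "prob_space (mix_measure \<mu> m \<xi>)"
proof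
  interpret prob_space \<mu> by fact
  interpret emp: prob_space "emp_measure \<mu> m \<xi>" by (rule prob_space_emp)
  have "space (emp_measure \<mu> m \<xi>) = space \<mu>" using sets_emp by (rule sets_eq_imp_space_eq)
  then have "emeasure (mix_measure \<mu> m \<xi>) (space \<mu>) = ennreal (1 / 2) + ennreal (1 / 2)"
    using emp.emeasure_space_1 by (simp add: emeasure_mix emeasure_space_1)
  also have "\<dots> = 1" by (simp flip: ennreal_plus del: ennreal_half)
  finally show "emeasure (mix_measure \<mu> m \<xi>) (space (mix_measure \<mu> m \<xi>)) = 1" by (simp add: space_mix)
qed

text \<open>A set that is small for the mixture is small for both measures at the price of a factor
  2, so a single application of Maurey's method serves both.\<close>

lemma measure_le_mix:
  assumes "prob_space \<mu>" "A \<in> sets \<mu>"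
  shows "measure \<mu> A \<le> 2 * measure (mix_measure \<mu> m \<xi>) A"
    and "measure (emp_measure \<mu> m \<xi>) A \<le> 2 * measure (mix_measure \<mu> m \<xi>) A"
proof -
  interpret prob_space \<mu> by fact
  interpret emp: prob_space "emp_measure \<mu> m \<xi>" by (rule prob_space_emp)
  interpret mix: prob_space "mix_measure \<mu> m \<xi>" using assms(1) by (rule prob_space_mix)
  have "measure (mix_measure \<mu> m \<xi>) A = 1 / 2 * measure \<mu> A + 1 / 2 * measure (emp_measure \<mu> m \<xi>) A"
    using emeasure_mix[OF assms(2)]
    by (simp add: mix.emeasure_eq_measure emeasure_eq_measure emp.emeasure_eq_measure
        flip: ennreal_mult' ennreal_plus del: ennreal_half)
  then show "measure \<mu> A \<le> 2 * measure (mix_measure \<mu> m \<xi>) A"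
    and "measure (emp_measure \<mu> m \<xi>) A \<le> 2 * measure (mix_measure \<mu> m \<xi>) A"
    by (simp_all add: add_nonneg_nonneg)
qed

end

section \<open>Maurey's empirical method and Chernoff bounds\<close>

text \<open>Hoeffding's inequality for \<open>n\<close> independent summands in an interval of
  length 4: the deviation \<open>n * \<delta>\<close> gives the exponent
  \<open>2 * (n * \<delta>)\<^sup>2 / (16 * n)\<close>.\<close>

lemma pmf_sample_tail:
  fixes Y :: "'i \<Rightarrow> real"
  assumes Y: "\<And>i. i \<in> set_pmf p \<Longrightarrow> \<bar>Y i\<bar> \<le> 2" and n: "0 < n" and \<delta>: "0 \<le> \<delta>"
  shows "measure_pmf.prob (Pi_pmf {..<n} d (\<lambda>_. p))
     {\<omega>. real n * \<delta> \<le> \<bar>(\<Sum>k<n. Y (\<omega> k)) - real n * measure_pmf.expectation p Y\<bar>} \<le> 2 * exp (- real n * \<delta>\<^sup>2 / 8)"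
proof -
  define Q where "Q = Pi_pmf {..<n} d (\<lambda>_. p)"
  have comp: "measure_pmf.expectation Q (\<lambda>\<omega>. Y (\<omega> k)) = measure_pmf.expectation p Y" if "k < n" for k
  proof -
    have "measure_pmf.expectation Q (\<lambda>\<omega>. Y (\<omega> k)) = measure_pmf.expectation (map_pmf (\<lambda>\<omega>. \<omega> k) Q) Y" by simp
    also have "map_pmf (\<lambda>\<omega>. \<omega> k) Q = p" using that by (simp add: Q_def Pi_pmf_component)
    finally show ?thesis .
  qed
  interpret Hoeffding_ineq "measure_pmf Q" "{..<n}" "\<lambda>k \<omega>. Y (\<omega> k)" "\<lambda>_. -2" "\<lambda>_. 2"
    "\<Sum>k<n. measure_pmf.expectation Q (\<lambda>\<omega>. Y (\<omega> k))"
  proof unfold_locales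
    show "prob_space.indep_vars (measure_pmf Q) (\<lambda>_. borel) (\<lambda>k \<omega>. Y (\<omega> k)) {..<n}"
      unfolding Q_def
      by (rule prob_space.indep_vars_compose2[OF prob_space_measure_pmf indep_vars_Pi_pmf]) auto
    fix k assume "k \<in> {..<n}"
    then show "AE \<omega> in measure_pmf Q. Y (\<omega> k) \<in> {-2..2}"
      using Y by (fastforce simp: AE_measure_pmf_iff Q_def set_Pi_pmf PiE_dflt_def abs_le_iff)
  qed simp_all
  show ?thesis
    using Hoeffding_ineq_abs_ge[of "real n * \<delta>"] n \<delta>
    by (simp add: comp Q_def[symmetric] power_mult_distrib power2_eq_square mult_ac)
qed

text \<open>A modulus of at least \<open>2 * \<delta>\<close> forces the real or the imaginary part
  to be at least \<open>\<delta>\<close> in absolute value, and the two real tails add up to the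
  factor 4.\<close>

lemma maurey_pointwise:
  fixes z :: "'i \<Rightarrow> complex"
  assumes z: "\<And>i. i \<in> set_pmf p \<Longrightarrow> cmod (z i) \<le> 2" and fin: "finite (set_pmf p)"
    and n: "0 < n" and \<delta>: "0 \<le> \<delta>"
  shows "measure_pmf.prob (Pi_pmf {..<n} d (\<lambda>_. p))
     {\<omega>. 2 * \<delta> \<le> cmod (measure_pmf.expectation p z - (\<Sum>k<n. z (\<omega> k)) / of_nat n)} \<le> 4 * exp (- real n * \<delta>\<^sup>2 / 8)"
proof -
  define Q where "Q = Pi_pmf {..<n} d (\<lambda>_. p)"
  define S where "S Y = {\<omega>. real n * \<delta> \<le> \<bar>(\<Sum>k<n. Y (\<omega> k)) - real n * measure_pmf.expectation p Y\<bar>}" for Y :: "'i \<Rightarrow> real"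
  have int: "integrable (measure_pmf p) z" by (rule integrable_measure_pmf_finite[OF fin])
  have "{\<omega>. 2 * \<delta> \<le> cmod (measure_pmf.expectation p z - (\<Sum>k<n. z (\<omega> k)) / of_nat n)}
     \<subseteq> S (\<lambda>i. Re (z i)) \<union> S (\<lambda>i. Im (z i))"
  proof (intro subsetI, rule ccontr)
    fix \<omega> assume a: "\<omega> \<in> {\<omega>. 2 * \<delta> \<le> cmod (measure_pmf.expectation p z - (\<Sum>k<n. z (\<omega> k)) / of_nat n)}"
      and neg: "\<omega> \<notin> S (\<lambda>i. Re (z i)) \<union> S (\<lambda>i. Im (z i))"
    define w where "w = measure_pmf.expectation p z - (\<Sum>k<n. z (\<omega> k)) / of_nat n"
    have Re: "Re w = measure_pmf.expectation p (\<lambda>i. Re (z i)) - (\<Sum>k<n. Re (z (\<omega> k))) / n"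
      using integral_Re[OF int] by (simp add: w_def)
    have Im: "Im w = measure_pmf.expectation p (\<lambda>i. Im (z i)) - (\<Sum>k<n. Im (z (\<omega> k))) / n"
      using integral_Im[OF int] by (simp add: w_def)
    have "real n * Re w = real n * measure_pmf.expectation p (\<lambda>i. Re (z i)) - (\<Sum>k<n. Re (z (\<omega> k)))"
      using n by (simp add: Re right_diff_distrib)
    then have "real n * \<bar>Re w\<bar> = \<bar>(\<Sum>k<n. Re (z (\<omega> k))) - real n * measure_pmf.expectation p (\<lambda>i. Re (z i))\<bar>"
      by (metis abs_minus_commute abs_mult abs_of_nat)
    then have Rew: "real n * \<bar>Re w\<bar> < real n * \<delta>"
      using neg by (simp add: S_def)
    have "real n * Im w = real n * measure_pmf.expectation p (\<lambda>i. Im (z i)) - (\<Sum>k<n. Im (z (\<omega> k)))"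
      using n by (simp add: Im right_diff_distrib)
    then have "real n * \<bar>Im w\<bar> = \<bar>(\<Sum>k<n. Im (z (\<omega> k))) - real n * measure_pmf.expectation p (\<lambda>i. Im (z i))\<bar>"
      by (metis abs_minus_commute abs_mult abs_of_nat)
    then have Imw: "real n * \<bar>Im w\<bar> < real n * \<delta>"
      using neg by (simp add: S_def)
    from Rew Imw have "\<bar>Re w\<bar> + \<bar>Im w\<bar> < 2 * \<delta>" using n by simp
    with cmod_le[of w] a show False by (simp add: w_def)
  qed
  then have "measure_pmf.prob Q {\<omega>. 2 * \<delta> \<le> cmod (measure_pmf.expectation p z - (\<Sum>k<n. z (\<omega> k)) / of_nat n)}
     \<le> measure_pmf.prob Q (S (\<lambda>i. Re (z i)) \<union> S (\<lambda>i. Im (z i)))"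
    by (intro measure_pmf.finite_measure_mono) auto
  also have "\<dots> \<le> measure_pmf.prob Q (S (\<lambda>i. Re (z i))) + measure_pmf.prob Q (S (\<lambda>i. Im (z i)))"
    by (intro measure_Un_le) auto
  also have "measure_pmf.prob Q (S (\<lambda>i. Re (z i))) \<le> 2 * exp (- real n * \<delta>\<^sup>2 / 8)"
    unfolding S_def Q_def
    by (intro pmf_sample_tail n \<delta>) (meson z abs_Re_le_cmod order_trans)
  also have "measure_pmf.prob Q (S (\<lambda>i. Im (z i))) \<le> 2 * exp (- real n * \<delta>\<^sup>2 / 8)"
    unfolding S_def Q_def
    by (intro pmf_sample_tail n \<delta>) (meson z abs_Im_le_cmod order_trans)
  finally show ?thesis by (simp add: Q_def)
qed

text \<open>Probabilistic method: integrating the pointwise tail over \<open>\<nu>\<close> bounds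
  the mean measure of the exceptional set of a random realization, so some realization in the
  support does no worse. Since \<open>\<nu>\<close> is arbitrary, it may later depend on the
  sample.\<close>

lemma maurey:
  fixes \<psi> :: "'i \<Rightarrow> 'a \<Rightarrow> complex"
  assumes \<nu>: "prob_space \<nu>" and fin: "finite (set_pmf p)"
    and meas: "\<And>i. i \<in> set_pmf p \<Longrightarrow> \<psi> i \<in> borel_measurable \<nu>"
    and bound: "\<And>i x. i \<in> set_pmf p \<Longrightarrow> x \<in> space \<nu> \<Longrightarrow> cmod (\<psi> i x) \<le> 2"
    and n: "0 < n" and \<delta>: "0 \<le> \<delta>"
  obtains \<omega> where "\<omega> \<in> PiE_dflt {..<n} d (\<lambda>_. set_pmf p)"
    "measure \<nu> {x \<in> space \<nu>. 2 * \<delta> \<le> cmod (measure_pmf.expectation p (\<lambda>i. \<psi> i x) - (\<Sum>k<n. \<psi> (\<omega> k) x) / of_nat n)}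
      \<le> 4 * exp (- real n * \<delta>\<^sup>2 / 8)"
proof -
  interpret prob_space \<nu> by fact
  define Q where "Q = Pi_pmf {..<n} d (\<lambda>_. p)"
  define W where "W = PiE_dflt {..<n} d (\<lambda>_. set_pmf p)"
  have WQ: "W = set_pmf Q" by (simp add: W_def Q_def set_Pi_pmf o_def)
  have finW: "finite W" unfolding W_def using fin by (intro finite_PiE_dflt) auto
  define q where "q = 4 * exp (- real n * \<delta>\<^sup>2 / 8)"
  define h where "h x = measure_pmf.expectation p (\<lambda>i. \<psi> i x)" for x
  have h: "h x = (\<Sum>i\<in>set_pmf p. pmf p i *\<^sub>R \<psi> i x)" for x
    unfolding h_def by (rule integral_measure_pmf[OF fin])
  have [measurable]: "h \<in> borel_measurable \<nu>"
    unfolding h using meas by (intro borel_measurable_sum borel_measurable_scaleR) auto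
  define B where "B \<omega> = {x \<in> space \<nu>. 2 * \<delta> \<le> cmod (h x - (\<Sum>k<n. \<psi> (\<omega> k) x) / of_nat n)}" for \<omega>
  have Bm [measurable]: "B \<omega> \<in> sets \<nu>" if "\<omega> \<in> W" for \<omega>
  proof -
    have [measurable]: "(\<lambda>x. \<Sum>k<n. \<psi> (\<omega> k) x) \<in> borel_measurable \<nu>"
      using that meas by (intro borel_measurable_sum) (auto simp: W_def PiE_dflt_def)
    show ?thesis unfolding B_def by measurable
  qed
  have int_ind: "integrable \<nu> (indicator (B \<omega>) :: 'a \<Rightarrow> real)" if "\<omega> \<in> W" for \<omega>
    using Bm[OF that] by (intro integrable_const_bound[where B = 1]) auto
  have "\<exists>\<omega>\<in>W. measure \<nu> (B \<omega>) \<le> q"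
  proof (rule ccontr)
    assume "\<not> ?thesis"
    then have gt: "q < measure \<nu> (B \<omega>)" if "\<omega> \<in> W" for \<omega> using that by auto
    have sum1: "(\<Sum>\<omega>\<in>W. pmf Q \<omega>) = 1" unfolding WQ by (rule sum_pmf_eq_1) (use finW WQ in auto)
    have "W \<noteq> {}" by (simp add: WQ set_pmf_not_empty)
    have "q = (\<Sum>\<omega>\<in>W. pmf Q \<omega> * q)" using sum1 by (simp add: sum_distrib_right[symmetric])
    also have "\<dots> < (\<Sum>\<omega>\<in>W. pmf Q \<omega> * measure \<nu> (B \<omega>))"
      using gt finW \<open>W \<noteq> {}\<close> by (intro sum_strict_mono mult_strict_left_mono) (auto simp: WQ pmf_positive)
    also have "\<dots> = (\<Sum>\<omega>\<in>W. (\<integral>x. pmf Q \<omega> * indicator (B \<omega>) x \<partial>\<nu>))"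
      by (intro sum.cong refl) (simp add: B_def Int_def conj_ac)
    \<comment> \<open>Exchanging sum and integral leaves, at each \<open>x\<close>, the probability
      that \<open>maurey_pointwise\<close> bounds.\<close>
    also have "\<dots> = (\<integral>x. (\<Sum>\<omega>\<in>W. pmf Q \<omega> * indicator (B \<omega>) x) \<partial>\<nu>)"
      by (intro Bochner_Integration.integral_sum[symmetric] integrable_mult_right int_ind)
    also have "\<dots> \<le> (\<integral>x. q \<partial>\<nu>)"
    proof (rule integral_mono)
      fix x assume x: "x \<in> space \<nu>"
      let ?S = "{\<omega>. 2 * \<delta> \<le> cmod (h x - (\<Sum>k<n. \<psi> (\<omega> k) x) / of_nat n)}"
      have "indicator (B \<omega>) x = (indicator ?S \<omega> :: real)" for \<omega>
        using x by (auto simp: B_def indicator_def)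
      then have "(\<Sum>\<omega>\<in>W. pmf Q \<omega> * indicator (B \<omega>) x) = (\<Sum>\<omega>\<in>W. pmf Q \<omega> *\<^sub>R indicator ?S \<omega>)"
        by simp
      also have "\<dots> = measure_pmf.expectation Q (indicator ?S)"
        by (rule integral_measure_pmf[OF finW, symmetric]) (auto simp: WQ)
      also have "\<dots> = measure_pmf.prob Q ?S"
        by simp
      also have "\<dots> \<le> q"
        unfolding h_def Q_def q_def using x bound by (intro maurey_pointwise fin n \<delta>) auto
      finally show "(\<Sum>\<omega>\<in>W. pmf Q \<omega> * indicator (B \<omega>) x) \<le> q" .
    qed (auto intro!: Bochner_Integration.integrable_sum integrable_mult_right int_ind)
    finally show False by (simp add: prob_space)
  qed
  then show ?thesis using that by (auto simp: W_def B_def h_def q_def)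
qed

section \<open>Chernoff bounds for the empirical measure of a fixed set\<close>

lemma emp_avg_real: "1 \<le> m \<Longrightarrow> real m * emp_avg m \<xi> g = (\<Sum>\<nu>=1..m. g (\<xi> \<nu>))"
  by (simp add: emp_avg_def)

text \<open>By independence the expectation factorizes; each factor has mean
  \<open>1 + (exp l - 1) * measure \<mu> A\<close>, and \<open>1 + x \<le> exp x\<close>. Both signs
  of \<open>l\<close> are allowed, one for each tail.\<close>

lemma empirical_mgf:
  fixes \<mu> :: "'a measure" and l :: real
  assumes \<mu>: "prob_space \<mu>" and A: "A \<in> sets \<mu>" and m: "1 \<le> m"
  shows "integrable (\<Pi>\<^sub>M \<nu>\<in>{1..m}. \<mu>) (\<lambda>\<xi>. exp (l * (real m * emp_avg m \<xi> (indicator A))))"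
    and "(\<integral>\<xi>. exp (l * (real m * emp_avg m \<xi> (indicator A))) \<partial>(\<Pi>\<^sub>M \<nu>\<in>{1..m}. \<mu>))
      \<le> exp (real m * measure \<mu> A * (exp l - 1))"
proof -
  interpret \<mu>: prob_space \<mu> by fact
  interpret product_sigma_finite "\<lambda>_::nat. \<mu>" by unfold_locales
  let ?P = "\<Pi>\<^sub>M \<nu>\<in>{1..m}. \<mu>"
  have eq: "(\<lambda>\<xi>. exp (l * (real m * emp_avg m \<xi> (indicator A)))) = (\<lambda>\<xi>. \<Prod>\<nu>\<in>{1..m}. exp (l * indicator A (\<xi> \<nu>)))"
    using m by (simp only: emp_avg_real sum_distrib_left exp_sum finite_atLeastAtMost)
  have exp_ind: "exp (l * indicator A x) = 1 + (exp l - 1) * indicator A x" for x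
    by (simp add: indicator_def)
  have intA: "integrable \<mu> (indicator A :: 'a \<Rightarrow> real)"
    using A by (intro \<mu>.integrable_const_bound[where B = 1]) auto
  have int: "integrable \<mu> (\<lambda>x. exp (l * indicator A x))"
    unfolding exp_ind using intA by simp
  show "integrable ?P (\<lambda>\<xi>. exp (l * (real m * emp_avg m \<xi> (indicator A))))"
    unfolding eq using int by (intro product_integrable_prod) auto
  have "(\<integral>\<xi>. exp (l * (real m * emp_avg m \<xi> (indicator A))) \<partial>?P) = (\<Prod>\<nu>\<in>{1..m}. \<integral>x. exp (l * indicator A x) \<partial>\<mu>)"
    unfolding eq using int by (intro product_integral_prod) auto
  also have "(\<integral>x. exp (l * indicator A x) \<partial>\<mu>) = 1 + (exp l - 1) * measure \<mu> A"
    unfolding exp_ind using intA sets.sets_into_space[OF A]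
    by (simp add: \<mu>.prob_space inf.absorb1)
  also have "(\<Prod>\<nu>\<in>{1..m}. 1 + (exp l - 1) * measure \<mu> A) = (1 + (exp l - 1) * measure \<mu> A) ^ m" by simp
  also have "\<dots> \<le> exp ((exp l - 1) * measure \<mu> A) ^ m"
  proof (rule power_mono)
    have "0 \<le> (1 - measure \<mu> A) + exp l * measure \<mu> A"
      using \<mu>.prob_le_1[of A] by (intro add_nonneg_nonneg mult_nonneg_nonneg) auto
    then show "0 \<le> 1 + (exp l - 1) * measure \<mu> A" by (simp add: algebra_simps)
  qed (rule exp_ge_add_one_self)
  also have "\<dots> = exp (real m * measure \<mu> A * (exp l - 1))"
    by (simp add: exp_of_nat_mult[symmetric] mult_ac)
  finally show "(\<integral>\<xi>. exp (l * (real m * emp_avg m \<xi> (indicator A))) \<partial>?P)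
      \<le> exp (real m * measure \<mu> A * (exp l - 1))" .
qed

text \<open>Since a factor 2 may be lost, the fixed exponents \<open>l = 1\<close> and
  \<open>l = -1\<close> suffice: \<open>exp 1 - 1 \<le> 2\<close> and
  \<open>exp (- 1) \<le> 1 / 2\<close> make the contributions of \<open>measure \<mu> A\<close>
  cancel, and the tail depends on \<open>m * \<tau>\<close> alone.\<close>

lemma empirical_tail:
  fixes \<mu> :: "'a measure"
  assumes \<mu>: "prob_space \<mu>" and A: "A \<in> sets \<mu>" and m: "1 \<le> m"
  defines "P \<equiv> (\<Pi>\<^sub>M \<nu>\<in>{1..m}. \<mu>)"
  shows "{\<xi> \<in> space P. 2 * measure \<mu> A + \<tau> < emp_avg m \<xi> (indicator A)} \<in> sets P"
    and "measure P {\<xi> \<in> space P. 2 * measure \<mu> A + \<tau> < emp_avg m \<xi> (indicator A)} \<le> exp (- real m * \<tau>)"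
    and "{\<xi> \<in> space P. 2 * emp_avg m \<xi> (indicator A) + \<tau> < measure \<mu> A} \<in> sets P"
    and "measure P {\<xi> \<in> space P. 2 * emp_avg m \<xi> (indicator A) + \<tau> < measure \<mu> A} \<le> exp (- real m * \<tau> / 2)"
proof -
  interpret \<mu>: prob_space \<mu> by fact
  interpret P: prob_space P unfolding P_def by (intro prob_space_PiM \<mu>)
  have [measurable]: "(\<lambda>\<xi>. emp_avg m \<xi> (indicator A) :: real) \<in> borel_measurable P"
    unfolding emp_avg_def P_def using A
    by (intro borel_measurable_divide borel_measurable_sum borel_measurable_const
      measurable_compose[OF measurable_component_singleton] borel_measurable_indicator) auto
  show S1: "{\<xi> \<in> space P. 2 * measure \<mu> A + \<tau> < emp_avg m \<xi> (indicator A)} \<in> sets P" by measurable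
  show S2: "{\<xi> \<in> space P. 2 * emp_avg m \<xi> (indicator A) + \<tau> < measure \<mu> A} \<in> sets P" by measurable
  \<comment> \<open>Markov's inequality for the exponential moment; a negative \<open>l\<close>
    turns it into a bound for the lower tail.\<close>
  have *: "measure P S \<le> exp (real m * measure \<mu> A * (exp l - 1) - c)"
    if S: "S \<in> sets P" "\<And>\<xi>. \<xi> \<in> S \<Longrightarrow> c \<le> l * (real m * emp_avg m \<xi> (indicator A))" for S c l
  proof -
    define Z where "Z \<xi> = exp (l * (real m * emp_avg m \<xi> (indicator A)))" for \<xi>
    have int: "integrable P Z" unfolding Z_def P_def by (rule empirical_mgf[OF \<mu> A m])
    have "measure P S \<le> measure P {\<xi> \<in> space P. exp c \<le> Z \<xi>}"
      using S sets.sets_into_space[OF S(1)] int by (intro P.finite_measure_mono) (auto simp: Z_def)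
    also have "\<dots> \<le> (\<integral>\<xi>. Z \<xi> \<partial>P) / exp c"
      by (rule integral_Markov_inequality_measure[where A = "space P", OF int]) (auto simp: Z_def)
    also have "\<dots> \<le> exp (real m * measure \<mu> A * (exp l - 1)) / exp c"
      unfolding Z_def P_def by (intro divide_right_mono empirical_mgf[OF \<mu> A m]) simp
    finally show ?thesis by (simp add: exp_diff)
  qed
  have "measure P {\<xi> \<in> space P. 2 * measure \<mu> A + \<tau> < emp_avg m \<xi> (indicator A)}
      \<le> exp (real m * measure \<mu> A * (exp 1 - 1) - real m * (2 * measure \<mu> A + \<tau>))"
    by (rule *[OF S1]) (auto intro!: mult_left_mono)
  also have "\<dots> \<le> exp (real m * measure \<mu> A * 2 - real m * (2 * measure \<mu> A + \<tau>))"
    using exp_le by (subst exp_le_cancel_iff, intro diff_right_mono mult_left_mono) auto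
  also have "\<dots> = exp (- real m * \<tau>)" by (simp add: algebra_simps)
  finally show "measure P {\<xi> \<in> space P. 2 * measure \<mu> A + \<tau> < emp_avg m \<xi> (indicator A)} \<le> exp (- real m * \<tau>)" .
  have "measure P {\<xi> \<in> space P. 2 * emp_avg m \<xi> (indicator A) + \<tau> < measure \<mu> A}
      \<le> exp (real m * measure \<mu> A * (exp (- 1) - 1) - (- (real m * ((measure \<mu> A - \<tau>) / 2))))"
  proof (rule *[OF S2])
    fix \<xi> assume "\<xi> \<in> {\<xi> \<in> space P. 2 * emp_avg m \<xi> (indicator A) + \<tau> < measure \<mu> A}"
    then have "real m * emp_avg m \<xi> (indicator A) \<le> real m * ((measure \<mu> A - \<tau>) / 2)"
      by (intro mult_left_mono) auto
    then show "- (real m * ((measure \<mu> A - \<tau>) / 2)) \<le> - 1 * (real m * emp_avg m \<xi> (indicator A))" by simp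
  qed
  also have "\<dots> \<le> exp (real m * measure \<mu> A * (1 / 2 - 1) - (- (real m * ((measure \<mu> A - \<tau>) / 2))))"
  proof -
    have "exp (- 1) \<le> (1 / 2 :: real)" using exp_ge_add_one_self[of "1::real"] by (simp add: exp_minus field_simps)
    then show ?thesis by (subst exp_le_cancel_iff, intro diff_right_mono mult_left_mono) auto
  qed
  also have "\<dots> = exp (- real m * \<tau> / 2)" by (simp add: algebra_simps add_divide_distrib diff_divide_distrib)
  finally show "measure P {\<xi> \<in> space P. 2 * emp_avg m \<xi> (indicator A) + \<tau> < measure \<mu> A} \<le> exp (- real m * \<tau> / 2)" .
qed

section \<open>Comparison of level sets\<close>

text \<open>Dyadic layers, by induction on the cutoff: either the new level is exceeded and its
  weight \<open>16 * (1 / 4) ^ Suc t\<close> pays for the old remainder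
  \<open>4 * (1 / 4) ^ t\<close>, or \<open>y \<le> (1 / 2) ^ t\<close> and the new remainder covers
  \<open>y\<^sup>2\<close> by itself.\<close>

lemma sq_le_levels:
  fixes y :: real
  assumes "0 \<le> y" "y \<le> 1"
  shows "y\<^sup>2 \<le> 4 * (1 / 4) ^ t + (\<Sum>i\<le>t. 16 * (1 / 4) ^ i * of_bool (2 * (1 / 2) ^ i < y))"
proof (induction t)
  case 0
  have "y\<^sup>2 \<le> 1" using assms by (intro power_le_one)
  then show ?case by simp
next
  case (Suc t)
  show ?case
  proof (cases "2 * (1 / 2) ^ Suc t < y")
    case True
    then have "(\<Sum>i\<le>Suc t. 16 * (1 / 4 :: real) ^ i * of_bool (2 * (1 / 2) ^ i < y))
        = (\<Sum>i\<le>t. 16 * (1 / 4) ^ i * of_bool (2 * (1 / 2) ^ i < y)) + 4 * (1 / 4) ^ t" by simp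
    moreover have "(0 :: real) \<le> 4 * (1 / 4) ^ Suc t" by simp
    ultimately show ?thesis using Suc by linarith
  next
    case False
    then have "y\<^sup>2 \<le> ((1 / 2) ^ t)\<^sup>2" using assms by (intro power_mono) auto
    also have "\<dots> = (1 / 4) ^ t" by (simp add: power_divide power_mult[symmetric] mult.commute[of _ 2] power_mult)
    moreover have "0 \<le> (\<Sum>i\<le>Suc t. 16 * (1 / 4) ^ i * of_bool (2 * (1 / 2) ^ i < y) :: real)"
      by (intro sum_nonneg) auto
    ultimately show ?thesis by simp
  qed
qed

lemma sum_quarter_powers: "(\<Sum>i\<le>t. (1 / 4 :: real) ^ i) \<le> 4 / 3"
proof -
  have "(\<Sum>i\<le>t. (1 / 4 :: real) ^ i) = 4 / 3 - (1 / 3) * (1 / 4) ^ t"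
    by (induction t) auto
  then show ?thesis by simp
qed

text \<open>The weights form a geometric series, dominated by the first level that \<open>y\<close>
  exceeds. The induction uses scaling: for \<open>y \<le> 1\<close> level 0 drops out, and passing
  to \<open>2 * y\<close> shifts the other levels by one.\<close>

lemma levels_le_sq:
  fixes y :: real
  assumes "0 \<le> y"
  shows "(\<Sum>i\<le>t. (1 / 4) ^ i * of_bool ((1 / 2) ^ i < y)) \<le> 4 / 3 * y\<^sup>2"
  using assms
proof (induction t arbitrary: y)
  case 0
  show ?case
  proof (cases "1 < y")
    case True
    then have "1 \<le> y\<^sup>2" by (simp add: one_le_power)
    then show ?thesis by (simp add: True)
  qed simp
next
  case (Suc t)
  show ?case
  proof (cases "1 < y")
    case True
    have "1 \<le> y\<^sup>2" using True by (simp add: one_le_power)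
    have "(\<Sum>i\<le>Suc t. (1 / 4) ^ i * of_bool ((1 / 2) ^ i < y)) \<le> (\<Sum>i\<le>Suc t. (1 / 4 :: real) ^ i)"
      by (intro sum_mono) (simp add: of_bool_def)
    also note sum_quarter_powers
    also have "4 / 3 \<le> 4 / 3 * y\<^sup>2" using \<open>1 \<le> y\<^sup>2\<close> by simp
    finally show ?thesis .
  next
    case False
    have "(\<Sum>i\<le>Suc t. (1 / 4 :: real) ^ i * of_bool ((1 / 2) ^ i < y))
        = 1 / 4 * (\<Sum>i\<le>t. (1 / 4) ^ i * of_bool ((1 / 2) ^ i < 2 * y))"
      using False by (subst sum.atMost_Suc_shift) (simp add: sum_distrib_left mult_ac del: sum_mult_of_bool_eq)
    also have "\<dots> \<le> 1 / 4 * (4 / 3 * (2 * y)\<^sup>2)"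
      using Suc.IH[of "2 * y"] Suc.prems by (intro mult_left_mono) auto
    finally show ?thesis by (simp add: power_mult_distrib)
  qed
qed

text \<open>The levels on the left have twice the height of those on the right, which leaves room
  for an approximation of \<open>h\<close> in between. The constant is
  \<open>16 * 2 * (4 / 3)\<close>, from the two layer inequalities and the factor 2 in the
  comparison of levels.\<close>

lemma integral_sq_level_transfer:
  fixes h :: "'a \<Rightarrow> complex"
  assumes \<nu>: "prob_space \<nu>" "prob_space \<nu>'" "sets \<nu>' = sets \<nu>"
    and h [measurable]: "h \<in> borel_measurable \<nu>" and bound: "\<And>x. x \<in> space \<nu> \<Longrightarrow> cmod (h x) \<le> 1"
    and levels: "\<And>i. i \<le> t \<Longrightarrow> measure \<nu> {x \<in> space \<nu>. 2 * (1 / 2) ^ i < cmod (h x)}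
       \<le> 2 * measure \<nu>' {x \<in> space \<nu>. (1 / 2) ^ i < cmod (h x)} + e i"
  shows "(\<integral>x. (cmod (h x))\<^sup>2 \<partial>\<nu>) \<le> 128 / 3 * (\<integral>x. (cmod (h x))\<^sup>2 \<partial>\<nu>')
     + (4 * (1 / 4) ^ t + 16 * (\<Sum>i\<le>t. (1 / 4) ^ i * e i))"
proof -
  interpret prob_space \<nu> by fact
  interpret \<nu>': prob_space \<nu>' by fact
  have sp: "space \<nu>' = space \<nu>" using \<nu>(3) by (rule sets_eq_imp_space_eq)
  have h' [measurable]: "h \<in> borel_measurable \<nu>'" using h \<nu>(3) by (simp cong: measurable_cong_sets)
  define A where "A c = {x \<in> space \<nu>. c < cmod (h x)}" for c :: real
  have A [measurable]: "A c \<in> sets \<nu>" for c unfolding A_def by measurable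
  have A' [measurable]: "A c \<in> sets \<nu>'" for c using A \<nu>(3) by simp
  have bound2: "(cmod (h x))\<^sup>2 \<le> 1" if "x \<in> space \<nu>" for x using bound[OF that] by (simp add: power_le_one)
  have int: "integrable \<nu> (\<lambda>x. (cmod (h x))\<^sup>2)"
    by (rule integrable_const_bound[where B = 1]) (auto simp: bound2)
  have int': "integrable \<nu>' (\<lambda>x. (cmod (h x))\<^sup>2)"
    by (rule \<nu>'.integrable_const_bound[where B = 1]) (auto simp: bound2 sp)
  have ind: "integrable \<nu> (indicator (A c) :: 'a \<Rightarrow> real)" "integrable \<nu>' (indicator (A c) :: 'a \<Rightarrow> real)" for c
    by (auto intro!: integrable_const_bound[where B = 1] \<nu>'.integrable_const_bound[where B = 1])
  have "(\<integral>x. (cmod (h x))\<^sup>2 \<partial>\<nu>)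
      \<le> (\<integral>x. 4 * (1 / 4) ^ t + (\<Sum>i\<le>t. 16 * (1 / 4) ^ i * indicator (A (2 * (1 / 2) ^ i)) x) \<partial>\<nu>)"
  proof (rule integral_mono[OF int])
    fix x assume "x \<in> space \<nu>"
    then show "(cmod (h x))\<^sup>2 \<le> 4 * (1 / 4) ^ t + (\<Sum>i\<le>t. 16 * (1 / 4) ^ i * indicator (A (2 * (1 / 2) ^ i)) x)"
      using sq_le_levels[of "cmod (h x)" t] bound[of x]
      by (simp add: A_def indicator_def of_bool_def del: indicator_simps)
  qed (intro Bochner_Integration.integrable_add integrable_const Bochner_Integration.integrable_sum
    integrable_mult_right ind)
  also have "\<dots> = 4 * (1 / 4) ^ t + (\<Sum>i\<le>t. 16 * (1 / 4) ^ i * measure \<nu> (A (2 * (1 / 2) ^ i)))"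
    using sets.sets_into_space[OF A] ind
    by (subst Bochner_Integration.integral_add)
       (simp_all add: prob_space Bochner_Integration.integral_sum inf.absorb1 del: sum_mult_indicator)
  also have "(\<Sum>i\<le>t. 16 * (1 / 4) ^ i * measure \<nu> (A (2 * (1 / 2) ^ i)))
      \<le> (\<Sum>i\<le>t. 16 * (1 / 4) ^ i * (2 * measure \<nu>' (A ((1 / 2) ^ i)) + e i))"
    using levels by (intro sum_mono mult_left_mono) (auto simp: A_def)
  also have "\<dots> = 32 * (\<Sum>i\<le>t. (1 / 4) ^ i * measure \<nu>' (A ((1 / 2) ^ i))) + 16 * (\<Sum>i\<le>t. (1 / 4) ^ i * e i)"
    by (simp add: sum_distrib_left sum.distrib[symmetric] algebra_simps)
  also have "(\<Sum>i\<le>t. (1 / 4) ^ i * measure \<nu>' (A ((1 / 2) ^ i)))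
      = (\<integral>x. (\<Sum>i\<le>t. (1 / 4) ^ i * indicator (A ((1 / 2) ^ i)) x) \<partial>\<nu>')"
    using sets.sets_into_space[OF A'] ind
    by (subst Bochner_Integration.integral_sum) (simp_all add: inf.absorb1)
  also have "\<dots> \<le> (\<integral>x. 4 / 3 * (cmod (h x))\<^sup>2 \<partial>\<nu>')"
  proof (rule integral_mono)
    fix x assume "x \<in> space \<nu>'"
    then show "(\<Sum>i\<le>t. (1 / 4) ^ i * indicator (A ((1 / 2) ^ i)) x) \<le> 4 / 3 * (cmod (h x))\<^sup>2"
      using levels_le_sq[of "cmod (h x)" t] by (simp add: A_def sp indicator_def of_bool_def del: indicator_simps)
  qed (intro Bochner_Integration.integrable_sum integrable_mult_right ind int')+
  also have "\<dots> = 4 / 3 * (\<integral>x. (cmod (h x))\<^sup>2 \<partial>\<nu>')" by simp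
  finally show ?thesis by simp
qed

text \<open>An error below \<open>r / 4\<close> cannot bridge the gaps between the heights
  \<open>2 * r\<close>, \<open>3 / 2 * r\<close> and \<open>r\<close>, so off the exceptional set
  the level sets of \<open>h\<close> and \<open>g\<close> are nested. That set enters once for
  \<open>\<nu>\<close> and twice for \<open>\<nu>'\<close>, whence \<open>3 * \<gamma>\<close>. Only
  \<open>g\<close>, which will come from a finite family, is compared directly.\<close>

lemma level_transfer:
  fixes h g :: "'a \<Rightarrow> complex"
  assumes r: "0 < r" and \<nu>: "prob_space \<nu>" "prob_space \<nu>'" "sets \<nu>' = sets \<nu>"
    and [measurable]: "h \<in> borel_measurable \<nu>" "g \<in> borel_measurable \<nu>"
    and B: "measure \<nu> {x \<in> space \<nu>. r / 4 \<le> cmod (h x - g x)} \<le> \<gamma>"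
      "measure \<nu>' {x \<in> space \<nu>. r / 4 \<le> cmod (h x - g x)} \<le> \<gamma>"
    and A: "measure \<nu> {x \<in> space \<nu>. 3 / 2 * r < cmod (g x)}
      \<le> 2 * measure \<nu>' {x \<in> space \<nu>. 3 / 2 * r < cmod (g x)} + \<tau>"
  shows "measure \<nu> {x \<in> space \<nu>. 2 * r < cmod (h x)}
      \<le> 2 * measure \<nu>' {x \<in> space \<nu>. r < cmod (h x)} + (\<tau> + 3 * \<gamma>)"
proof -
  interpret prob_space \<nu> by fact
  interpret \<nu>': prob_space \<nu>' by fact
  define B where "B = {x \<in> space \<nu>. r / 4 \<le> cmod (h x - g x)}"
  define A where "A = {x \<in> space \<nu>. 3 / 2 * r < cmod (g x)}"
  define H where "H c = {x \<in> space \<nu>. c < cmod (h x)}" for c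
  have [measurable]: "B \<in> sets \<nu>" "A \<in> sets \<nu>" "H c \<in> sets \<nu>" for c
    by (auto simp: B_def A_def H_def)
  have [measurable]: "B \<in> sets \<nu>'" "A \<in> sets \<nu>'" "H c \<in> sets \<nu>'" for c
    using \<nu>(3) by auto
  have "H (2 * r) \<subseteq> A \<union> B"
  proof
    fix x assume "x \<in> H (2 * r)"
    moreover have "cmod (h x) \<le> cmod (g x) + cmod (h x - g x)"
      using norm_triangle_ineq[of "g x" "h x - g x"] by simp
    ultimately show "x \<in> A \<union> B" using r by (auto simp: H_def A_def B_def)
  qed
  then have "measure \<nu> (H (2 * r)) \<le> measure \<nu> (A \<union> B)" by (intro finite_measure_mono) auto
  also have "\<dots> \<le> measure \<nu> A + measure \<nu> B" by (intro measure_Un_le) auto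
  finally have 1: "measure \<nu> (H (2 * r)) \<le> measure \<nu> A + measure \<nu> B" .
  have 2: "measure \<nu> A \<le> 2 * measure \<nu>' A + \<tau>" using A(1) by (simp add: A_def)
  have "measure \<nu>' A \<le> measure \<nu>' (H r \<union> B)"
  proof (rule \<nu>'.finite_measure_mono)
    show "A \<subseteq> H r \<union> B"
    proof
      fix x assume "x \<in> A"
      moreover have "cmod (g x) \<le> cmod (h x) + cmod (h x - g x)"
        using norm_triangle_ineq4[of "h x" "h x - g x"] by simp
      ultimately show "x \<in> H r \<union> B" using r by (auto simp: H_def A_def B_def)
    qed
  qed auto
  also have "\<dots> \<le> measure \<nu>' (H r) + measure \<nu>' B" by (intro measure_Un_le) auto
  finally have "measure \<nu>' A \<le> measure \<nu>' (H r) + measure \<nu>' B" .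
  with 1 2 show ?thesis using B unfolding B_def[symmetric] H_def[symmetric] by linarith
qed

section \<open>Finite nets of dictionary averages and the good event\<close>

context
  fixes \<mu> :: "'a measure" and \<psi> :: "'i \<Rightarrow> 'a \<Rightarrow> complex" and I :: "'i set" and d :: 'i
    and m t L :: nat and \<eta> :: real
begin

text \<open>The exponent in Hoeffding's bound for the accuracy \<open>(1 / 2) ^ i / 8\<close> of the real and the
  imaginary part is then exactly \<open>L\<close>.\<close>

definition samples :: "nat \<Rightarrow> nat" where "samples i = 512 * 4 ^ i * L"

text \<open>The default value \<open>d\<close> makes a realization a total function without adding
  choices, so the net is finite. It contains the realizations of Maurey's method for every
  distribution on \<open>I\<close>.\<close>

definition net :: "nat \<Rightarrow> (nat \<Rightarrow> 'i) set" where "net i = PiE_dflt {..<samples i} d (\<lambda>_. I)"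

definition net_avg :: "nat \<Rightarrow> (nat \<Rightarrow> 'i) \<Rightarrow> 'a \<Rightarrow> complex" where
  "net_avg i \<omega> x = (\<Sum>k<samples i. \<psi> (\<omega> k) x) / of_nat (samples i)"

definition net_level :: "nat \<Rightarrow> (nat \<Rightarrow> 'i) \<Rightarrow> 'a set" where
  "net_level i \<omega> = {x \<in> space \<mu>. 3 / 2 * (1 / 2) ^ i < cmod (net_avg i \<omega> x)}"

text \<open>Grows with \<open>i\<close> like the logarithm of the net size; under the level weights
  \<open>(1 / 4) ^ i\<close> the \<open>t + 1\<close> levels together contribute exactly
  \<open>\<eta>\<close>.\<close>

definition slack :: "nat \<Rightarrow> real" where "slack i = 4 ^ i * \<eta> / (real t + 1)"

text \<open>Finitely many conditions, fixed before sampling and free of any particular combination,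
  that nevertheless control the whole convex hull of the dictionary.\<close>

definition good_samples :: "(nat \<Rightarrow> 'a) set" where
  "good_samples = {\<xi> \<in> space (\<Pi>\<^sub>M \<nu>\<in>{1..m}. \<mu>). \<forall>i\<le>t. \<forall>\<omega>\<in>net i.
     emp_avg m \<xi> (indicator (net_level i \<omega>)) \<le> 2 * measure \<mu> (net_level i \<omega>) + slack i \<and>
     measure \<mu> (net_level i \<omega>) \<le> 2 * emp_avg m \<xi> (indicator (net_level i \<omega>)) + slack i}"

context
  assumes \<mu>: "prob_space \<mu>" and fin: "finite I"
    and meas: "\<And>i. i \<in> I \<Longrightarrow> \<psi> i \<in> borel_measurable \<mu>"
    and bound: "\<And>i x. i \<in> I \<Longrightarrow> x \<in> space \<mu> \<Longrightarrow> cmod (\<psi> i x) \<le> 2"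
    and m: "1 \<le> m" and L: "1 \<le> L" and \<eta>: "0 < \<eta>"
begin

lemma finite_net: "finite (net i)" unfolding net_def using fin by (intro finite_PiE_dflt) auto

lemma card_net: "card (net i) = card I ^ samples i"
  unfolding net_def by (subst card_PiE_dflt) (auto simp: fin)

lemma net_avg_measurable: "\<omega> \<in> net i \<Longrightarrow> net_avg i \<omega> \<in> borel_measurable \<mu>"
proof -
  assume "\<omega> \<in> net i"
  then have [measurable]: "(\<lambda>x. \<Sum>k<samples i. \<psi> (\<omega> k) x) \<in> borel_measurable \<mu>"
    using meas by (intro borel_measurable_sum) (auto simp: net_def PiE_dflt_def)
  show ?thesis unfolding net_avg_def[abs_def] by measurable
qed

lemma net_level_sets: "\<omega> \<in> net i \<Longrightarrow> net_level i \<omega> \<in> sets \<mu>"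
  unfolding net_level_def using net_avg_measurable by measurable

lemma good_samples_prob:
  shows "good_samples \<in> sets (\<Pi>\<^sub>M \<nu>\<in>{1..m}. \<mu>)"
    and "1 - (\<Sum>i\<le>t. real (card I ^ samples i) * (2 * exp (- real m * slack i / 2)))
      \<le> measure (\<Pi>\<^sub>M \<nu>\<in>{1..m}. \<mu>) good_samples"
proof -
  define P where "P = (\<Pi>\<^sub>M \<nu>\<in>{1..m}. \<mu>)"
  interpret P: prob_space P unfolding P_def by (intro prob_space_PiM \<mu>)
  define B1 where "B1 i \<omega> = {\<xi> \<in> space P. 2 * measure \<mu> (net_level i \<omega>) + slack i < emp_avg m \<xi> (indicator (net_level i \<omega>))}" for i \<omega>
  define B2 where "B2 i \<omega> = {\<xi> \<in> space P. 2 * emp_avg m \<xi> (indicator (net_level i \<omega>)) + slack i < measure \<mu> (net_level i \<omega>)}" for i \<omega>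
  define bad where "bad = (\<Union>i\<le>t. \<Union>\<omega>\<in>net i. B1 i \<omega> \<union> B2 i \<omega>)"
  have slack: "0 \<le> slack i" for i using \<eta> by (simp add: slack_def)
  have B: "B1 i \<omega> \<in> sets P" "measure P (B1 i \<omega>) \<le> exp (- real m * slack i / 2)"
      "B2 i \<omega> \<in> sets P" "measure P (B2 i \<omega>) \<le> exp (- real m * slack i / 2)" if "\<omega> \<in> net i" for i \<omega>
  proof -
    note tails = empirical_tail[OF \<mu> net_level_sets[OF that] m, where \<tau> = "slack i", folded P_def]
    show "B1 i \<omega> \<in> sets P" "B2 i \<omega> \<in> sets P" "measure P (B2 i \<omega>) \<le> exp (- real m * slack i / 2)"
      unfolding B1_def B2_def using tails by auto
    have "measure P (B1 i \<omega>) \<le> exp (- real m * slack i)" unfolding B1_def by (rule tails(2))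
    also have "\<dots> \<le> exp (- real m * slack i / 2)" using slack[of i] by simp
    finally show "measure P (B1 i \<omega>) \<le> exp (- real m * slack i / 2)" .
  qed
  have bad: "bad \<in> sets P"
    unfolding bad_def using B finite_net by (intro sets.finite_UN) auto
  have "good_samples = {\<xi> \<in> space P. \<forall>i\<le>t. \<forall>\<omega>\<in>net i. \<xi> \<notin> B1 i \<omega> \<and> \<xi> \<notin> B2 i \<omega>}"
    unfolding good_samples_def P_def[symmetric] B1_def B2_def
    by (intro Collect_cong conj_cong refl) (simp add: not_less)
  also have "\<dots> = space P - bad" by (auto simp: bad_def)
  finally have good: "good_samples = space P - bad" .
  show "good_samples \<in> sets (\<Pi>\<^sub>M \<nu>\<in>{1..m}. \<mu>)" unfolding good P_def[symmetric] using bad by auto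
  have "measure P bad \<le> (\<Sum>i\<le>t. measure P (\<Union>\<omega>\<in>net i. B1 i \<omega> \<union> B2 i \<omega>))"
    unfolding bad_def using B finite_net by (intro measure_UNION_le) (auto intro!: sets.finite_UN)
  also have "\<dots> \<le> (\<Sum>i\<le>t. \<Sum>\<omega>\<in>net i. measure P (B1 i \<omega> \<union> B2 i \<omega>))"
    using B finite_net by (intro sum_mono measure_UNION_le) auto
  also have "\<dots> \<le> (\<Sum>i\<le>t. \<Sum>\<omega>\<in>net i. 2 * exp (- real m * slack i / 2))"
  proof (intro sum_mono)
    fix i \<omega> assume w: "\<omega> \<in> net i"
    have "measure P (B1 i \<omega> \<union> B2 i \<omega>) \<le> measure P (B1 i \<omega>) + measure P (B2 i \<omega>)"
      using B[OF w] by (intro measure_Un_le) auto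
    with B[OF w] show "measure P (B1 i \<omega> \<union> B2 i \<omega>) \<le> 2 * exp (- real m * slack i / 2)" by simp
  qed
  also have "\<dots> = (\<Sum>i\<le>t. real (card I ^ samples i) * (2 * exp (- real m * slack i / 2)))"
    by (simp add: card_net)
  finally show "1 - (\<Sum>i\<le>t. real (card I ^ samples i) * (2 * exp (- real m * slack i / 2)))
      \<le> measure (\<Pi>\<^sub>M \<nu>\<in>{1..m}. \<mu>) good_samples"
    unfolding good P_def[symmetric] using P.prob_compl[OF bad] by simp
qed

lemma good_samples_transfer:
  assumes \<xi>: "\<xi> \<in> good_samples" and p: "set_pmf p \<subseteq> I"
    and h: "\<And>x. h x = measure_pmf.expectation p (\<lambda>i. \<psi> i x)"
    and h1: "\<And>x. x \<in> space \<mu> \<Longrightarrow> cmod (h x) \<le> 1"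
  defines "R \<equiv> 4 * (1 / 4) ^ t + 16 * \<eta> + 512 * exp (- real L)"
  shows "(\<integral>x. (cmod (h x))\<^sup>2 \<partial>\<mu>) \<le> 128 / 3 * emp_avg m \<xi> (\<lambda>x. (cmod (h x))\<^sup>2) + R"
    and "emp_avg m \<xi> (\<lambda>x. (cmod (h x))\<^sup>2) \<le> 128 / 3 * (\<integral>x. (cmod (h x))\<^sup>2 \<partial>\<mu>) + R"
proof -
  interpret prob_space \<mu> by fact
  have \<xi>s: "\<xi> \<in> {1..m} \<rightarrow> space \<mu>"
    using \<xi> by (auto simp: good_samples_def space_PiM)
  note emp = prob_space_emp[OF m \<xi>s] sets_emp[OF m \<xi>s] measure_emp[OF m \<xi>s] integral_emp[OF m \<xi>s]
  note mix = prob_space_mix[OF m \<xi>s \<mu>] sets_mix[OF m \<xi>s] space_mix[OF m \<xi>s] measure_le_mix[OF m \<xi>s \<mu>]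
  define \<nu> where "\<nu> = emp_measure \<mu> m \<xi>"
  have finp: "finite (set_pmf p)" using p fin finite_subset by blast
  have hs: "h = (\<lambda>x. \<Sum>i\<in>set_pmf p. pmf p i *\<^sub>R \<psi> i x)"
    unfolding h by (intro ext integral_measure_pmf[OF finp]) auto
  have hm [measurable]: "h \<in> borel_measurable \<mu>"
    unfolding hs using meas p by (intro borel_measurable_sum borel_measurable_scaleR) auto
  \<comment> \<open>Maurey's method gives \<open>4 * exp (- real L)\<close> for the mixture, hence
    twice that for each of the two measures.\<close>
  define \<gamma> where "\<gamma> = 8 * exp (- real L)"
  have ex: "\<exists>\<omega>\<in>net i. measure \<mu> {x \<in> space \<mu>. (1 / 2) ^ i / 4 \<le> cmod (h x - net_avg i \<omega> x)} \<le> \<gamma> \<and>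
      measure \<nu> {x \<in> space \<mu>. (1 / 2) ^ i / 4 \<le> cmod (h x - net_avg i \<omega> x)} \<le> \<gamma>" for i
  proof -
    define n where "n = samples i"
    define \<delta> :: real where "\<delta> = (1 / 2) ^ i / 8"
    have n: "0 < n" using L by (simp add: n_def samples_def)
    have "real n * \<delta>\<^sup>2 / 8 = real L"
    proof -
      have "\<delta>\<^sup>2 = (1 / 4) ^ i / 64"
        by (simp add: \<delta>_def power_divide power_mult[symmetric] mult.commute[of i 2] power_mult)
      then show ?thesis by (simp add: n_def samples_def power_divide)
    qed
    then have rate: "4 * exp (- real n * \<delta>\<^sup>2 / 8) = 4 * exp (- real L)" by simp
    \<comment> \<open>The mixture depends on \<open>\<xi>\<close>, and so does the realization; this
      is harmless because a good sample controls every element of the net.\<close>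
    obtain \<omega> where w: "\<omega> \<in> PiE_dflt {..<n} d (\<lambda>_. set_pmf p)"
      "measure (mix_measure \<mu> m \<xi>) {x \<in> space (mix_measure \<mu> m \<xi>). 2 * \<delta> \<le> cmod (measure_pmf.expectation p (\<lambda>i. \<psi> i x) - (\<Sum>k<n. \<psi> (\<omega> k) x) / of_nat n)}
      \<le> 4 * exp (- real n * \<delta>\<^sup>2 / 8)"
    proof (rule maurey[OF mix(1) finp _ _ n])
      show "\<psi> j \<in> borel_measurable (mix_measure \<mu> m \<xi>)" if "j \<in> set_pmf p" for j
        using meas[of j] that p mix(2) by (auto cong: measurable_cong_sets)
      show "cmod (\<psi> j x) \<le> 2" if "j \<in> set_pmf p" "x \<in> space (mix_measure \<mu> m \<xi>)" for j x
        using bound[of j x] that p mix(3) by auto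
      show "0 \<le> \<delta>" by (simp add: \<delta>_def)
    qed
    define B where "B = {x \<in> space \<mu>. (1 / 2) ^ i / 4 \<le> cmod (h x - net_avg i \<omega> x)}"
    have wn: "\<omega> \<in> net i" using w(1) p by (auto simp: net_def n_def PiE_dflt_def)
    have [measurable]: "B \<in> sets \<mu>"
      unfolding B_def using net_avg_measurable[OF wn] by measurable
    have "space (mix_measure \<mu> m \<xi>) = space \<mu>"
      by (rule sets_eq_imp_space_eq) (rule mix(2))
    then have "B = {x \<in> space (mix_measure \<mu> m \<xi>). 2 * \<delta> \<le> cmod (measure_pmf.expectation p (\<lambda>i. \<psi> i x) - (\<Sum>k<n. \<psi> (\<omega> k) x) / of_nat n)}"
      by (simp add: B_def h net_avg_def n_def \<delta>_def)
    with w(2) rate have "measure (mix_measure \<mu> m \<xi>) B \<le> 4 * exp (- real L)" by simp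
    then have "measure \<mu> B \<le> \<gamma>" "measure \<nu> B \<le> \<gamma>"
      using mix(4,5)[of B] by (auto simp: \<gamma>_def \<nu>_def)
    with wn show ?thesis by (auto simp: B_def)
  qed
  have good: "measure \<nu> (net_level i \<omega>) \<le> 2 * measure \<mu> (net_level i \<omega>) + slack i"
     "measure \<mu> (net_level i \<omega>) \<le> 2 * measure \<nu> (net_level i \<omega>) + slack i"
     if "i \<le> t" "\<omega> \<in> net i" for i \<omega>
    using \<xi> that emp(3)[OF net_level_sets[OF that(2)]] by (auto simp: good_samples_def \<nu>_def)
  have p\<nu>: "prob_space \<nu>" and s\<nu>: "sets \<nu> = sets \<mu>" unfolding \<nu>_def by (rule emp(1), rule emp(2))
  have sp\<nu>: "space \<nu> = space \<mu>" using s\<nu> by (rule sets_eq_imp_space_eq)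
  have \<nu>m: "g \<in> borel_measurable \<nu>" if "g \<in> borel_measurable \<mu>" for g :: "'a \<Rightarrow> complex"
    using that measurable_cong_sets[OF s\<nu> refl] by auto
  have int\<nu>: "(\<integral>x. (cmod (h x))\<^sup>2 \<partial>\<nu>) = emp_avg m \<xi> (\<lambda>x. (cmod (h x))\<^sup>2)"
    unfolding \<nu>_def by (rule emp(4)) measurable
  \<comment> \<open>The terms of \<open>R\<close> come from the truncation of the levels, the slack,
    and the exceptional sets; the last constant is
    \<open>16 * (4 / 3) * 3 * 8 = 512\<close>.\<close>
  have R: "4 * (1 / 4) ^ t + 16 * (\<Sum>i\<le>t. (1 / 4) ^ i * (slack i + 3 * \<gamma>)) \<le> R"
  proof -
    have "(\<Sum>i\<le>t. (1 / 4) ^ i * slack i) = (\<Sum>i\<le>t. \<eta> / (real t + 1))"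
      by (intro sum.cong) (auto simp: slack_def power_divide)
    also have "\<dots> = \<eta>" by (simp add: field_simps)
    finally have "(\<Sum>i\<le>t. (1 / 4) ^ i * (slack i + 3 * \<gamma>)) = \<eta> + (\<Sum>i\<le>t. (1 / 4) ^ i) * (3 * \<gamma>)"
      by (simp add: distrib_left sum.distrib sum_distrib_right)
    moreover have "(\<Sum>i\<le>t. (1 / 4 :: real) ^ i) * (3 * \<gamma>) \<le> 4 / 3 * (3 * \<gamma>)"
      by (intro mult_right_mono sum_quarter_powers) (simp add: \<gamma>_def)
    ultimately show ?thesis by (simp add: R_def \<gamma>_def)
  qed
  have "(\<integral>x. (cmod (h x))\<^sup>2 \<partial>\<mu>) \<le> 128 / 3 * (\<integral>x. (cmod (h x))\<^sup>2 \<partial>\<nu>)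
     + (4 * (1 / 4) ^ t + 16 * (\<Sum>i\<le>t. (1 / 4) ^ i * (slack i + 3 * \<gamma>)))"
  proof (rule integral_sq_level_transfer[OF \<mu> p\<nu> s\<nu> hm h1])
    fix i assume i: "i \<le> t"
    obtain \<omega> where w: "\<omega> \<in> net i" and B: "measure \<mu> {x \<in> space \<mu>. (1 / 2) ^ i / 4 \<le> cmod (h x - net_avg i \<omega> x)} \<le> \<gamma>"
      "measure \<nu> {x \<in> space \<mu>. (1 / 2) ^ i / 4 \<le> cmod (h x - net_avg i \<omega> x)} \<le> \<gamma>" using ex[of i] by auto
    show "measure \<mu> {x \<in> space \<mu>. 2 * (1 / 2) ^ i < cmod (h x)}
       \<le> 2 * measure \<nu> {x \<in> space \<mu>. (1 / 2) ^ i < cmod (h x)} + (slack i + 3 * \<gamma>)"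
      using good(2)[OF i w]
      by (intro level_transfer[OF _ \<mu> p\<nu> s\<nu> hm net_avg_measurable[OF w] B]) (simp_all add: net_level_def)
  qed
  also note int\<nu>
  finally show "(\<integral>x. (cmod (h x))\<^sup>2 \<partial>\<mu>) \<le> 128 / 3 * emp_avg m \<xi> (\<lambda>x. (cmod (h x))\<^sup>2) + R" using R by linarith
  have "(\<integral>x. (cmod (h x))\<^sup>2 \<partial>\<nu>) \<le> 128 / 3 * (\<integral>x. (cmod (h x))\<^sup>2 \<partial>\<mu>)
     + (4 * (1 / 4) ^ t + 16 * (\<Sum>i\<le>t. (1 / 4) ^ i * (slack i + 3 * \<gamma>)))"
  proof (rule integral_sq_level_transfer[OF p\<nu> \<mu> s\<nu>[symmetric] \<nu>m[OF hm], unfolded sp\<nu>, OF h1])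
    fix i assume i: "i \<le> t"
    obtain \<omega> where w: "\<omega> \<in> net i" and B: "measure \<mu> {x \<in> space \<mu>. (1 / 2) ^ i / 4 \<le> cmod (h x - net_avg i \<omega> x)} \<le> \<gamma>"
      "measure \<nu> {x \<in> space \<mu>. (1 / 2) ^ i / 4 \<le> cmod (h x - net_avg i \<omega> x)} \<le> \<gamma>" using ex[of i] by auto
    show "measure \<nu> {x \<in> space \<mu>. 2 * (1 / 2) ^ i < cmod (h x)}
       \<le> 2 * measure \<mu> {x \<in> space \<mu>. (1 / 2) ^ i < cmod (h x)} + (slack i + 3 * \<gamma>)"
      using good(1)[OF i w]
      by (intro level_transfer[OF _ p\<nu> \<mu> s\<nu>[symmetric] \<nu>m[OF hm] \<nu>m[OF net_avg_measurable[OF w]], unfolded sp\<nu>]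
          B) (simp_all add: net_level_def)
  qed
  also note int\<nu>
  finally show "emp_avg m \<xi> (\<lambda>x. (cmod (h x))\<^sup>2) \<le> 128 / 3 * (\<integral>x. (cmod (h x))\<^sup>2 \<partial>\<mu>) + R" using R by linarith
qed

end
end

section \<open>The restricted isometry property of random samples\<close>

lemma pmf_of_weights:
  fixes w :: "'i \<Rightarrow> real"
  assumes "finite I" "\<And>i. i \<in> I \<Longrightarrow> 0 \<le> w i" "sum w I = 1"
  obtains p where "set_pmf p \<subseteq> I" "\<And>i. i \<in> I \<Longrightarrow> pmf p i = w i"
proof -
  define f where "f i = (if i \<in> I then w i else 0)" for i
  have "(\<integral>\<^sup>+ i. ennreal (f i) \<partial>count_space UNIV) = (\<Sum>i\<in>I. ennreal (f i))"
    using assms(1) by (intro nn_integral_count_space') (auto simp: f_def)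
  also have "\<dots> = ennreal (sum w I)"
    using assms(2) by (subst sum_ennreal[symmetric]) (auto simp: f_def intro!: sum.cong)
  finally have pmf: "pmf (embed_pmf f) i = f i" for i
    using assms by (intro pmf_embed_pmf) (auto simp: f_def)
  have "set_pmf (embed_pmf f) \<subseteq> I" by (auto simp: set_pmf_eq pmf f_def)
  then show ?thesis by (rule that) (simp add: pmf f_def)
qed

definition units :: "complex set" where "units = {0, 1, -1, \<i>, -\<i>}"

lemma sum_units: "(\<Sum>c\<in>units. g c) = g 0 + g 1 + g (-1) + g \<i> + g (-\<i>)" for g :: "complex \<Rightarrow> 'b::ab_group_add"
proof -
  have "distinct [0, 1, -1, \<i>, -\<i>]" by (auto simp: complex_eq_iff)
  then have "(\<Sum>c\<in>set [0, 1, -1, \<i>, -\<i>]. g c) = sum_list (map g [0, 1, -1, \<i>, -\<i>])"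
    by (rule sum.distinct_set_conv_list)
  then show ?thesis by (simp add: units_def add.assoc)
qed

lemma finite_units: "finite units" and card_units: "card units \<le> 5"
  using card_length[of "[0, 1, -1, \<i>, -\<i>]"] by (auto simp: units_def)

text \<open>The element with the unit \<open>0\<close> absorbs the weight that is missing to a probability
  distribution; the factor \<open>2\<close> makes room for the separate treatment of real and imaginary parts.\<close>

definition dict :: "(nat \<Rightarrow> 'a \<Rightarrow> complex) \<Rightarrow> nat \<times> complex \<Rightarrow> 'a \<Rightarrow> complex" where
  "dict \<phi> i x = 2 * snd i * \<phi> (fst i) x"

lemma dict_measurable:
  assumes "\<And>j. j \<in> {1..N} \<Longrightarrow> \<phi> j \<in> borel_measurable \<mu>" "i \<in> {1..N} \<times> units"
  shows "dict \<phi> i \<in> borel_measurable \<mu>"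
  using assms unfolding dict_def[abs_def] by (intro borel_measurable_times borel_measurable_const) auto

lemma dict_le_2:
  assumes bound: "\<And>j x. j \<in> {1..N} \<Longrightarrow> x \<in> S \<Longrightarrow> cmod (\<phi> j x) \<le> 1"
    and i: "i \<in> {1..N} \<times> units" and x: "x \<in> S"
  shows "cmod (dict \<phi> i x) \<le> 2"
proof -
  have "cmod (snd i) \<le> 1" "cmod (\<phi> (fst i) x) \<le> 1" using i x bound by (auto simp: units_def)
  then have "cmod (snd i) * cmod (\<phi> (fst i) x) \<le> 1" by (intro mult_le_one) auto
  then show ?thesis by (simp add: dict_def norm_mult)
qed

text \<open>The positive and negative parts of \<open>Re (a j)\<close> and \<open>Im (a j)\<close>
  become weights of the four nonzero units, halved to offset the factor 2 in \<open>dict\<close>. As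
  \<open>\<bar>Re z\<bar> + \<bar>Im z\<bar> \<le> 2 * cmod z\<close>, they add up to at most 1; the
  missing mass is spread over the elements with unit 0, which vanish identically.\<close>

lemma l1_ball_subset_dict_hull:
  fixes a :: "nat \<Rightarrow> complex"
  assumes N: "1 \<le> N" and a: "(\<Sum>j=1..N. cmod (a j)) \<le> 1"
  obtains p where "set_pmf p \<subseteq> {1..N} \<times> units"
    "\<And>x. (\<Sum>j=1..N. a j * \<phi> j x) = measure_pmf.expectation p (\<lambda>i. dict \<phi> i x)"
proof -
  define S where "S = (\<Sum>j=1..N. (\<bar>Re (a j)\<bar> + \<bar>Im (a j)\<bar>) / 2)"
  have S1: "S \<le> 1"
  proof -
    have "S \<le> (\<Sum>j=1..N. cmod (a j))"
      unfolding S_def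
    proof (intro sum_mono)
      fix j show "(\<bar>Re (a j)\<bar> + \<bar>Im (a j)\<bar>) / 2 \<le> cmod (a j)"
        using abs_Re_le_cmod[of "a j"] abs_Im_le_cmod[of "a j"] by simp
    qed
    with a show ?thesis by simp
  qed
  define W where "W j c = (if c = 1 then max (Re (a j)) 0 / 2 else if c = -1 then max (- Re (a j)) 0 / 2
     else if c = \<i> then max (Im (a j)) 0 / 2 else if c = -\<i> then max (- Im (a j)) 0 / 2
     else (1 - S) / real N)" for j and c :: complex
  have ne: "(0::complex) \<noteq> 1" "(0::complex) \<noteq> -1" "(0::complex) \<noteq> \<i>" "(0::complex) \<noteq> -\<i>" "(-1::complex) \<noteq> 1"
    "\<i> \<noteq> 1" "\<i> \<noteq> -1" "-\<i> \<noteq> 1" "-\<i> \<noteq> -1" "-\<i> \<noteq> \<i>" by (auto simp: complex_eq_iff)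
  have W: "W j 0 = (1 - S) / real N" "W j 1 = max (Re (a j)) 0 / 2" "W j (-1) = max (- Re (a j)) 0 / 2"
    "W j \<i> = max (Im (a j)) 0 / 2" "W j (-\<i>) = max (- Im (a j)) 0 / 2" for j
    using ne by (simp_all add: W_def)
  have "(\<Sum>i\<in>{1..N} \<times> units. W (fst i) (snd i)) = (\<Sum>j=1..N. \<Sum>c\<in>units. W j c)"
    by (simp add: sum.cartesian_product split_beta)
  also have "\<dots> = (\<Sum>j=1..N. (1 - S) / real N + (\<bar>Re (a j)\<bar> + \<bar>Im (a j)\<bar>) / 2)"
    by (intro sum.cong) (auto simp: sum_units W)
  also have "\<dots> = (\<Sum>j=1..N. (1 - S) / real N) + S"
    by (simp only: sum.distrib S_def)
  also have "\<dots> = 1" using N by simp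
  finally have tot: "(\<Sum>i\<in>{1..N} \<times> units. W (fst i) (snd i)) = 1" .
  obtain p where p: "set_pmf p \<subseteq> {1..N} \<times> units"
    "\<And>i. i \<in> {1..N} \<times> units \<Longrightarrow> pmf p i = W (fst i) (snd i)"
    by (rule pmf_of_weights[OF _ _ tot]) (use S1 in \<open>auto simp: finite_units W_def\<close>)
  have "measure_pmf.expectation p (\<lambda>i. dict \<phi> i x) = (\<Sum>j=1..N. a j * \<phi> j x)" for x
  proof -
    have "measure_pmf.expectation p (\<lambda>i. dict \<phi> i x)
        = (\<Sum>i\<in>{1..N} \<times> units. pmf p i *\<^sub>R dict \<phi> i x)"
      using p(1) finite_units by (intro integral_measure_pmf) auto
    also have "\<dots> = (\<Sum>i\<in>{1..N} \<times> units. W (fst i) (snd i) *\<^sub>R dict \<phi> i x)"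
      by (intro sum.cong refl) (simp add: p(2))
    also have "\<dots> = (\<Sum>j=1..N. \<Sum>c\<in>units. W j c *\<^sub>R dict \<phi> (j, c) x)"
      by (simp add: sum.cartesian_product split_beta)
    also have "\<dots> = (\<Sum>j=1..N. a j * \<phi> j x)"
    proof (intro sum.cong refl)
      fix j
      have "(\<Sum>c\<in>units. W j c *\<^sub>R dict \<phi> (j, c) x)
          = (complex_of_real (max (Re (a j)) 0 - max (- Re (a j)) 0)
            + \<i> * complex_of_real (max (Im (a j)) 0 - max (- Im (a j)) 0)) * \<phi> j x"
        by (simp add: sum_units W dict_def scaleR_conv_of_real algebra_simps)
      also have "max (Re (a j)) 0 - max (- Re (a j)) 0 = Re (a j)" by simp
      also have "max (Im (a j)) 0 - max (- Im (a j)) 0 = Im (a j)" by simp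
      finally show "(\<Sum>c\<in>units. W j c *\<^sub>R dict \<phi> (j, c) x) = a j * \<phi> j x"
        by (simp add: complex_eq[symmetric])
    qed
    finally show ?thesis .
  qed
  with p(1) show ?thesis by (intro that[of p]) auto
qed

lemma emp_avg_scale: "emp_avg m \<xi> (\<lambda>x. c * g x) = c * emp_avg m \<xi> g"
  by (simp add: emp_avg_def sum_distrib_left)

text \<open>The normalization is by the coefficient norm: Cauchy-Schwarz over at most
  \<open>s\<close> indices makes the coefficient sum at most 1. By \<open>lower\<close> the
  remainder is at most half of the scaled integral \<open>A\<close> over \<open>\<mu>\<close> and
  can be absorbed: with \<open>B\<close> the scaled empirical average,
  \<open>A \<le> 128 / 3 * B + A / 2\<close> and \<open>B \<le> 128 / 3 * A + A / 2\<close> give the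
  factors 86 and 44.\<close>

lemma good_samples_rip:
  fixes \<mu> :: "'a measure"
  assumes \<mu>: "prob_space \<mu>" and N: "1 \<le> N" and s: "1 \<le> s" and m: "1 \<le> m" and L: "1 \<le> L" and \<eta>: "0 < \<eta>"
    and meas: "\<And>j. j \<in> {1..N} \<Longrightarrow> \<phi> j \<in> borel_measurable \<mu>"
    and bound: "\<And>j x. j \<in> {1..N} \<Longrightarrow> x \<in> space \<mu> \<Longrightarrow> cmod (\<phi> j x) \<le> 1"
    and R: "0 < r" "4 * (1 / 4) ^ t + 16 * \<eta> + 512 * exp (- real L) \<le> r / (2 * real s)"
    and \<xi>: "\<xi> \<in> good_samples \<mu> (dict \<phi>) ({1..N} \<times> units) d m t L \<eta>"
    and J: "J \<subseteq> {1..N}" "card J \<le> s"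
    and lower: "r * (\<Sum>j\<in>J. (cmod (a j))\<^sup>2) \<le> (\<integral>x. (cmod (\<Sum>j\<in>J. a j * \<phi> j x))\<^sup>2 \<partial>\<mu>)"
  shows "(\<integral>x. (cmod (\<Sum>j\<in>J. a j * \<phi> j x))\<^sup>2 \<partial>\<mu>) \<le> 86 * emp_avg m \<xi> (\<lambda>x. (cmod (\<Sum>j\<in>J. a j * \<phi> j x))\<^sup>2)"
    and "emp_avg m \<xi> (\<lambda>x. (cmod (\<Sum>j\<in>J. a j * \<phi> j x))\<^sup>2) \<le> 44 * (\<integral>x. (cmod (\<Sum>j\<in>J. a j * \<phi> j x))\<^sup>2 \<partial>\<mu>)"
proof -
  have finJ: "finite J" using J finite_subset by blast
  define S where "S = (\<Sum>j\<in>J. (cmod (a j))\<^sup>2)"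
  define g where "g x = (\<Sum>j\<in>J. a j * \<phi> j x)" for x
  have "(\<integral>x. (cmod (g x))\<^sup>2 \<partial>\<mu>) \<le> 86 * emp_avg m \<xi> (\<lambda>x. (cmod (g x))\<^sup>2)
      \<and> emp_avg m \<xi> (\<lambda>x. (cmod (g x))\<^sup>2) \<le> 44 * (\<integral>x. (cmod (g x))\<^sup>2 \<partial>\<mu>)"
  proof (cases "S = 0")
    case True
    then have "\<forall>j\<in>J. a j = 0" using finJ by (auto simp: S_def sum_nonneg_eq_0_iff)
    then have "g = (\<lambda>x. 0)" by (auto simp: g_def)
    then show ?thesis by (simp add: emp_avg_def)
  next
    case False
    then have S: "0 < S" using sum_nonneg[of J "\<lambda>j. (cmod (a j))\<^sup>2"] by (simp add: S_def less_le)
    define c where "c = 1 / sqrt (real s * S)"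
    have c: "0 < c" "c\<^sup>2 = 1 / (real s * S)" using S s by (auto simp: c_def power_divide)
    define b where "b j = (if j \<in> J then complex_of_real c * a j else 0)" for j
    define h where "h x = (\<Sum>j=1..N. b j * \<phi> j x)" for x
    have b1: "(\<Sum>j=1..N. cmod (b j)) \<le> 1"
    proof -
      have "(\<Sum>j=1..N. cmod (b j)) = (\<Sum>j\<in>J. c * cmod (a j))"
        using J c by (intro sum.mono_neutral_cong_right) (auto simp: b_def norm_mult)
      also have "\<dots> = c * (\<Sum>j\<in>J. cmod (a j))" by (simp add: sum_distrib_left)
      also have "(\<Sum>j\<in>J. cmod (a j)) \<le> sqrt (real s * S)"
      proof (rule real_le_rsqrt)
        have "(\<Sum>j\<in>J. cmod (a j))\<^sup>2 \<le> real (card J) * S"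
          unfolding S_def using sum_squared_le_sum_of_squares[of "\<lambda>j. cmod (a j)" J] by (simp add: mult.commute)
        also have "\<dots> \<le> real s * S" using J S by (intro mult_right_mono) auto
        finally show "(\<Sum>j\<in>J. cmod (a j))\<^sup>2 \<le> real s * S" .
      qed
      also have "c * sqrt (real s * S) = 1" using S s by (simp add: c_def)
      finally show ?thesis using c by simp
    qed
    have hg: "h x = complex_of_real c * g x" for x
    proof -
      have "h x = (\<Sum>j\<in>J. complex_of_real c * (a j * \<phi> j x))"
        unfolding h_def using J by (intro sum.mono_neutral_cong_right) (auto simp: b_def)
      then show ?thesis by (simp add: g_def sum_distrib_left)
    qed
    have hg2: "(\<lambda>x. (cmod (h x))\<^sup>2) = (\<lambda>x. c\<^sup>2 * (cmod (g x))\<^sup>2)"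
      using c by (auto simp: hg norm_mult power_mult_distrib)
    have h1: "cmod (h x) \<le> 1" if "x \<in> space \<mu>" for x
    proof -
      have "cmod (h x) \<le> (\<Sum>j=1..N. cmod (b j) * 1)"
        unfolding h_def using that bound by (intro sum_norm_le) (auto simp: norm_mult intro!: mult_left_le)
      with b1 show ?thesis by simp
    qed
    obtain p where p: "set_pmf p \<subseteq> {1..N} \<times> units" "\<And>x. h x = measure_pmf.expectation p (\<lambda>i. dict \<phi> i x)"
      using l1_ball_subset_dict_hull[OF N b1, of \<phi>] unfolding h_def by metis
    have fin: "finite ({1..N} \<times> units)" by (simp add: finite_units)
    have dm: "dict \<phi> i \<in> borel_measurable \<mu>" if "i \<in> {1..N} \<times> units" for i
      by (rule dict_measurable[OF meas that])
    have db: "cmod (dict \<phi> i x) \<le> 2" if "i \<in> {1..N} \<times> units" "x \<in> space \<mu>" for i x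
      by (rule dict_le_2[OF bound that])
    define R' where "R' = 4 * (1 / 4) ^ t + 16 * \<eta> + 512 * exp (- real L)"
    have tr: "(\<integral>x. (cmod (h x))\<^sup>2 \<partial>\<mu>) \<le> 128 / 3 * emp_avg m \<xi> (\<lambda>x. (cmod (h x))\<^sup>2) + R'"
      unfolding R'_def by (rule good_samples_transfer(1)[OF \<mu> fin dm db m L \<eta> \<xi> p h1])
    have tr': "emp_avg m \<xi> (\<lambda>x. (cmod (h x))\<^sup>2) \<le> 128 / 3 * (\<integral>x. (cmod (h x))\<^sup>2 \<partial>\<mu>) + R'"
      unfolding R'_def by (rule good_samples_transfer(2)[OF \<mu> fin dm db m L \<eta> \<xi> p h1])
    have "R' \<le> r / (2 * real s)" using R by (simp add: R'_def)
    also have "\<dots> = c\<^sup>2 * (r * S) / 2" using S s by (simp add: c)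
    also have "\<dots> \<le> c\<^sup>2 * (\<integral>x. (cmod (g x))\<^sup>2 \<partial>\<mu>) / 2"
      using lower by (intro divide_right_mono mult_left_mono) (auto simp: S_def g_def)
    finally have R': "R' \<le> c\<^sup>2 * (\<integral>x. (cmod (g x))\<^sup>2 \<partial>\<mu>) / 2" .
    have ge0: "0 \<le> emp_avg m \<xi> (\<lambda>x. (cmod (g x))\<^sup>2)" "0 \<le> (\<integral>x. (cmod (g x))\<^sup>2 \<partial>\<mu>)"
      by (auto simp: emp_avg_def sum_nonneg)
    define A B where "A = c\<^sup>2 * (\<integral>x. (cmod (g x))\<^sup>2 \<partial>\<mu>)" and "B = c\<^sup>2 * emp_avg m \<xi> (\<lambda>x. (cmod (g x))\<^sup>2)"
    have "A \<le> 128 / 3 * B + R'" "B \<le> 128 / 3 * A + R'"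
      using tr tr' unfolding hg2 emp_avg_scale by (simp_all add: A_def B_def)
    moreover have "0 \<le> A" "0 \<le> B" using ge0 by (simp_all add: A_def B_def)
    ultimately have "A \<le> 86 * B" "B \<le> 44 * A" using R' unfolding A_def[symmetric] by linarith+
    then have "c\<^sup>2 * (\<integral>x. (cmod (g x))\<^sup>2 \<partial>\<mu>) \<le> c\<^sup>2 * (86 * emp_avg m \<xi> (\<lambda>x. (cmod (g x))\<^sup>2))"
      "c\<^sup>2 * emp_avg m \<xi> (\<lambda>x. (cmod (g x))\<^sup>2) \<le> c\<^sup>2 * (44 * (\<integral>x. (cmod (g x))\<^sup>2 \<partial>\<mu>))"
      by (simp_all only: A_def B_def mult_ac)
    then show ?thesis using c(1) by (metis mult_le_cancel_left_pos zero_less_power)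
  qed
  then show "(\<integral>x. (cmod (\<Sum>j\<in>J. a j * \<phi> j x))\<^sup>2 \<partial>\<mu>) \<le> 86 * emp_avg m \<xi> (\<lambda>x. (cmod (\<Sum>j\<in>J. a j * \<phi> j x))\<^sup>2)"
    and "emp_avg m \<xi> (\<lambda>x. (cmod (\<Sum>j\<in>J. a j * \<phi> j x))\<^sup>2) \<le> 44 * (\<integral>x. (cmod (\<Sum>j\<in>J. a j * \<phi> j x))\<^sup>2 \<partial>\<mu>)"
    by (simp_all add: g_def)
qed

text \<open>\<open>Q\<close> stands for \<open>K * s\<close>, and \<open>t\<close> is at once the
  cutoff of the levels and the parameter \<open>L\<close> of \<open>samples\<close>. The three
  remainder terms are at most \<open>1 / 1024\<close>, \<open>1 / 4\<close> and \<open>1 / 8\<close>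
  times \<open>1 / Q\<close>. Of the Chernoff exponent \<open>2 * (4 ^ i * Y)\<close> one half pays
  for the size of the net, and \<open>Y / 2\<close> of the rest pays for the number of
  levels.\<close>

lemma failure_bound:
  fixes Q M :: real and N m t n :: nat and card_I :: nat
  assumes Q: "2 \<le> Q" and N: "2 \<le> N" and t: "t = nat \<lceil>ln (4096 * Q)\<rceil>" and card_I: "card_I \<le> 5 * N"
    and m: "64000000 * Q * ln N * (ln (2 * Q))\<^sup>2 \<le> real m"
  shows "1 \<le> t" and "4 * (1 / 4) ^ t + 16 * (1 / (64 * Q)) + 512 * exp (- real t) \<le> 1 / (2 * Q)"
    and "(\<Sum>i\<le>t. real (card_I ^ samples t i) * (2 * exp (- real m * slack t (1 / (64 * Q)) i / 2)))
       \<le> 2 * exp (- (1 / 5632) * real m / (Q * (ln (2 * Q))\<^sup>2))"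
proof -
  define \<Lambda> where "\<Lambda> = ln (2 * Q)"
  have ln4: "ln 4 = 2 * ln (2::real)" using ln_realpow[of 2 2] by simp
  have "ln 4 \<le> \<Lambda>" using Q by (simp add: \<Lambda>_def)
  then have \<Lambda>: "1 \<le> \<Lambda>" using ln2_ge_two_thirds ln4 by simp
  have "ln (4096 * Q) = ln (2 ^ 11 * (2 * Q))" by simp
  also have "\<dots> = ln (2 ^ 11) + \<Lambda>" unfolding \<Lambda>_def using Q by (intro ln_mult_pos) auto
  also have "ln (2 ^ 11) = 11 * ln (2::real)" using ln_realpow[of 2 11] by simp
  finally have l: "ln (4096 * Q) = 11 * ln 2 + \<Lambda>" .
  have tl: "ln (4096 * Q) \<le> real t" "real t \<le> ln (4096 * Q) + 1"
    using l \<Lambda> ln2_ge_two_thirds unfolding t by linarith+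
  have "1 \<le> real t" using tl(1) l \<Lambda> ln2_ge_two_thirds by linarith
  then show t1: "1 \<le> t" by simp
  \<comment> \<open>\<open>11 * ln 2 + 2 \<le> 10 \<le> 10 * \<Lambda>\<close>, where one unit is
    due to rounding up and one to the extra level.\<close>
  have t\<Lambda>: "real t + 1 \<le> 11 * \<Lambda>" using tl(2) l \<Lambda> ln2_le_25_over_36 by linarith
  have et: "exp (- real t) \<le> 1 / (4096 * Q)"
  proof -
    have "exp (- real t) \<le> exp (- ln (4096 * Q))" using tl(1) by simp
    also have "\<dots> = 1 / (4096 * Q)" using Q by (simp add: exp_minus inverse_eq_divide)
    finally show ?thesis .
  qed
  have "(1 / 4 :: real) ^ t \<le> exp (- 1) ^ t"
    using exp_le by (intro power_mono) (auto simp: exp_minus field_simps)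
  also have "\<dots> = exp (- real t)" by (simp add: exp_of_nat_mult[symmetric])
  also note et
  finally have "(1 / 4 :: real) ^ t \<le> 1 / (4096 * Q)" .
  then have "4 * (1 / 4) ^ t + 16 * (1 / (64 * Q)) + 512 * exp (- real t)
     \<le> 4 * (1 / (4096 * Q)) + 16 * (1 / (64 * Q)) + 512 * (1 / (4096 * Q))"
    using et by (intro add_mono mult_left_mono) auto
  also have "\<dots> \<le> 1 / (2 * Q)" using Q by (simp add: field_simps)
  finally show "4 * (1 / 4) ^ t + 16 * (1 / (64 * Q)) + 512 * exp (- real t) \<le> 1 / (2 * Q)" .
  define Y where "Y = real m / (256 * Q * (real t + 1))"
  have lnN: "2 / 3 \<le> ln (real N)"
  proof -
    have "ln 2 \<le> ln (real N)" using N by simp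
    with ln2_ge_two_thirds show ?thesis by linarith
  qed
  \<comment> \<open>The logarithm of the net size is at most
    \<open>512 * 4 ^ i * t * (4 * ln N)\<close>, and \<open>512 * 4 * 11 = 22528\<close>. The
    constant in the bound for \<open>m\<close> comes from
    \<open>22528 * 256 * 11 \<le> 64000000\<close>.\<close>
  have Ybig: "22528 * \<Lambda> * ln N \<le> Y"
  proof -
    have "22528 * \<Lambda> * ln N * (256 * Q * (real t + 1)) \<le> 22528 * \<Lambda> * ln N * (256 * Q * (11 * \<Lambda>))"
      using \<Lambda> lnN Q t\<Lambda> by (intro mult_left_mono) auto
    also have "\<dots> \<le> 64000000 * Q * ln N * \<Lambda>\<^sup>2"
      using \<Lambda> lnN Q by (simp add: power2_eq_square)
    also have "\<dots> \<le> real m" using m by (simp add: \<Lambda>_def)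
    finally show ?thesis unfolding Y_def using Q by (subst pos_le_divide_eq) auto
  qed
  have card4: "real card_I \<le> exp (4 * ln N)"
  proof -
    have "5 * N \<le> N ^ 4"
    proof -
      have "2 ^ 3 \<le> N ^ 3" using N by (intro power_mono) auto
      then have "N * 5 \<le> N * N ^ 3" by (intro mult_le_mono2) simp
      then show ?thesis by (simp add: eval_nat_numeral mult_ac)
    qed
    with card_I have "real card_I \<le> real (N ^ 4)" by (meson of_nat_le_iff le_trans)
    also have "\<dots> = exp (4 * ln N)" using N by (simp add: exp_of_nat_mult[of 4, simplified])
    finally show ?thesis .
  qed
  have level: "real (card_I ^ samples t i) * (2 * exp (- real m * slack t (1 / (64 * Q)) i / 2)) \<le> 2 * exp (- Y)" for i
  proof -
    have "real (card_I ^ samples t i) \<le> exp (4 * ln N) ^ samples t i"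
      using card4 by (simp add: power_mono)
    also have "\<dots> = exp (4 ^ i * (2048 * real t * ln N))"
      by (simp add: exp_of_nat_mult[symmetric] samples_def mult_ac)
    also have "\<dots> \<le> exp (4 ^ i * Y)"
    proof -
      have "2048 * real t * ln N \<le> 2048 * (11 * \<Lambda>) * ln N"
        using t\<Lambda> lnN by (intro mult_right_mono mult_left_mono) auto
      also have "\<dots> \<le> Y" using Ybig by (simp add: mult_ac)
      finally show ?thesis by simp
    qed
    finally have size: "real (card_I ^ samples t i) \<le> exp (4 ^ i * Y)" .
    have rate: "- real m * slack t (1 / (64 * Q)) i / 2 = - (2 * (4 ^ i * Y))"
    proof -
      have "- real m * (4 ^ i * (1 / (64 * Q)) / x) / 2 = - (2 * (4 ^ i * (real m / (256 * Q * x))))"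
        if "x \<noteq> 0" for x :: real using that Q by (simp add: field_simps)
      from this[of "real t + 1"] show ?thesis by (simp only: slack_def Y_def)
    qed
    have "real (card_I ^ samples t i) * (2 * exp (- real m * slack t (1 / (64 * Q)) i / 2))
        \<le> exp (4 ^ i * Y) * (2 * exp (- (2 * (4 ^ i * Y))))"
      unfolding rate by (intro mult_right_mono[OF size]) simp
    also have "\<dots> = 2 * exp (- (4 ^ i * Y))" by (simp add: exp_add[symmetric])
    also have "\<dots> \<le> 2 * exp (- Y)"
    proof -
      have "0 \<le> Y" using Q by (simp add: Y_def)
      moreover have "(1::real) \<le> 4 ^ i" by (rule one_le_power) simp
      ultimately have "1 * Y \<le> 4 ^ i * Y" by (intro mult_right_mono) auto
      then show ?thesis by simp
    qed
    finally show ?thesis .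
  qed
  have "(\<Sum>i\<le>t. real (card_I ^ samples t i) * (2 * exp (- real m * slack t (1 / (64 * Q)) i / 2)))
      \<le> (\<Sum>i\<le>t. 2 * exp (- Y))" by (intro sum_mono level)
  also have "\<dots> = (real t + 1) * (2 * exp (- Y))" by simp
  also have "\<dots> \<le> exp (Y / 2) * (2 * exp (- Y))"
  proof (rule mult_right_mono)
    have "11 * \<Lambda> \<le> Y / 2"
    proof -
      have "22528 * \<Lambda> * (2 / 3) \<le> 22528 * \<Lambda> * ln N" using \<Lambda> lnN by (intro mult_left_mono) auto
      with Ybig \<Lambda> show ?thesis by linarith
    qed
    with t\<Lambda> show "real t + 1 \<le> exp (Y / 2)" using exp_ge_add_one_self[of "Y / 2"] by linarith
  qed simp
  also have "\<dots> = 2 * exp (- (Y / 2))" by (simp add: exp_add[symmetric])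
  \<comment> \<open>\<open>5632 = 512 * 11\<close>, from
    \<open>t + 1 \<le> 11 * \<Lambda> \<le> 11 * \<Lambda>\<^sup>2\<close>.\<close>
  also have "\<dots> \<le> 2 * exp (- (1 / 5632) * real m / (Q * \<Lambda>\<^sup>2))"
  proof -
    have "real m / (5632 * (Q * \<Lambda>\<^sup>2)) \<le> real m / (512 * Q * (real t + 1))"
    proof (rule divide_left_mono)
      have "512 * Q * (real t + 1) \<le> 512 * Q * (11 * \<Lambda>)"
        using Q t\<Lambda> by (intro mult_left_mono) auto
      also have "\<dots> \<le> 512 * Q * (11 * \<Lambda>\<^sup>2)"
        using Q \<Lambda> by (intro mult_left_mono) (auto simp: power2_eq_square)
      finally show "512 * Q * (real t + 1) \<le> 5632 * (Q * \<Lambda>\<^sup>2)" by (simp add: mult_ac)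
    qed (use Q \<Lambda> in auto)
    then show ?thesis by (simp add: Y_def)
  qed
  finally show "(\<Sum>i\<le>t. real (card_I ^ samples t i) * (2 * exp (- real m * slack t (1 / (64 * Q)) i / 2)))
       \<le> 2 * exp (- (1 / 5632) * real m / (Q * (ln (2 * Q))\<^sup>2))"
    by (simp add: \<Lambda>_def)
qed

section \<open>Orthogonal matching pursuit\<close>

text \<open>Only semidefinite: the empirical product vanishes on functions that are zero at all
  sample points. The identities are demanded for all functions, which a finite sum satisfies without
  integrability conditions.\<close>

locale semi_inner =
  fixes ip :: "('a \<Rightarrow> complex) \<Rightarrow> ('a \<Rightarrow> complex) \<Rightarrow> complex"
  assumes ip_add: "ip (\<lambda>x. f x + g x) h = ip f h + ip g h"
    and ip_scale: "ip (\<lambda>x. c * f x) h = c * ip f h"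
    and ip_herm: "ip g f = cnj (ip f g)"
    and ip_pos: "0 \<le> Re (ip f f)"
begin

definition sq :: "('a \<Rightarrow> complex) \<Rightarrow> real" where "sq f = Re (ip f f)"

lemma sq_nonneg: "0 \<le> sq f"
  using ip_pos by (simp add: sq_def)

lemma ip_add_right: "ip h (\<lambda>x. f x + g x) = ip h f + ip h g"
  by (metis complex_cnj_add ip_add ip_herm)

lemma ip_scale_right: "ip h (\<lambda>x. c * f x) = cnj c * ip h f"
  by (metis complex_cnj_mult ip_scale ip_herm)

lemma ip_diff: "ip (\<lambda>x. f x - g x) h = ip f h - ip g h"
  using ip_add[of f "\<lambda>x. (-1) * g x" h] ip_scale[of "-1" g h] by simp

lemma ip_diff_right: "ip h (\<lambda>x. f x - g x) = ip h f - ip h g"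
  by (metis complex_cnj_diff ip_diff ip_herm)

lemma ip_zero_right: "ip h (\<lambda>x. 0) = 0"
  using ip_scale_right[of h 0 h] by simp

lemma ip_sum_right: "finite J \<Longrightarrow> ip f (\<lambda>x. \<Sum>j\<in>J. a j * \<phi> j x) = (\<Sum>j\<in>J. cnj (a j) * ip f (\<phi> j))"
  by (induction J rule: finite_induct) (simp_all add: ip_zero_right ip_add_right ip_scale_right)

lemma Re_ip_commute: "Re (ip g f) = Re (ip f g)"
  by (subst ip_herm) simp

lemma sq_add: "sq (\<lambda>x. f x + g x) = sq f + 2 * Re (ip f g) + sq g"
  using Re_ip_commute[of f g] by (simp add: sq_def ip_add ip_add_right)

lemma sq_diff: "sq (\<lambda>x. f x - g x) = sq f - 2 * Re (ip f g) + sq g"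
  using Re_ip_commute[of f g] by (simp add: sq_def ip_diff ip_diff_right)

text \<open>Parallelogram law: the two sides differ by the squared seminorm of
  \<open>f - g\<close>.\<close>

lemma sq_add_le: "sq (\<lambda>x. f x + g x) \<le> 2 * sq f + 2 * sq g"
  using sq_nonneg[of "\<lambda>x. f x - g x"] by (simp add: sq_add sq_diff)

lemma sq_diff_le: "sq (\<lambda>x. f x - g x) \<le> 2 * sq f + 2 * sq g"
  using sq_nonneg[of "\<lambda>x. f x + g x"] by (simp add: sq_add sq_diff)

lemma sq_scale: "sq (\<lambda>x. c * f x) = (cmod c)\<^sup>2 * sq f"
proof -
  have "ip (\<lambda>x. c * f x) (\<lambda>x. c * f x) = (c * cnj c) * ip f f"
    by (simp add: ip_scale ip_scale_right)
  then show ?thesis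
    by (simp add: sq_def complex_norm_square[symmetric])
qed

end

section \<open>Scalars and spans\<close>

locale scalars =
  fixes F :: "complex set"
  assumes scalars: "F = \<real> \<or> F = UNIV"
begin

lemma F_closed [simp, intro]:
  "0 \<in> F" "1 \<in> F" "a \<in> F \<Longrightarrow> b \<in> F \<Longrightarrow> a + b \<in> F" "a \<in> F \<Longrightarrow> b \<in> F \<Longrightarrow> a - b \<in> F"
  "a \<in> F \<Longrightarrow> b \<in> F \<Longrightarrow> a * b \<in> F" "a \<in> F \<Longrightarrow> - a \<in> F" "complex_of_real r \<in> F"
  "a \<in> F \<Longrightarrow> cnj a \<in> F" "a \<in> F \<Longrightarrow> a / complex_of_real r \<in> F"
  using scalars by (auto simp: Reals_cnj_iff)

lemma F_sum: "(\<And>j. j \<in> J \<Longrightarrow> a j \<in> F) \<Longrightarrow> (\<Sum>j\<in>J. a j) \<in> F"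
  using scalars by auto

lemma lin_span_mono:
  assumes "J \<subseteq> J'" "finite J'" "g \<in> lin_span F \<phi> J" shows "g \<in> lin_span F \<phi> J'"
proof -
  obtain a where a: "\<forall>j\<in>J. a j \<in> F" "g = (\<lambda>x. \<Sum>j\<in>J. a j * \<phi> j x)"
    using assms(3) by (auto simp: lin_span_def)
  have "g = (\<lambda>x. \<Sum>j\<in>J'. (if j \<in> J then a j else 0) * \<phi> j x)"
    unfolding a(2) by (intro ext sum.mono_neutral_cong_left) (use assms in auto)
  with a(1) show ?thesis
    unfolding lin_span_def by (intro CollectI exI[of _ "\<lambda>j. if j \<in> J then a j else 0"]) auto
qed

lemma lin_span_add:
  assumes "g \<in> lin_span F \<phi> J" "h \<in> lin_span F \<phi> J" shows "(\<lambda>x. g x + h x) \<in> lin_span F \<phi> J"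
proof -
  obtain a b where "\<forall>j\<in>J. a j \<in> F" "g = (\<lambda>x. \<Sum>j\<in>J. a j * \<phi> j x)"
    "\<forall>j\<in>J. b j \<in> F" "h = (\<lambda>x. \<Sum>j\<in>J. b j * \<phi> j x)"
    using assms by (auto simp: lin_span_def)
  then show ?thesis
    unfolding lin_span_def
    by (intro CollectI exI[of _ "\<lambda>j. a j + b j"]) (auto simp: sum.distrib algebra_simps)
qed

lemma lin_span_scale:
  assumes "g \<in> lin_span F \<phi> J" "c \<in> F" shows "(\<lambda>x. c * g x) \<in> lin_span F \<phi> J"
proof -
  obtain a where "\<forall>j\<in>J. a j \<in> F" "g = (\<lambda>x. \<Sum>j\<in>J. a j * \<phi> j x)"
    using assms by (auto simp: lin_span_def)
  then show ?thesis
    using assms(2) unfolding lin_span_def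
    by (intro CollectI exI[of _ "\<lambda>j. c * a j"]) (auto simp: sum_distrib_left algebra_simps)
qed

lemma lin_span_diff:
  assumes "g \<in> lin_span F \<phi> J" "h \<in> lin_span F \<phi> J" shows "(\<lambda>x. g x - h x) \<in> lin_span F \<phi> J"
  using lin_span_add[OF assms(1) lin_span_scale[OF assms(2), of "-1"]] by simp

lemma lin_span_base:
  assumes "j \<in> J" "finite J" shows "\<phi> j \<in> lin_span F \<phi> J"
proof -
  have "\<phi> j = (\<lambda>x. \<Sum>i\<in>J. (if i = j then 1 else 0) * \<phi> i x)"
    using assms by (intro ext) (simp add: if_distrib[of "\<lambda>u. u * _"] cong: if_cong)
  then show ?thesis
    unfolding lin_span_def by (intro CollectI exI[of _ "\<lambda>i. if i = j then 1 else 0"]) auto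
qed

end

text \<open>Here \<open>r\<^sub>1\<close> and \<open>r\<^sub>2\<close> bound squared norms, that is, they are the squares of the Riesz constants.\<close>

locale greedy = semi_inner ip + scalars F
  for ip :: "('a \<Rightarrow> complex) \<Rightarrow> ('a \<Rightarrow> complex) \<Rightarrow> complex" and F +
  fixes \<phi> :: "nat \<Rightarrow> 'a \<Rightarrow> complex" and N s :: nat and r\<^sub>1 r\<^sub>2 t :: real
    and k :: "nat \<Rightarrow> nat" and f :: "nat \<Rightarrow> 'a \<Rightarrow> complex"
  assumes r: "0 < r\<^sub>1" "r\<^sub>1 \<le> r\<^sub>2" and t: "0 < t" "t \<le> 1" and s: "1 \<le> s"
    and riesz_lower: "\<lbrakk>J \<subseteq> {1..N}; card J \<le> s; \<forall>j\<in>J. a j \<in> F\<rbrakk> \<Longrightarrow>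
       r\<^sub>1 * (\<Sum>j\<in>J. (cmod (a j))\<^sup>2) \<le> sq (\<lambda>x. \<Sum>j\<in>J. a j * \<phi> j x)"
    and riesz_upper: "\<lbrakk>J \<subseteq> {1..N}; card J \<le> s; \<forall>j\<in>J. a j \<in> F\<rbrakk> \<Longrightarrow>
       sq (\<lambda>x. \<Sum>j\<in>J. a j * \<phi> j x) \<le> r\<^sub>2 * (\<Sum>j\<in>J. (cmod (a j))\<^sup>2)"
    and k: "\<And>n. k (Suc n) \<in> {1..N}"
    and weak: "\<And>n j. j \<in> {1..N} \<Longrightarrow> t * cmod (ip (f n) (\<phi> j)) \<le> cmod (ip (f n) (\<phi> (k (Suc n))))"
    and ip_F: "\<And>n. ip (f n) (\<phi> (k (Suc n))) \<in> F"
    and approximant: "\<And>n. (\<lambda>x. f 0 x - f n x) \<in> lin_span F \<phi> (k ` {1..n})"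
    and orth: "\<And>n h. h \<in> lin_span F \<phi> (k ` {1..n}) \<Longrightarrow> ip (f n) h = 0"
begin

section \<open>One step of the pursuit\<close>

abbreviation "E n \<equiv> sq (f n)"
abbreviation "\<Gamma> n \<equiv> k ` {1..n}"
text \<open>With at most \<open>u\<close> missing coefficients under consideration, one step
  contracts the excess of \<open>E\<close> over the attainable error by the factor
  \<open>1 - \<kappa> / u\<close>.\<close>

definition \<kappa> :: real where "\<kappa> = t\<^sup>2 * r\<^sub>1 / r\<^sub>2"

lemma \<Gamma>_subset: "\<Gamma> n \<subseteq> {1..N}"
proof
  fix j assume "j \<in> \<Gamma> n"
  then obtain i where "i \<in> {1..n}" "j = k i" by auto
  with k[of "i - 1"] show "j \<in> {1..N}" by auto
qed

lemma card_\<Gamma>: "card (\<Gamma> n) \<le> n"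
  using card_image_le[of "{1..n}" k] by simp

text \<open>Pythagoras: the approximant differs from \<open>h\<close> by an element of the span,
  which is orthogonal to the residual.\<close>

lemma residual_minimal:
  assumes "h \<in> lin_span F \<phi> (\<Gamma> n)" shows "E n \<le> sq (\<lambda>x. f 0 x - h x)"
proof -
  define d where "d = (\<lambda>x. (f 0 x - f n x) - h x)"
  have "d \<in> lin_span F \<phi> (\<Gamma> n)"
    unfolding d_def by (rule lin_span_diff[OF approximant assms])
  then have "ip (f n) d = 0" by (rule orth)
  then have "sq (\<lambda>x. f n x + d x) = E n + sq d" by (simp add: sq_add)
  moreover have "(\<lambda>x. f n x + d x) = (\<lambda>x. f 0 x - h x)" by (auto simp: d_def)
  ultimately show ?thesis using sq_nonneg[of d] by simp
qed

text \<open>The new projection is at least as good as the old approximant corrected by a multiple of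
  the new element. In that multiple \<open>r\<^sub>2\<close> replaces the squared norm of the
  element, so the decrease is \<open>2 * x - x\<close> with
  \<open>x = (cmod p)\<^sup>2 / r\<^sub>2\<close>.\<close>

lemma E_Suc_le: "E (Suc n) \<le> E n - (cmod (ip (f n) (\<phi> (k (Suc n)))))\<^sup>2 / r\<^sub>2"
proof -
  define \<psi> where "\<psi> = \<phi> (k (Suc n))"
  define p where "p = ip (f n) \<psi>"
  define c where "c = p / complex_of_real r\<^sub>2"
  have sq\<psi>: "sq \<psi> \<le> r\<^sub>2"
    using riesz_upper[of "{k (Suc n)}" "\<lambda>_. 1"] k[of n] s by (simp add: \<psi>_def)
  have "(\<lambda>x. f 0 x - f n x) \<in> lin_span F \<phi> (\<Gamma> (Suc n))"
    by (rule lin_span_mono[OF _ _ approximant[of n]]) auto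
  moreover have "(\<lambda>x. c * \<psi> x) \<in> lin_span F \<phi> (\<Gamma> (Suc n))"
    unfolding \<psi>_def by (intro lin_span_scale lin_span_base) (auto simp: c_def p_def \<psi>_def ip_F)
  ultimately have "E (Suc n) \<le> sq (\<lambda>x. f 0 x - ((f 0 x - f n x) + c * \<psi> x))"
    by (intro residual_minimal lin_span_add)
  also have "\<dots> = sq (\<lambda>x. f n x - c * \<psi> x)" by (simp add: algebra_simps)
  also have "\<dots> = E n - 2 * Re (cnj c * p) + (cmod c)\<^sup>2 * sq \<psi>"
    unfolding sq_diff ip_scale_right sq_scale p_def ..
  also have "Re (cnj c * p) = (cmod p)\<^sup>2 / r\<^sub>2"
  proof -
    have "cnj c * p = (p * cnj p) / complex_of_real r\<^sub>2" by (simp add: c_def)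
    also have "\<dots> = complex_of_real ((cmod p)\<^sup>2 / r\<^sub>2)" by (simp add: complex_norm_square[symmetric])
    finally show ?thesis by simp
  qed
  also have "(cmod c)\<^sup>2 * sq \<psi> \<le> (cmod c)\<^sup>2 * r\<^sub>2"
    using sq\<psi> by (intro mult_left_mono) auto
  also have "(cmod c)\<^sup>2 * r\<^sub>2 = (cmod p)\<^sup>2 / r\<^sub>2"
    using r by (simp add: c_def norm_divide power2_eq_square)
  finally show ?thesis by (simp add: p_def \<psi>_def)
qed

lemma E_antimono: "n \<le> n' \<Longrightarrow> E n' \<le> E n"
proof (induction n' rule: dec_induct)
  case (step i)
  have "0 \<le> (cmod (ip (f i) (\<phi> (k (Suc i)))))\<^sup>2 / r\<^sub>2" using r by simp
  with step E_Suc_le[of i] show ?case by linarith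
qed simp

lemma \<kappa>_bounds: "0 < \<kappa>" "\<kappa> \<le> 1"
proof -
  show "0 < \<kappa>" using r t by (simp add: \<kappa>_def)
  have "t\<^sup>2 * r\<^sub>1 \<le> 1 * r\<^sub>2" using t r by (intro mult_mono power_le_one) auto
  then show "\<kappa> \<le> 1" using r by (simp add: \<kappa>_def divide_le_eq)
qed

lemma \<kappa>_div_le: "1 \<le> u \<Longrightarrow> \<kappa> / u \<le> 1"
  using \<kappa>_bounds by (simp add: divide_le_eq)

section \<open>Comparison with a fixed sparse target\<close>

context
  fixes T :: "nat set" and a :: "nat \<Rightarrow> complex" and e :: real
  assumes T: "T \<subseteq> {1..N}" and a: "\<forall>j\<in>T. a j \<in> F"
    and e: "e = sq (\<lambda>x. f 0 x - (\<Sum>j\<in>T. a j * \<phi> j x))"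
begin

lemma finite_T: "finite T" using T finite_subset by blast

text \<open>Orthogonality leaves only the block \<open>B\<close> in \<open>ip (f n) z\<close>, and
  Cauchy-Schwarz bounds it by \<open>sqrt (card B * S)\<close> times the largest inner product,
  \<open>S\<close> being the weight of the block. The distance \<open>D\<close> between the partial
  target and the approximant is kept in the estimate, because
  \<open>r\<^sub>1 * S \<le> sq D\<close> is what cancels \<open>S\<close>.\<close>

lemma E_Suc_contract:
  assumes B: "B \<subseteq> T" "B \<inter> \<Gamma> n = {}" and card: "card (\<Gamma> n \<union> T) \<le> s"
    and u: "real (card B) \<le> u" "1 \<le> u"
    and q: "sq (\<lambda>x. f 0 x - (\<Sum>j\<in>(T \<inter> \<Gamma> n) \<union> B. a j * \<phi> j x)) \<le> q" "q \<le> E n"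
  shows "E (Suc n) - q \<le> (1 - \<kappa> / u) * (E n - q)"
proof (cases "E n = q")
  case True
  then show ?thesis using E_antimono[of n "Suc n"] by simp
next
  case False
  with q have less: "q < E n" by simp
  define z where "z = (\<lambda>x. \<Sum>j\<in>(T \<inter> \<Gamma> n) \<union> B. a j * \<phi> j x)"
  have finB: "finite B" using B finite_T finite_subset by blast
  obtain g where g: "\<forall>j\<in>\<Gamma> n. g j \<in> F" "(\<lambda>x. f 0 x - f n x) = (\<lambda>x. \<Sum>j\<in>\<Gamma> n. g j * \<phi> j x)"
    using approximant[of n] by (auto simp: lin_span_def)
  define D where "D = (\<lambda>x. z x - (f 0 x - f n x))"
  define S where "S = (\<Sum>j\<in>B. (cmod (a j))\<^sup>2)"
  define M where "M = cmod (ip (f n) (\<phi> (k (Suc n)))) / t"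
  define d where "d j = (if j \<in> T then a j else 0) - (if j \<in> \<Gamma> n then g j else 0)" for j
  have Deq: "D = (\<lambda>x. \<Sum>j\<in>\<Gamma> n \<union> B. d j * \<phi> j x)"
  proof
    fix x
    have "z x = (\<Sum>j\<in>\<Gamma> n \<union> B. (if j \<in> T then a j else 0) * \<phi> j x)"
      unfolding z_def using B finB by (intro sum.mono_neutral_cong_left) auto
    moreover have "f 0 x - f n x = (\<Sum>j\<in>\<Gamma> n \<union> B. (if j \<in> \<Gamma> n then g j else 0) * \<phi> j x)"
      unfolding fun_cong[OF g(2)] using finB by (intro sum.mono_neutral_cong_left) auto
    ultimately show "D x = (\<Sum>j\<in>\<Gamma> n \<union> B. d j * \<phi> j x)"
      by (simp add: D_def d_def sum_subtractf algebra_simps)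
  qed
  have "r\<^sub>1 * S \<le> r\<^sub>1 * (\<Sum>j\<in>\<Gamma> n \<union> B. (cmod (d j))\<^sup>2)"
  proof -
    \<comment> \<open>Indices in \<open>B\<close> are not selected yet, so the approximant does not
      alter their coefficients.\<close>
    have "S = (\<Sum>j\<in>B. (cmod (d j))\<^sup>2)"
      unfolding S_def d_def using B by (intro sum.cong) auto
    also have "\<dots> \<le> (\<Sum>j\<in>\<Gamma> n \<union> B. (cmod (d j))\<^sup>2)"
      using finB by (intro sum_mono2) auto
    finally show ?thesis using r by simp
  qed
  also have "\<dots> \<le> sq D"
    unfolding Deq
  proof (rule riesz_lower)
    have "card (\<Gamma> n \<union> B) \<le> card (\<Gamma> n \<union> T)"
      using B finite_T by (intro card_mono) auto
    then show "card (\<Gamma> n \<union> B) \<le> s" using card by simp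
    show "\<Gamma> n \<union> B \<subseteq> {1..N}" using \<Gamma>_subset B T by blast
    show "\<forall>j\<in>\<Gamma> n \<union> B. d j \<in> F" using a g(1) B by (auto simp: d_def)
  qed
  finally have SD: "r\<^sub>1 * S \<le> sq D" .
  have ipD: "ip (f n) D = ip (f n) z"
    unfolding D_def ip_diff_right[of _ z] orth[OF approximant] by simp
  have "(\<lambda>x. f 0 x - z x) = (\<lambda>x. f n x - D x)" by (auto simp: D_def)
  then have "sq (\<lambda>x. f 0 x - z x) = E n - 2 * Re (ip (f n) z) + sq D"
    by (simp add: sq_diff ipD)
  with q(1) have lower: "(E n - q) + sq D \<le> 2 * Re (ip (f n) z)" by (simp add: z_def)
  have zeq: "ip (f n) z = (\<Sum>j\<in>B. cnj (a j) * ip (f n) (\<phi> j))"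
  proof -
    have "ip (f n) z = (\<Sum>j\<in>(T \<inter> \<Gamma> n) \<union> B. cnj (a j) * ip (f n) (\<phi> j))"
      unfolding z_def using finB finite_T by (intro ip_sum_right) auto
    also have "\<dots> = (\<Sum>j\<in>B. cnj (a j) * ip (f n) (\<phi> j))"
      using finB finite_T B
      by (intro sum.mono_neutral_right) (auto simp: orth[OF lin_span_base])
    finally show ?thesis .
  qed
  have M: "0 \<le> M" "cmod (ip (f n) (\<phi> j)) \<le> M" if "j \<in> B" for j
  proof -
    have "j \<in> {1..N}" using that B T by auto
    from weak[OF this, of n] show "cmod (ip (f n) (\<phi> j)) \<le> M" "0 \<le> M"
      using t by (simp_all add: M_def field_simps)
  qed
  have "Re (ip (f n) z) \<le> (\<Sum>j\<in>B. cmod (a j)) * M"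
  proof -
    have "Re (ip (f n) z) \<le> cmod (\<Sum>j\<in>B. cnj (a j) * ip (f n) (\<phi> j))"
      unfolding zeq by (rule complex_Re_le_cmod)
    also have "\<dots> \<le> (\<Sum>j\<in>B. cmod (a j) * M)"
      by (intro sum_norm_le) (auto simp: norm_mult intro!: mult_left_mono M)
    finally show ?thesis by (simp add: sum_distrib_right)
  qed
  with lower have up: "(E n - q) + sq D \<le> 2 * ((\<Sum>j\<in>B. cmod (a j)) * M)" by simp
  \<comment> \<open>The inequality of arithmetic and geometric means turns the sum into a product,
    from which \<open>S\<close> can be divided out.\<close>
  have "4 * ((E n - q) * sq D) \<le> ((E n - q) + sq D)\<^sup>2"
    using sum_squares_ge_zero[of "E n - q - sq D" 0] by (simp add: power2_eq_square algebra_simps)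
  also have "\<dots> \<le> (2 * ((\<Sum>j\<in>B. cmod (a j)) * M))\<^sup>2"
    using up less sq_nonneg[of D] by (intro power_mono) auto
  also have "\<dots> = 4 * ((\<Sum>j\<in>B. cmod (a j))\<^sup>2 * M\<^sup>2)" by (simp add: power_mult_distrib)
  also have "(\<Sum>j\<in>B. cmod (a j))\<^sup>2 \<le> card B * S"
    unfolding S_def using sum_squared_le_sum_of_squares[of "\<lambda>j. cmod (a j)" B] by (simp add: mult.commute)
  finally have "(E n - q) * sq D \<le> card B * S * M\<^sup>2"
    by (simp add: mult_right_mono)
  moreover have "(E n - q) * (r\<^sub>1 * S) \<le> (E n - q) * sq D"
    using SD less by (intro mult_left_mono) auto
  moreover have "card B * S * M\<^sup>2 \<le> u * S * M\<^sup>2"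
    using u by (intro mult_right_mono) (auto simp: S_def sum_nonneg)
  ultimately have main: "S * ((E n - q) * r\<^sub>1) \<le> S * (u * M\<^sup>2)" by (simp add: mult_ac)
  have "S \<noteq> 0"
  proof
    assume "S = 0"
    then have "\<forall>j\<in>B. a j = 0" using finB by (auto simp: S_def sum_nonneg_eq_0_iff)
    then have "ip (f n) z = 0" by (simp add: zeq)
    with lower less sq_nonneg[of D] show False by simp
  qed
  then have "S > 0" by (metis S_def less_eq_real_def sum_nonneg zero_le_power2)
  with main have "(E n - q) * r\<^sub>1 \<le> u * M\<^sup>2" by simp
  then have "(E n - q) * r\<^sub>1 * t\<^sup>2 / (r\<^sub>2 * u) \<le> u * M\<^sup>2 * t\<^sup>2 / (r\<^sub>2 * u)"
    using r u by (intro divide_right_mono mult_right_mono) auto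
  also have "\<dots> = (cmod (ip (f n) (\<phi> (k (Suc n)))))\<^sup>2 / r\<^sub>2"
    using t u by (simp add: M_def power_divide)
  finally have "\<kappa> / u * (E n - q) \<le> (cmod (ip (f n) (\<phi> (k (Suc n)))))\<^sup>2 / r\<^sub>2"
    by (simp add: \<kappa>_def mult_ac)
  with E_Suc_le[of n] show ?thesis by (simp add: algebra_simps)
qed

lemma sq_partial_le:
  assumes "R \<subseteq> T" "card T \<le> s"
  shows "sq (\<lambda>x. f 0 x - (\<Sum>j\<in>T - R. a j * \<phi> j x)) \<le> 2 * e + 2 * r\<^sub>2 * (\<Sum>j\<in>R. (cmod (a j))\<^sup>2)"
proof -
  have "(\<lambda>x. f 0 x - (\<Sum>j\<in>T - R. a j * \<phi> j x))
      = (\<lambda>x. (f 0 x - (\<Sum>j\<in>T. a j * \<phi> j x)) + (\<Sum>j\<in>R. a j * \<phi> j x))"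
    using assms(1) finite_T by (auto simp: sum_diff)
  then have "sq (\<lambda>x. f 0 x - (\<Sum>j\<in>T - R. a j * \<phi> j x)) \<le> 2 * e + 2 * sq (\<lambda>x. \<Sum>j\<in>R. a j * \<phi> j x)"
    using sq_add_le[of "\<lambda>x. f 0 x - (\<Sum>j\<in>T. a j * \<phi> j x)" "\<lambda>x. \<Sum>j\<in>R. a j * \<phi> j x"] by (simp add: e)
  moreover have "sq (\<lambda>x. \<Sum>j\<in>R. a j * \<phi> j x) \<le> r\<^sub>2 * (\<Sum>j\<in>R. (cmod (a j))\<^sup>2)"
    using assms T a card_mono[OF finite_T assms(1)] by (intro riesz_upper) auto
  ultimately show ?thesis by simp
qed

lemma e_nonneg: "0 \<le> e" by (simp add: e sq_nonneg)

text \<open>As elements are captured, the block shrinks and the weight outside it does not grow, so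
  \<open>q\<close> and \<open>u\<close> from the start of the phase stay valid. Contraction is
  applied while \<open>E\<close> exceeds \<open>q\<close>; afterwards monotonicity is
  enough.\<close>

lemma E_phase:
  assumes A: "A \<subseteq> T" "card A \<le> u" "1 \<le> u" and card: "card (\<Gamma> (n + i) \<union> T) \<le> s"
    and q: "q = 2 * e + 2 * r\<^sub>2 * (\<Sum>j\<in>T - \<Gamma> n - A. (cmod (a j))\<^sup>2)"
  shows "E (n + i) \<le> q + (1 - \<kappa> / u) ^ i * E n"
proof -
  have c0: "0 \<le> 1 - \<kappa> / u"
    using \<kappa>_div_le[of u] A(3) by simp
  have q0: "0 \<le> q" using e_nonneg r by (auto simp: q intro!: add_nonneg_nonneg mult_nonneg_nonneg sum_nonneg)
  have cardT: "card T \<le> s"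
    using card card_mono[of "\<Gamma> (n + i) \<union> T" T] finite_T by simp
  show ?thesis using card
  proof (induction i)
    case 0
    then show ?case using q0 by simp
  next
    case (Suc i)
    have fin: "finite (\<Gamma> (n + Suc i) \<union> T)" using finite_T by simp
    have "card (\<Gamma> (n + i) \<union> T) \<le> card (\<Gamma> (n + Suc i) \<union> T)"
      by (intro card_mono[OF fin]) auto
    with Suc.prems have card': "card (\<Gamma> (n + i) \<union> T) \<le> s" by simp
    note IH = Suc.IH[OF card']
    show ?case
    proof (cases "E (n + i) \<le> q")
      case True
      moreover have "0 \<le> (1 - \<kappa> / u) ^ Suc i * E n"
        using c0 sq_nonneg[of "f n"] by simp
      ultimately show ?thesis using E_antimono[of "n + i" "n + Suc i"] by simp
    next
      case False
      define B where "B = A - \<Gamma> (n + i)"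
      define R where "R = T - \<Gamma> (n + i) - A"
      have "T \<inter> \<Gamma> (n + i) \<union> B = T - R" using A by (auto simp: B_def R_def)
      moreover have "sq (\<lambda>x. f 0 x - (\<Sum>j\<in>T - R. a j * \<phi> j x)) \<le> q"
      proof -
        have "(\<Sum>j\<in>R. (cmod (a j))\<^sup>2) \<le> (\<Sum>j\<in>T - \<Gamma> n - A. (cmod (a j))\<^sup>2)"
          using finite_T by (intro sum_mono2) (auto simp: R_def)
        then have "2 * e + 2 * r\<^sub>2 * (\<Sum>j\<in>R. (cmod (a j))\<^sup>2) \<le> q" using r by (simp add: q)
        then show ?thesis using sq_partial_le[of R] cardT by (fastforce simp: R_def)
      qed
      moreover have "card B \<le> u"
        using A(2) card_mono[of A B] finite_subset[OF A(1) finite_T] by (auto simp: B_def)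
      ultimately have "E (Suc (n + i)) - q \<le> (1 - \<kappa> / u) * (E (n + i) - q)"
        using False A card' by (intro E_Suc_contract[where B = B]) (auto simp: B_def)
      also have "\<dots> \<le> (1 - \<kappa> / u) * ((1 - \<kappa> / u) ^ i * E n)"
        using IH c0 by (intro mult_left_mono) auto
      finally show ?thesis by (simp add: mult_ac)
    qed
  qed
qed

text \<open>A number of steps proportional to the block size gains a factor that does not depend on
  the block size; this is what makes a linear number of steps sufficient.\<close>

lemma E_phase_exp:
  assumes A: "A \<subseteq> T" "card A \<le> u" "1 \<le> u" and card: "card (\<Gamma> (n + b * u) \<union> T) \<le> s"
    and b: "exp (- \<kappa> * b) \<le> \<theta>"
  shows "E (n + b * u) \<le> 2 * e + 2 * r\<^sub>2 * (\<Sum>j\<in>T - \<Gamma> n - A. (cmod (a j))\<^sup>2) + \<theta> * E n"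
proof -
  have "(1 - \<kappa> / u) ^ (b * u) \<le> exp (- \<kappa> / u) ^ (b * u)"
    using \<kappa>_div_le[of u] A(3) exp_ge_add_one_self[of "- \<kappa> / u"]
    by (intro power_mono) auto
  also have "\<dots> = exp (- \<kappa> * b)"
    using A(3) by (simp add: exp_of_nat_mult[symmetric])
  also note b
  finally have "(1 - \<kappa> / u) ^ (b * u) * E n \<le> \<theta> * E n"
    by (intro mult_right_mono sq_nonneg)
  with E_phase[OF A card refl] show ?thesis by simp
qed

text \<open>Which \<open>p\<close> elements are removed from \<open>U\<close> does not matter as long as the remaining
  weight is minimal; this replaces sorting the coefficients by modulus.\<close>

definition tail :: "nat set \<Rightarrow> nat \<Rightarrow> real" where
  "tail U p = Min ((\<lambda>W. \<Sum>j\<in>W. (cmod (a j))\<^sup>2) ` {W. W \<subseteq> U \<and> card W = card U - p})"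

lemma tail_attained:
  assumes "finite U"
  obtains A where "A \<subseteq> U" "card A \<le> p" "tail U p = (\<Sum>j\<in>U - A. (cmod (a j))\<^sup>2)"
proof -
  let ?S = "{W. W \<subseteq> U \<and> card W = card U - p}"
  obtain W0 where "W0 \<subseteq> U" "card W0 = card U - p"
    using obtain_subset_with_card_n[of "card U - p" U] by (metis diff_le_self)
  then have "?S \<noteq> {}" by auto
  moreover have "finite ?S" using assms by simp
  ultimately have "tail U p \<in> (\<lambda>W. \<Sum>j\<in>W. (cmod (a j))\<^sup>2) ` ?S"
    unfolding tail_def by (intro Min_in) auto
  then obtain W where W: "W \<subseteq> U" "card W = card U - p" "tail U p = (\<Sum>j\<in>W. (cmod (a j))\<^sup>2)"
    by auto
  have "U - (U - W) = W" using W by auto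
  moreover have "card (U - W) \<le> p"
    using W assms by (simp add: card_Diff_subset finite_subset)
  ultimately show ?thesis using W that[of "U - W"] by auto
qed

lemma tail_le:
  assumes "finite U" "W \<subseteq> U" "card U - p \<le> card W"
  shows "tail U p \<le> (\<Sum>j\<in>W. (cmod (a j))\<^sup>2)"
proof -
  obtain W' where W': "W' \<subseteq> W" "card W' = card U - p"
    using obtain_subset_with_card_n[OF assms(3)] by metis
  then have "tail U p \<le> (\<Sum>j\<in>W'. (cmod (a j))\<^sup>2)"
    unfolding tail_def using assms by (intro Min_le) auto
  also have "\<dots> \<le> (\<Sum>j\<in>W. (cmod (a j))\<^sup>2)"
    using W' assms finite_subset by (intro sum_mono2) auto
  finally show ?thesis .
qed

lemma tail_nonneg: "finite U \<Longrightarrow> 0 \<le> tail U p"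
  by (erule tail_attained[of U p]) (simp add: sum_nonneg)

lemma tail_eq_0: "finite U \<Longrightarrow> card U \<le> p \<Longrightarrow> tail U p = 0"
  using tail_le[of U "{}" p] tail_nonneg[of U p] by simp


text \<open>Here \<open>\<mu>\<close> is a number. The phases stop at the first block size beyond
  which the remaining weight drops by the factor \<open>\<mu>\<close>. Up to then the residual keeps
  pace with the remaining weight, and the last phase pushes it down to
  \<open>4 * e + r\<^sub>1 * X L / 8\<close>. If the error bound failed and at most
  \<open>p L\<close> coefficients had been captured, the missing weight would be at least
  \<open>X L\<close>, and the lower Riesz bound would force a larger residual.\<close>

lemma E_reduce:
  assumes \<mu>: "\<mu> = 32 * r\<^sub>2 / r\<^sub>1" and b: "exp (- \<kappa> * b) \<le> 1 / (2 * \<mu>)"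
    and u: "card (T - \<Gamma> n) = u" "u > 0"
    and card: "\<And>i. i \<le> n + 4 * b * u \<Longrightarrow> card (\<Gamma> i \<union> T) \<le> s"
  obtains i p where "i \<le> 4 * b * Suc p" "Suc p \<le> u"
    "E (n + i) \<le> 7 * e \<or> card (T - \<Gamma> (n + i)) + Suc p \<le> u"
proof -
  define U where "U = T - \<Gamma> n"
  have finU: "finite U" using finite_T by (simp add: U_def)
  \<comment> \<open>Phase \<open>l\<close> works with a block of at most
    \<open>p (Suc l) = 2 ^ l\<close> elements; \<open>p 0 = 0\<close> makes \<open>X 0\<close> the
    whole missing weight.\<close>
  define p :: "nat \<Rightarrow> nat" where "p l = (if l = 0 then 0 else 2 ^ (l - 1))" for l
  define X where "X l = tail U (p l)" for l
  have X0: "0 \<le> X l" for l by (simp add: X_def tail_nonneg[OF finU])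
  have \<mu>1: "32 \<le> \<mu>" using r by (simp add: \<mu> divide_simps)
  define \<theta> where "\<theta> = 1 / (2 * \<mu>)"
  have \<theta>: "0 < \<theta>" "\<theta> \<le> 1 / 2" "\<theta> * \<mu> = 1 / 2" using \<mu>1 by (auto simp: \<theta>_def field_simps)
  have "\<exists>l. \<mu> * X (Suc l) \<le> X l"
  proof
    have "u < 2 ^ u" by simp
    then have "X (Suc u) = 0" unfolding X_def using u by (intro tail_eq_0[OF finU]) (auto simp: p_def U_def)
    then show "\<mu> * X (Suc u) \<le> X u" using X0 by simp
  qed
  then obtain L where L: "\<mu> * X (Suc L) \<le> X L" "\<And>l. l < L \<Longrightarrow> X l < \<mu> * X (Suc l)"
    using exists_least_iff[of "\<lambda>l. \<mu> * X (Suc l) \<le> X l"] by (auto simp: not_le)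
  have pL: "p L < u"
  proof (rule ccontr)
    assume "\<not> p L < u"
    then have *: "X L = 0" unfolding X_def using u by (intro tail_eq_0[OF finU]) (auto simp: U_def)
    have "L \<noteq> 0" using \<open>\<not> p L < u\<close> u by (auto simp: p_def intro!: Nat.gr0I)
    then have "X (L - 1) < \<mu> * X (Suc (L - 1))" by (intro L(2)) simp
    with * \<open>L \<noteq> 0\<close> X0[of "L - 1"] show False by simp
  qed
  \<comment> \<open>The phase lengths \<open>b * 2 ^ l\<close> add up to
    \<open>b * (2 ^ Suc L - 1)\<close>, at most \<open>4 * b\<close> for each of the
    \<open>Suc (p L)\<close> coefficients to be captured. The factor 4 in the total number of steps
    comes from here.\<close>
  have two_p: "(2::nat) ^ Suc L - 1 \<le> 4 * Suc (p L) - 1"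
    by (cases L) (auto simp: p_def)
  have steps: "b * (2 ^ l - 1) \<le> 4 * b * u" if "l \<le> Suc L" for l
  proof -
    have "(2::nat) ^ l \<le> 2 ^ Suc L" using that by (intro power_increasing) auto
    then have "2 ^ l - 1 \<le> 4 * Suc (p L) - 1" using two_p by (meson diff_le_mono le_trans)
    also have "\<dots> \<le> 4 * u" using pL by simp
    finally have "2 ^ l - 1 \<le> 4 * u" .
    then show ?thesis by (metis mult.assoc mult.commute mult_le_mono1)
  qed
  have phase: "E (n + b * (2 ^ Suc l - 1)) \<le> 2 * e + 2 * r\<^sub>2 * X (Suc l) + \<theta> * E (n + b * (2 ^ l - 1))"
    if "l \<le> L" for l
  proof -
    obtain A where A: "A \<subseteq> U" "card A \<le> p (Suc l)" "X (Suc l) = (\<Sum>j\<in>U - A. (cmod (a j))\<^sup>2)"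
      unfolding X_def by (rule tail_attained[OF finU])
    have eq: "n + b * (2 ^ Suc l - 1) = n + b * (2 ^ l - 1) + b * 2 ^ l"
    proof -
      have "(2::nat) ^ Suc l - 1 = (2 ^ l - 1) + 2 ^ l" by simp
      then show ?thesis by (metis add.assoc distrib_left)
    qed
    have "E (n + b * (2 ^ l - 1) + b * 2 ^ l)
        \<le> 2 * e + 2 * r\<^sub>2 * (\<Sum>j\<in>T - \<Gamma> (n + b * (2 ^ l - 1)) - A. (cmod (a j))\<^sup>2)
          + \<theta> * E (n + b * (2 ^ l - 1))"
    proof (rule E_phase_exp)
      show "A \<subseteq> T" using A by (auto simp: U_def)
      show "card A \<le> 2 ^ l" using A by (simp add: p_def)
      show "card (\<Gamma> (n + b * (2 ^ l - 1) + b * 2 ^ l) \<union> T) \<le> s"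
        unfolding eq[symmetric] using steps[of "Suc l"] that by (intro card) simp
      show "exp (- \<kappa> * b) \<le> \<theta>" using b by (simp add: \<theta>_def)
    qed simp
    moreover have "(\<Sum>j\<in>T - \<Gamma> (n + b * (2 ^ l - 1)) - A. (cmod (a j))\<^sup>2) \<le> X (Suc l)"
      unfolding A(3) using finU by (intro sum_mono2) (auto simp: U_def)
    then have "2 * r\<^sub>2 * (\<Sum>j\<in>T - \<Gamma> (n + b * (2 ^ l - 1)) - A. (cmod (a j))\<^sup>2) \<le> 2 * r\<^sub>2 * X (Suc l)"
      using r by (intro mult_left_mono) auto
    ultimately show ?thesis unfolding eq by linarith
  qed
  have bound: "E (n + b * (2 ^ l - 1)) \<le> 4 * e + 4 * r\<^sub>2 * X l" if "l \<le> L" for l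
    using that
  proof (induction l)
    case 0
    have cardT: "card T \<le> s"
      using card[of 0] by simp
    have "E n \<le> sq (\<lambda>x. f 0 x - (\<Sum>j\<in>T - U. a j * \<phi> j x))"
    proof (rule residual_minimal, rule lin_span_mono)
      show "(\<lambda>x. \<Sum>j\<in>T - U. a j * \<phi> j x) \<in> lin_span F \<phi> (T - U)"
        using a by (auto simp: lin_span_def)
    qed (auto simp: U_def)
    also have "\<dots> \<le> 2 * e + 2 * r\<^sub>2 * (\<Sum>j\<in>U. (cmod (a j))\<^sup>2)"
      by (rule sq_partial_le[OF _ cardT]) (auto simp: U_def)
    also have "(\<Sum>j\<in>U. (cmod (a j))\<^sup>2) = X 0"
    proof -
      obtain A where "A \<subseteq> U" "card A \<le> 0" "tail U 0 = (\<Sum>j\<in>U - A. (cmod (a j))\<^sup>2)"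
        by (rule tail_attained[OF finU])
      moreover have "A = {}"
        using \<open>card A \<le> 0\<close> finite_subset[OF \<open>A \<subseteq> U\<close> finU] by simp
      ultimately show ?thesis by (simp add: X_def p_def)
    qed
    finally have "E n \<le> 2 * e + 2 * r\<^sub>2 * X 0" .
    moreover have "0 \<le> r\<^sub>2 * X 0" using X0[of 0] r by simp
    ultimately show ?case using e_nonneg by simp
  next
    case (Suc l)
    have "\<theta> * E (n + b * (2 ^ l - 1)) \<le> \<theta> * (4 * e + 4 * r\<^sub>2 * X l)"
      using Suc \<theta> by (intro mult_left_mono) auto
    \<comment> \<open>Before \<open>L\<close> the tails drop by less than the factor
      \<open>\<mu>\<close>, which \<open>\<theta> * \<mu> = 1 / 2\<close> outweighs.\<close>
    also have "\<dots> \<le> \<theta> * (4 * e + 4 * r\<^sub>2 * (\<mu> * X (Suc l)))"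
      using L(2)[of l] Suc.prems \<theta> r by (intro mult_left_mono add_left_mono) auto
    also have "\<dots> = 4 * (\<theta> * e) + 4 * r\<^sub>2 * X (Suc l) * (\<theta> * \<mu>)" by (simp add: algebra_simps)
    also have "\<dots> \<le> 2 * e + 2 * r\<^sub>2 * X (Suc l)"
      using \<theta>(2) e_nonneg mult_right_mono[of \<theta> "1/2" e] by (simp add: \<theta>(3))
    finally show ?case using phase[of l] Suc.prems by simp
  qed
  define i where "i = b * (2 ^ Suc L - 1)"
  have final: "E (n + i) \<le> 4 * e + r\<^sub>1 * X L / 8"
  proof -
    have "\<theta> * E (n + b * (2 ^ L - 1)) \<le> \<theta> * (4 * e + 4 * r\<^sub>2 * X L)"
      using bound[of L] \<theta> by (intro mult_left_mono) auto
    also have "\<dots> \<le> 2 * e + 4 * r\<^sub>2 * X L * \<theta>"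
      using \<theta>(2) e_nonneg mult_right_mono[of \<theta> "1/2" e] by (simp add: algebra_simps)
    finally have "E (n + i) \<le> 4 * e + 2 * r\<^sub>2 * X (Suc L) + 4 * r\<^sub>2 * X L * \<theta>"
      using phase[of L] by (simp add: i_def)
    moreover have "2 * r\<^sub>2 * X (Suc L) \<le> 2 * r\<^sub>2 * (X L / \<mu>)"
      using L(1) \<mu>1 r by (intro mult_left_mono) (auto simp: field_simps)
    \<comment> \<open>The value of \<open>\<mu>\<close> makes each of the two summands equal to
      \<open>r\<^sub>1 * X L / 16\<close>.\<close>
    moreover have "2 * r\<^sub>2 * (X L / \<mu>) + 4 * r\<^sub>2 * X L * \<theta> = r\<^sub>1 * X L / 8"
      using r by (simp add: \<theta>_def \<mu> field_simps)
    ultimately show ?thesis by linarith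
  qed
  have i_le: "i \<le> 4 * b * Suc (p L)"
  proof -
    have "(2::nat) ^ Suc L - 1 \<le> 4 * Suc (p L)" using two_p by linarith
    then have "b * (2 ^ Suc L - 1) \<le> b * (4 * Suc (p L))" by (rule mult_le_mono2)
    also have "\<dots> = 4 * b * Suc (p L)" by (simp only: mult_ac)
    finally show ?thesis by (simp only: i_def)
  qed
  have "E (n + i) \<le> 7 * e \<or> card (T - \<Gamma> (n + i)) + Suc (p L) \<le> u"
  proof (rule ccontr)
    assume neg: "\<not> ?thesis"
    define W where "W = T - \<Gamma> (n + i)"
    have cW: "card U - p L \<le> card W" using neg u by (auto simp: W_def U_def)
    have WU: "W \<subseteq> U" by (auto simp: W_def U_def)
    \<comment> \<open>The opposite estimate derived below amounts to
      \<open>r\<^sub>1 * X L \<le> 10 * e + r\<^sub>1 * X L / 4\<close>.\<close>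
    have big: "20 * e < r\<^sub>1 * X L" using neg final e_nonneg by linarith
    obtain g where g: "\<forall>j\<in>\<Gamma> (n + i). g j \<in> F"
      "(\<lambda>x. f 0 x - f (n + i) x) = (\<lambda>x. \<Sum>j\<in>\<Gamma> (n + i). g j * \<phi> j x)"
      using approximant[of "n + i"] by (auto simp: lin_span_def)
    define d where "d j = (if j \<in> T then a j else 0) - (if j \<in> \<Gamma> (n + i) then g j else 0)" for j
    have eq: "(\<lambda>x. f (n + i) x - (f 0 x - (\<Sum>j\<in>T. a j * \<phi> j x)))
        = (\<lambda>x. \<Sum>j\<in>\<Gamma> (n + i) \<union> T. d j * \<phi> j x)"
    proof
      fix x
      have "(\<Sum>j\<in>T. a j * \<phi> j x) = (\<Sum>j\<in>\<Gamma> (n + i) \<union> T. (if j \<in> T then a j else 0) * \<phi> j x)"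
        using finite_T by (intro sum.mono_neutral_cong_left) auto
      moreover have "f 0 x - f (n + i) x
          = (\<Sum>j\<in>\<Gamma> (n + i) \<union> T. (if j \<in> \<Gamma> (n + i) then g j else 0) * \<phi> j x)"
        unfolding fun_cong[OF g(2)] using finite_T by (intro sum.mono_neutral_cong_left) auto
      ultimately show "f (n + i) x - (f 0 x - (\<Sum>j\<in>T. a j * \<phi> j x))
          = (\<Sum>j\<in>\<Gamma> (n + i) \<union> T. d j * \<phi> j x)"
        by (simp add: d_def sum_subtractf algebra_simps)
    qed
    have "X L \<le> (\<Sum>j\<in>W. (cmod (a j))\<^sup>2)"
      unfolding X_def using WU cW by (intro tail_le finU)
    also have "\<dots> = (\<Sum>j\<in>W. (cmod (d j))\<^sup>2)"
      by (intro sum.cong) (auto simp: d_def W_def)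
    also have "\<dots> \<le> (\<Sum>j\<in>\<Gamma> (n + i) \<union> T. (cmod (d j))\<^sup>2)"
      using finite_T by (intro sum_mono2) (auto simp: W_def)
    finally have "r\<^sub>1 * X L \<le> r\<^sub>1 * (\<Sum>j\<in>\<Gamma> (n + i) \<union> T. (cmod (d j))\<^sup>2)" using r by simp
    also have "\<dots> \<le> sq (\<lambda>x. \<Sum>j\<in>\<Gamma> (n + i) \<union> T. d j * \<phi> j x)"
    proof (rule riesz_lower)
      show "\<Gamma> (n + i) \<union> T \<subseteq> {1..N}" using \<Gamma>_subset T by blast
      show "\<forall>j\<in>\<Gamma> (n + i) \<union> T. d j \<in> F" using a g(1) by (auto simp: d_def)
      show "card (\<Gamma> (n + i) \<union> T) \<le> s"
        using steps[of "Suc L"] by (intro card) (simp add: i_def)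
    qed
    also have "\<dots> \<le> 2 * E (n + i) + 2 * e"
      unfolding eq[symmetric] e by (rule sq_diff_le)
    finally show False using final big e_nonneg by linarith
  qed
  with i_le pL show ?thesis by (intro that[of i "p L"]) auto
qed

text \<open>A round of \<open>E_reduce\<close> that does not reach the error bound captures at least
  \<open>p + 1\<close> missing coefficients with at most \<open>4 * b\<close> steps for each. Hence
  the budget of \<open>4 * b * v\<close> steps lasts until the bound holds or all of
  \<open>T\<close> is captured, when the projection is at least as good as the target.\<close>

theorem greedy_bound:
  assumes \<mu>: "\<mu> = 32 * r\<^sub>2 / r\<^sub>1" and b: "exp (- \<kappa> * b) \<le> 1 / (2 * \<mu>)"
    and card: "card T \<le> v" "v + 4 * b * v \<le> s"
  shows "E (4 * b * v) \<le> 7 * e"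
proof -
  have gen: "E (n + 4 * b * u) \<le> 7 * e"
    if "card (T - \<Gamma> n) \<le> u" "n + 4 * b * u \<le> 4 * b * v" for n u
    using that
  proof (induction u arbitrary: n rule: less_induct)
    case (less u)
    have cardi: "card (\<Gamma> i \<union> T) \<le> s" if "i \<le> 4 * b * v" for i
      using card_Un_le[of "\<Gamma> i" T] card_\<Gamma>[of i] card that by linarith
    define w where "w = card (T - \<Gamma> n)"
    show ?case
    proof (cases "w = 0")
      case True
      then have "T \<subseteq> \<Gamma> n" using finite_T by (auto simp: w_def)
      have "E n \<le> e"
        unfolding e
      proof (rule residual_minimal, rule lin_span_mono[OF \<open>T \<subseteq> \<Gamma> n\<close>])
        show "(\<lambda>x. \<Sum>j\<in>T. a j * \<phi> j x) \<in> lin_span F \<phi> T" using a by (auto simp: lin_span_def)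
      qed simp
      then show ?thesis using E_antimono[of n "n + 4 * b * u"] e_nonneg by simp
    next
      case False
      have wu: "w \<le> u" using less.prems by (simp add: w_def)
      have wv: "n + 4 * b * w \<le> 4 * b * v"
        using less.prems(2) mult_le_mono2[OF wu, of "4 * b"] by linarith
      obtain i p where ip: "i \<le> 4 * b * Suc p" "Suc p \<le> w"
        "E (n + i) \<le> 7 * e \<or> card (T - \<Gamma> (n + i)) + Suc p \<le> w"
      proof (rule E_reduce[OF \<mu> b w_def[symmetric]])
        show "card (\<Gamma> j \<union> T) \<le> s" if "j \<le> n + 4 * b * w" for j
          using that wv by (intro cardi) simp
      qed (use False in auto)
      have i_le: "i \<le> 4 * b * u" using ip wu by (meson le_trans mult_le_mono2)
      from ip(3) show ?thesis
      proof
        assume "E (n + i) \<le> 7 * e"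
        then show ?thesis using E_antimono[of "n + i" "n + 4 * b * u"] i_le by simp
      next
        assume c: "card (T - \<Gamma> (n + i)) + Suc p \<le> w"
        have split: "4 * b * u = 4 * b * Suc p + 4 * b * (u - Suc p)"
          using ip wu by (metis add_mult_distrib2 le_add_diff_inverse le_trans)
        have "E (n + i + 4 * b * (u - Suc p)) \<le> 7 * e"
        proof (rule less.IH)
          show "u - Suc p < u" using ip wu by simp
          show "card (T - \<Gamma> (n + i)) \<le> u - Suc p" using c wu by simp
          show "n + i + 4 * b * (u - Suc p) \<le> 4 * b * v" using less.prems(2) split ip(1) by linarith
        qed
        moreover have "n + i + 4 * b * (u - Suc p) \<le> n + 4 * b * u" using split ip(1) by linarith
        ultimately show ?thesis using E_antimono order_trans by blast
      qed
    qed
  qed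
  from gen[of 0 v] card show ?thesis by simp
qed

end
end

section \<open>Transfer of the error bounds\<close>

text \<open>Squaring removes the case distinction in \<open>L2_norm\<close>, so norms can be
  compared through integrals, infinite ones included.\<close>

lemma L2_norm_power2: "(L2_norm M f)\<^sup>2 = (\<integral>\<^sup>+x. ennreal ((cmod (f x))\<^sup>2) \<partial>M)"
proof (cases "(\<integral>\<^sup>+x. ennreal ((cmod (f x))\<^sup>2) \<partial>M)" rule: ennreal_cases)
  case (real r)
  then show ?thesis by (simp add: L2_norm_def Let_def ennreal_power)
next
  case top
  then show ?thesis by (simp add: L2_norm_def Let_def infinity_ennreal_def power2_eq_square)
qed

lemma ennreal_power2_le_imp_le:
  fixes x y :: ennreal
  assumes "x\<^sup>2 \<le> y\<^sup>2" shows "x \<le> y"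
proof (cases y rule: ennreal_cases)
  case (real s)
  show ?thesis
  proof (cases x rule: ennreal_cases)
    case (real r)
    then show ?thesis using assms \<open>y = ennreal s\<close> \<open>0 \<le> s\<close>
      by (simp add: ennreal_power abs_le_square_iff[symmetric])
  next
    case top
    then show ?thesis using assms real by (simp add: power2_eq_square ennreal_mult_eq_top_iff top_unique)
  qed
qed simp

text \<open>The infimum in \<open>sigma_best\<close> need not be attained, so the error bounds are
  proved for each competitor and passed to the infimum here.\<close>

lemma le_mult_INF_ennreal:
  fixes C :: real and X :: "'g \<Rightarrow> ennreal"
  assumes C: "0 < C" and le: "\<And>g. g \<in> S \<Longrightarrow> L \<le> ennreal C * X g"
  shows "L \<le> ennreal C * (INF g\<in>S. X g)"
proof -
  have one: "ennreal C * ennreal (1 / C) = 1" "ennreal (1 / C) * ennreal C = 1"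
    using C by (simp_all flip: ennreal_mult'')
  have "ennreal (1 / C) * L \<le> (INF g\<in>S. X g)"
  proof (rule INF_greatest)
    fix g assume "g \<in> S"
    then have "ennreal (1 / C) * L \<le> ennreal (1 / C) * (ennreal C * X g)"
      by (intro mult_left_mono le) auto
    also have "\<dots> = X g" by (simp add: mult.assoc[symmetric] one)
    finally show "ennreal (1 / C) * L \<le> X g" .
  qed
  then have "ennreal C * (ennreal (1 / C) * L) \<le> ennreal C * (INF g\<in>S. X g)" by (intro mult_left_mono) auto
  then show ?thesis by (simp add: mult.assoc[symmetric] one)
qed

lemma cmod_add_power2_le: "(cmod (a + b))\<^sup>2 \<le> 2 * (cmod a)\<^sup>2 + 2 * (cmod b)\<^sup>2"
proof -
  have "(cmod (a + b))\<^sup>2 \<le> (cmod a + cmod b)\<^sup>2" by (intro power_mono norm_triangle_ineq) auto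
  also have "\<dots> \<le> 2 * (cmod a)\<^sup>2 + 2 * (cmod b)\<^sup>2"
    using sum_squares_ge_zero[of "cmod a - cmod b" 0] by (simp add: power2_eq_square algebra_simps)
  finally show ?thesis .
qed

interpretation emp: semi_inner "\<lambda>f g. emp_avg m \<xi> (\<lambda>x. f x * cnj (g x))" for m \<xi>
proof
  fix f g h :: "'a \<Rightarrow> complex" and c
  show "emp_avg m \<xi> (\<lambda>x. (f x + g x) * cnj (h x)) = emp_avg m \<xi> (\<lambda>x. f x * cnj (h x)) + emp_avg m \<xi> (\<lambda>x. g x * cnj (h x))"
    by (simp add: emp_avg_def distrib_right sum.distrib add_divide_distrib)
  show "emp_avg m \<xi> (\<lambda>x. c * f x * cnj (h x)) = c * emp_avg m \<xi> (\<lambda>x. f x * cnj (h x))"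
    by (simp add: emp_avg_def sum_distrib_left mult.assoc)
  show "emp_avg m \<xi> (\<lambda>x. g x * cnj (f x)) = cnj (emp_avg m \<xi> (\<lambda>x. f x * cnj (g x)))"
    by (simp add: emp_avg_def mult.commute)
  show "0 \<le> Re (emp_avg m \<xi> (\<lambda>x. f x * cnj (f x)))"
    by (simp add: emp_avg_def complex_norm_square[symmetric] sum_nonneg)
qed

lemma emp_sq: "emp.sq m \<xi> f = emp_avg m \<xi> (\<lambda>x. (cmod (f x))\<^sup>2)"
  unfolding emp.sq_def by (simp add: emp_avg_def complex_norm_square[symmetric])

text \<open>\<open>H\<close> is the residual and \<open>e\<close> the error of a competitor; norms
  are transferred only for the difference. The constants are \<open>7 \<le> 3\<^sup>2\<close>, then
  \<open>2 + 2 * 86 * (2 * 7 + 2) = 2754 \<le> 53\<^sup>2\<close>, and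
  \<open>2 * 2754 \<le> 75\<^sup>2\<close> because each of the two measures costs a factor 2 against
  the mixture.\<close>

lemma error_transfer:
  fixes H e :: "'a \<Rightarrow> complex"
  assumes \<mu>: "prob_space \<mu>" and m: "1 \<le> m" and \<xi>: "\<xi> \<in> {1..m} \<rightarrow> space \<mu>"
    and [measurable]: "H \<in> borel_measurable \<mu>" "e \<in> borel_measurable \<mu>"
    and emp: "emp.sq m \<xi> H \<le> 7 * emp.sq m \<xi> e"
    and diff: "(\<integral>\<^sup>+x. ennreal ((cmod (H x - e x))\<^sup>2) \<partial>\<mu>) \<le> ennreal (86 * emp.sq m \<xi> (\<lambda>x. H x - e x))"
  shows "L2_norm (emp_measure \<mu> m \<xi>) H \<le> ennreal 3 * L2_norm (emp_measure \<mu> m \<xi>) e"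
    and "L2_norm \<mu> H \<le> ennreal 53 * sup_norm (space \<mu>) e"
    and "L2_norm \<mu> H \<le> ennreal 75 * L2_norm (mix_measure \<mu> m \<xi>) e"
proof -
  have nn_emp: "(\<integral>\<^sup>+x. ennreal ((cmod (g x))\<^sup>2) \<partial>emp_measure \<mu> m \<xi>) = ennreal (emp.sq m \<xi> g)"
    if [measurable]: "g \<in> borel_measurable \<mu>" for g
    unfolding emp_sq by (rule nn_integral_emp[OF m \<xi>]) auto
  show "L2_norm (emp_measure \<mu> m \<xi>) H \<le> ennreal 3 * L2_norm (emp_measure \<mu> m \<xi>) e"
  proof (rule ennreal_power2_le_imp_le)
    have "(L2_norm (emp_measure \<mu> m \<xi>) H)\<^sup>2 = ennreal (emp.sq m \<xi> H)" by (simp add: L2_norm_power2 nn_emp)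
    also have "\<dots> \<le> ennreal (9 * emp.sq m \<xi> e)"
      using emp emp.sq_nonneg[of m \<xi> e] by (intro ennreal_leI) simp
    also have "\<dots> = (ennreal 3 * L2_norm (emp_measure \<mu> m \<xi>) e)\<^sup>2"
      by (simp only: power_mult_distrib L2_norm_power2 nn_emp assms ennreal_power) (simp add: ennreal_mult emp.sq_nonneg)
    finally show "(L2_norm (emp_measure \<mu> m \<xi>) H)\<^sup>2 \<le> (ennreal 3 * L2_norm (emp_measure \<mu> m \<xi>) e)\<^sup>2" .
  qed
  have "(L2_norm \<mu> H)\<^sup>2 \<le> (\<integral>\<^sup>+x. ennreal 2 * ennreal ((cmod (e x))\<^sup>2) + ennreal 2 * ennreal ((cmod (H x - e x))\<^sup>2) \<partial>\<mu>)"
    unfolding L2_norm_power2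
  proof (rule nn_integral_mono)
    fix x
    have "(cmod (H x))\<^sup>2 \<le> 2 * (cmod (e x))\<^sup>2 + 2 * (cmod (H x - e x))\<^sup>2"
      using cmod_add_power2_le[of "e x" "H x - e x"] by simp
    then have "ennreal ((cmod (H x))\<^sup>2) \<le> ennreal (2 * (cmod (e x))\<^sup>2 + 2 * (cmod (H x - e x))\<^sup>2)" by (rule ennreal_leI)
    then show "ennreal ((cmod (H x))\<^sup>2) \<le> ennreal 2 * ennreal ((cmod (e x))\<^sup>2) + ennreal 2 * ennreal ((cmod (H x - e x))\<^sup>2)"
      by (simp add: ennreal_plus ennreal_mult)
  qed
  also have "\<dots> = ennreal 2 * (\<integral>\<^sup>+x. ennreal ((cmod (e x))\<^sup>2) \<partial>\<mu>) + ennreal 2 * (\<integral>\<^sup>+x. ennreal ((cmod (H x - e x))\<^sup>2) \<partial>\<mu>)"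
    by (subst nn_integral_add) (auto simp: nn_integral_cmult)
  also have "(\<integral>\<^sup>+x. ennreal ((cmod (H x - e x))\<^sup>2) \<partial>\<mu>) \<le> ennreal (1376 * emp.sq m \<xi> e)"
  proof (rule order.trans[OF diff ennreal_leI])
    show "86 * emp.sq m \<xi> (\<lambda>x. H x - e x) \<le> 1376 * emp.sq m \<xi> e"
      using emp.sq_diff_le[of m \<xi> H e] emp by simp
  qed
  also have "ennreal 2 * ennreal (1376 * emp.sq m \<xi> e) = ennreal 2752 * (\<integral>\<^sup>+x. ennreal ((cmod (e x))\<^sup>2) \<partial>emp_measure \<mu> m \<xi>)"
  proof -
    have "ennreal 2 * ennreal (1376 * emp.sq m \<xi> e) = ennreal (2 * (1376 * emp.sq m \<xi> e))"
      by (rule ennreal_mult[symmetric]) (auto simp: emp.sq_nonneg)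
    also have "\<dots> = ennreal (2752 * emp.sq m \<xi> e)" by simp
    also have "\<dots> = ennreal 2752 * ennreal (emp.sq m \<xi> e)"
      by (rule ennreal_mult) (auto simp: emp.sq_nonneg)
    finally show ?thesis by (simp add: nn_emp)
  qed
  finally have main: "(L2_norm \<mu> H)\<^sup>2 \<le> ennreal 2 * (\<integral>\<^sup>+x. ennreal ((cmod (e x))\<^sup>2) \<partial>\<mu>)
      + ennreal 2752 * (\<integral>\<^sup>+x. ennreal ((cmod (e x))\<^sup>2) \<partial>emp_measure \<mu> m \<xi>)"
    by (simp add: mult_left_mono add_left_mono)
  interpret \<mu>: prob_space \<mu> by fact
  interpret emp: prob_space "emp_measure \<mu> m \<xi>" by (rule prob_space_emp[OF m \<xi>])
  show "L2_norm \<mu> H \<le> ennreal 53 * sup_norm (space \<mu>) e"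
  proof (rule ennreal_power2_le_imp_le)
    define S where "S = sup_norm (space \<mu>) e"
    have pt: "ennreal ((cmod (e x))\<^sup>2) \<le> S\<^sup>2" if "x \<in> space \<mu>" for x
    proof -
      have "ennreal (cmod (e x)) \<le> S" unfolding S_def sup_norm_def using that by (rule SUP_upper)
      then have "(ennreal (cmod (e x)))\<^sup>2 \<le> S\<^sup>2" by (rule power_mono) simp
      then show ?thesis by (simp add: ennreal_power)
    qed
    have sp: "space (emp_measure \<mu> m \<xi>) = space \<mu>" using sets_emp[OF m \<xi>] by (rule sets_eq_imp_space_eq)
    have "(\<integral>\<^sup>+x. ennreal ((cmod (e x))\<^sup>2) \<partial>\<mu>) \<le> (\<integral>\<^sup>+x. S\<^sup>2 \<partial>\<mu>)" by (intro nn_integral_mono pt)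
    moreover have "(\<integral>\<^sup>+x. ennreal ((cmod (e x))\<^sup>2) \<partial>emp_measure \<mu> m \<xi>) \<le> (\<integral>\<^sup>+x. S\<^sup>2 \<partial>emp_measure \<mu> m \<xi>)"
      by (intro nn_integral_mono pt) (simp add: sp)
    ultimately have "(L2_norm \<mu> H)\<^sup>2 \<le> ennreal 2 * S\<^sup>2 + ennreal 2752 * S\<^sup>2"
      by (intro order.trans[OF main] add_mono mult_left_mono) (auto simp: \<mu>.emeasure_space_1 emp.emeasure_space_1)
    also have "\<dots> = ennreal 2754 * S\<^sup>2" by (simp flip: distrib_right ennreal_plus)
    also have "\<dots> \<le> ennreal (53\<^sup>2) * S\<^sup>2" by (intro mult_right_mono ennreal_leI) auto
    also have "\<dots> = (ennreal 53 * S)\<^sup>2" by (simp only: power_mult_distrib ennreal_power)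
    finally show "(L2_norm \<mu> H)\<^sup>2 \<le> (ennreal 53 * sup_norm (space \<mu>) e)\<^sup>2" by (simp add: S_def)
  qed
  show "L2_norm \<mu> H \<le> ennreal 75 * L2_norm (mix_measure \<mu> m \<xi>) e"
  proof (rule ennreal_power2_le_imp_le)
    define S where "S = (\<integral>\<^sup>+x. ennreal ((cmod (e x))\<^sup>2) \<partial>mix_measure \<mu> m \<xi>)"
    have "(L2_norm \<mu> H)\<^sup>2 \<le> ennreal 2 * (ennreal 2 * S) + ennreal 2752 * (ennreal 2 * S)"
      using nn_integral_le_mix[OF m \<xi>, of "\<lambda>x. ennreal ((cmod (e x))\<^sup>2)"]
      by (intro order.trans[OF main] add_mono mult_left_mono) (auto simp: S_def)
    also have "\<dots> = ennreal 5508 * S"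
      by (simp only: mult.assoc[symmetric] distrib_right[symmetric] ennreal_mult[symmetric] ennreal_plus[symmetric]) simp
    also have "\<dots> \<le> ennreal (75\<^sup>2) * S" by (intro mult_right_mono ennreal_leI) auto
    also have "\<dots> = (ennreal 75 * L2_norm (mix_measure \<mu> m \<xi>) e)\<^sup>2"
      by (simp only: power_mult_distrib L2_norm_power2 ennreal_power S_def)
    finally show "(L2_norm \<mu> H)\<^sup>2 \<le> (ennreal 75 * L2_norm (mix_measure \<mu> m \<xi>) e)\<^sup>2" .
  qed
qed

section \<open>Riesz bounds as integrals and the pursuit on samples\<close>

lemma bounded_combination:
  fixes \<mu> :: "'a measure"
  assumes \<mu>: "prob_space \<mu>" and J: "finite J"
    and meas: "\<And>j. j \<in> J \<Longrightarrow> \<phi> j \<in> borel_measurable \<mu>"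
    and bound: "\<And>j x. j \<in> J \<Longrightarrow> x \<in> space \<mu> \<Longrightarrow> cmod (\<phi> j x) \<le> 1"
  shows "(\<lambda>x. \<Sum>j\<in>J. a j * \<phi> j x) \<in> borel_measurable \<mu>"
    and "(\<integral>\<^sup>+x. ennreal ((cmod (\<Sum>j\<in>J. a j * \<phi> j x))\<^sup>2) \<partial>\<mu>) = ennreal (\<integral>x. (cmod (\<Sum>j\<in>J. a j * \<phi> j x))\<^sup>2 \<partial>\<mu>)"
proof -
  interpret prob_space \<mu> by fact
  show [measurable]: "(\<lambda>x. \<Sum>j\<in>J. a j * \<phi> j x) \<in> borel_measurable \<mu>"
    using meas by (intro borel_measurable_sum borel_measurable_times) auto
  show "(\<integral>\<^sup>+x. ennreal ((cmod (\<Sum>j\<in>J. a j * \<phi> j x))\<^sup>2) \<partial>\<mu>) = ennreal (\<integral>x. (cmod (\<Sum>j\<in>J. a j * \<phi> j x))\<^sup>2 \<partial>\<mu>)"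
  proof (rule nn_integral_eq_integral)
    show "integrable \<mu> (\<lambda>x. (cmod (\<Sum>j\<in>J. a j * \<phi> j x))\<^sup>2)"
    proof (rule integrable_const_bound[where B = "(\<Sum>j\<in>J. cmod (a j))\<^sup>2"])
      show "AE x in \<mu>. norm ((cmod (\<Sum>j\<in>J. a j * \<phi> j x))\<^sup>2) \<le> (\<Sum>j\<in>J. cmod (a j))\<^sup>2"
      proof (rule AE_I2)
        fix x assume "x \<in> space \<mu>"
        then have "cmod (\<Sum>j\<in>J. a j * \<phi> j x) \<le> (\<Sum>j\<in>J. cmod (a j))"
          using bound by (intro sum_norm_le) (auto simp: norm_mult intro!: mult_left_le)
        then have "(cmod (\<Sum>j\<in>J. a j * \<phi> j x))\<^sup>2 \<le> (\<Sum>j\<in>J. cmod (a j))\<^sup>2"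
          by (intro power_mono) auto
        then show "norm ((cmod (\<Sum>j\<in>J. a j * \<phi> j x))\<^sup>2) \<le> (\<Sum>j\<in>J. cmod (a j))\<^sup>2" by simp
      qed
    qed measurable
  qed auto
qed

text \<open>The class is defined through exactly \<open>s\<close> elements; smaller sets are filled
  up with zero coefficients, for which \<open>s \<le> N\<close> leaves room.\<close>

lemma riesz_integral:
  fixes \<mu> :: "'a measure"
  assumes riesz: "riesz F \<mu> \<phi> N s R\<^sub>1 R\<^sub>2" and s: "s \<le> N" and R: "0 < R\<^sub>1" "0 < R\<^sub>2" and F: "0 \<in> F"
    and \<mu>: "prob_space \<mu>"
    and meas: "\<And>j. j \<in> {1..N} \<Longrightarrow> \<phi> j \<in> borel_measurable \<mu>"
    and bound: "\<And>j x. j \<in> {1..N} \<Longrightarrow> x \<in> space \<mu> \<Longrightarrow> cmod (\<phi> j x) \<le> 1"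
    and J: "J \<subseteq> {1..N}" "card J \<le> s" and a: "\<forall>j\<in>J. a j \<in> F"
  shows "R\<^sub>1\<^sup>2 * (\<Sum>j\<in>J. (cmod (a j))\<^sup>2) \<le> (\<integral>x. (cmod (\<Sum>j\<in>J. a j * \<phi> j x))\<^sup>2 \<partial>\<mu>)"
    and "(\<integral>x. (cmod (\<Sum>j\<in>J. a j * \<phi> j x))\<^sup>2 \<partial>\<mu>) \<le> R\<^sub>2\<^sup>2 * (\<Sum>j\<in>J. (cmod (a j))\<^sup>2)"
proof -
  obtain J' where J': "J \<subseteq> J'" "J' \<subseteq> {1..N}" "card J' = s"
    using exists_subset_between[OF J(2) _ J(1)] s by auto
  have fin: "finite J'" using J' finite_subset by blast
  define b where "b j = (if j \<in> J then a j else 0)" for j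
  have comb: "(\<Sum>j\<in>J'. b j * \<phi> j x) = (\<Sum>j\<in>J. a j * \<phi> j x)" for x
    using J' fin by (intro sum.mono_neutral_cong_right) (auto simp: b_def)
  have coef: "(\<Sum>j\<in>J'. (cmod (b j))\<^sup>2) = (\<Sum>j\<in>J. (cmod (a j))\<^sup>2)"
    using J' fin by (intro sum.mono_neutral_cong_right) (auto simp: b_def)
  define S where "S = (\<Sum>j\<in>J. (cmod (a j))\<^sup>2)"
  define I where "I = (\<integral>x. (cmod (\<Sum>j\<in>J. a j * \<phi> j x))\<^sup>2 \<partial>\<mu>)"
  have S: "0 \<le> S" and I: "0 \<le> I" by (auto simp: S_def I_def sum_nonneg)
  have L: "(L2_norm \<mu> (\<lambda>x. \<Sum>j\<in>J. a j * \<phi> j x))\<^sup>2 = ennreal I"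
    unfolding L2_norm_power2 I_def using J meas bound finite_subset[OF J(1)]
    by (intro bounded_combination(2)[OF \<mu>]) auto
  have "\<forall>j\<in>J'. b j \<in> F" using a F by (auto simp: b_def)
  with riesz J' have le: "ennreal (R\<^sub>1 * sqrt S) \<le> L2_norm \<mu> (\<lambda>x. \<Sum>j\<in>J. a j * \<phi> j x)"
    "L2_norm \<mu> (\<lambda>x. \<Sum>j\<in>J. a j * \<phi> j x) \<le> ennreal (R\<^sub>2 * sqrt S)"
    unfolding riesz_def comb[symmetric] coef[symmetric] S_def by auto
  have "(ennreal (R\<^sub>1 * sqrt S))\<^sup>2 \<le> ennreal I" unfolding L[symmetric] by (intro power_mono le) auto
  then have "R\<^sub>1\<^sup>2 * S \<le> I" using R S I by (simp add: ennreal_power power_mult_distrib)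
  then show "R\<^sub>1\<^sup>2 * (\<Sum>j\<in>J. (cmod (a j))\<^sup>2) \<le> (\<integral>x. (cmod (\<Sum>j\<in>J. a j * \<phi> j x))\<^sup>2 \<partial>\<mu>)"
    by (simp add: S_def I_def)
  have "ennreal I \<le> (ennreal (R\<^sub>2 * sqrt S))\<^sup>2" unfolding L[symmetric] by (intro power_mono le) auto
  then have "I \<le> R\<^sub>2\<^sup>2 * S" using R S I by (simp add: ennreal_power power_mult_distrib)
  then show "(\<integral>x. (cmod (\<Sum>j\<in>J. a j * \<phi> j x))\<^sup>2 \<partial>\<mu>) \<le> R\<^sub>2\<^sup>2 * (\<Sum>j\<in>J. (cmod (a j))\<^sup>2)"
    by (simp add: S_def I_def)
qed

definition sparse_rip ::
    "complex set \<Rightarrow> 'a measure \<Rightarrow> (nat \<Rightarrow> 'a \<Rightarrow> complex) \<Rightarrow> nat \<Rightarrow> nat \<Rightarrow> nat \<Rightarrow> (nat \<Rightarrow> 'a) \<Rightarrow> bool" where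
  "sparse_rip F \<mu> \<phi> N s m \<xi> \<longleftrightarrow> (\<forall>J a. J \<subseteq> {1..N} \<longrightarrow> card J \<le> s \<longrightarrow> (\<forall>j\<in>J. a j \<in> F) \<longrightarrow>
       (\<integral>x. (cmod (\<Sum>j\<in>J. a j * \<phi> j x))\<^sup>2 \<partial>\<mu>) \<le> 86 * emp_avg m \<xi> (\<lambda>x. (cmod (\<Sum>j\<in>J. a j * \<phi> j x))\<^sup>2) \<and>
       emp_avg m \<xi> (\<lambda>x. (cmod (\<Sum>j\<in>J. a j * \<phi> j x))\<^sup>2) \<le> 44 * (\<integral>x. (cmod (\<Sum>j\<in>J. a j * \<phi> j x))\<^sup>2 \<partial>\<mu>))"

text \<open>For \<open>\<rho> = R\<^sub>2 / R\<^sub>1\<close> the squared Riesz constants with respect to the samples are \<open>r\<^sub>1 = R\<^sub>1\<^sup>2 / 86\<close> and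
  \<open>r\<^sub>2 = 44 * R\<^sub>2\<^sup>2\<close>, so that \<open>3784 * \<rho>\<^sup>2 = r\<^sub>2 / r\<^sub>1\<close> and \<open>121088 * \<rho>\<^sup>2 = 32 * r\<^sub>2 / r\<^sub>1\<close>.\<close>

definition phase_factor :: "real \<Rightarrow> real \<Rightarrow> nat" where
  "phase_factor t \<rho> = nat \<lceil>ln (2 * (121088 * \<rho>\<^sup>2)) * (3784 * \<rho>\<^sup>2) / t\<^sup>2\<rceil> + 1"

text \<open>The Riesz bounds for \<open>\<mu>\<close> and the isometry property compose to Riesz
  bounds in the empirical space, so a realization there is an instance of \<open>greedy\<close>. The
  alternative \<open>v = 0\<close> is meant for \<open>s = 1\<close>: then the only competitor is
  the zero function.\<close>

lemma womp_errors:
  fixes \<mu> :: "'a measure"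
  assumes F: "F = \<real> \<or> F = UNIV" and \<mu>: "prob_space \<mu>"
    and system: "\<forall>j\<in>{1..N}. \<phi> j \<in> borel_measurable \<mu> \<and> (\<forall>x\<in>space \<mu>. \<phi> j x \<in> F \<and> cmod (\<phi> j x) \<le> 1)"
    and s: "1 \<le> s" "s \<le> N" and R: "0 < R\<^sub>1" "R\<^sub>1 \<le> R\<^sub>2" and riesz: "riesz F \<mu> \<phi> N s R\<^sub>1 R\<^sub>2"
    and t: "0 < t" "t \<le> 1" and m: "1 \<le> m" and \<xi>: "\<xi> \<in> {1..m} \<rightarrow> space \<mu>"
    and rip: "v = 0 \<or> sparse_rip F \<mu> \<phi> N s m \<xi>"
    and f0: "f0 \<in> borel_measurable \<mu>" "f0 ` space \<mu> \<subseteq> F"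
    and womp: "womp F (emp_measure \<mu> m \<xi>) \<phi> N t f0 k f"
    and b: "b = phase_factor t (R\<^sub>2 / R\<^sub>1)" and v: "(1 + 4 * b) * v \<le> s"
  shows "L2_norm (emp_measure \<mu> m \<xi>) (f (4 * b * v)) \<le> ennreal 3 * sigma_best F \<phi> N (L2_norm (emp_measure \<mu> m \<xi>)) v f0"
    and "L2_norm \<mu> (f (4 * b * v)) \<le> ennreal 53 * sigma_best F \<phi> N (sup_norm (space \<mu>)) v f0"
    and "L2_norm \<mu> (f (4 * b * v)) \<le> ennreal 75 * sigma_best F \<phi> N (L2_norm (mix_measure \<mu> m \<xi>)) v f0"
proof -
  have meas: "\<phi> j \<in> borel_measurable \<mu>" if "j \<in> {1..N}" for j using system that by blast
  have bound: "cmod (\<phi> j x) \<le> 1" and \<phi>F: "\<phi> j x \<in> F" if "j \<in> {1..N}" "x \<in> space \<mu>" for j x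
    using system that by blast+
  have f0F: "f0 x \<in> F" if "x \<in> space \<mu>" for x using f0(2) that by blast
  interpret sc: scalars F using F by unfold_locales
  let ?ip = "\<lambda>f g. emp_avg m \<xi> (\<lambda>x. f x * cnj (g x))"
  have lin_meas: "g \<in> borel_measurable \<mu>" if "g \<in> lin_span F \<phi> J" "J \<subseteq> {1..N}" for g J
    using that meas finite_subset[OF that(2)]
    by (auto simp: lin_span_def intro!: borel_measurable_sum borel_measurable_times)
  have k: "k n \<in> {1..N}" if "1 \<le> n" for n using womp that by (auto simp: womp_def)
  then have \<Gamma>: "k ` {1..n} \<subseteq> {1..N}" for n by fastforce
  have f_0: "f 0 = f0" using womp by (simp add: womp_def)
  have approx: "(\<lambda>x. f 0 x - f n x) \<in> lin_span F \<phi> (k ` {1..n})"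
    and orth: "h \<in> lin_span F \<phi> (k ` {1..n}) \<Longrightarrow> L2_inner (emp_measure \<mu> m \<xi>) (f n) h = 0" for n h
  proof -
    have "(\<lambda>x. f 0 x - f n x) \<in> lin_span F \<phi> (k ` {1..n}) \<and>
      (h \<in> lin_span F \<phi> (k ` {1..n}) \<longrightarrow> L2_inner (emp_measure \<mu> m \<xi>) (f n) h = 0)"
    \<comment> \<open>\<open>womp\<close> describes the residuals from index 1 on; at index 0 the
      span consists of the zero function alone.\<close>
    proof (cases "n = 0")
      case True
      then show ?thesis by (auto simp: lin_span_def L2_inner_def)
    next
      case False
      have "\<forall>n\<ge>1. \<exists>G. is_orth_proj (emp_measure \<mu> m \<xi>) (lin_span F \<phi> (k ` {1..n})) f0 G \<and> f n = (\<lambda>x. f0 x - G x)"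
        using womp unfolding womp_def by blast
      moreover have "1 \<le> n" using False by simp
      ultimately obtain G where "is_orth_proj (emp_measure \<mu> m \<xi>) (lin_span F \<phi> (k ` {1..n})) f0 G" "f n = (\<lambda>x. f0 x - G x)"
        by blast
      then show ?thesis by (auto simp: is_orth_proj_def f_0)
    qed
    then show "(\<lambda>x. f 0 x - f n x) \<in> lin_span F \<phi> (k ` {1..n})"
      "h \<in> lin_span F \<phi> (k ` {1..n}) \<Longrightarrow> L2_inner (emp_measure \<mu> m \<xi>) (f n) h = 0" by auto
  qed
  have fm: "f n \<in> borel_measurable \<mu>" for n
  proof -
    have "(\<lambda>x. f0 x - (f 0 x - f n x)) \<in> borel_measurable \<mu>"
      by (intro borel_measurable_diff f0(1) lin_meas[OF approx \<Gamma>])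
    then show ?thesis by (simp add: f_0)
  qed
  have fF: "f n x \<in> F" if x: "x \<in> space \<mu>" for n x
  proof -
    obtain a where a: "\<forall>j\<in>k ` {1..n}. a j \<in> F" "(\<lambda>x. f 0 x - f n x) = (\<lambda>x. \<Sum>j\<in>k ` {1..n}. a j * \<phi> j x)"
      using approx[of n] by (auto simp: lin_span_def)
    have "(\<Sum>j\<in>k ` {1..n}. a j * \<phi> j x) \<in> F"
      using a(1) \<Gamma>[of n] by (intro sc.F_sum sc.F_closed(5) \<phi>F x) auto
    then have "f 0 x - f n x \<in> F" unfolding fun_cong[OF a(2)] .
    from sc.F_closed(4)[OF f0F[OF x] this] have "f 0 x - (f 0 x - f n x) \<in> F" by (simp only: f_0)
    then show ?thesis by simp
  qed
  have inner: "L2_inner (emp_measure \<mu> m \<xi>) g h = ?ip g h"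
    if "g \<in> borel_measurable \<mu>" "h \<in> borel_measurable \<mu>" for g h
  proof -
    have "(\<lambda>x. cnj (h x)) \<in> borel_measurable \<mu>"
      by (rule measurable_compose[OF that(2)]) (intro borel_measurable_continuous_onI continuous_intros)
    then have "(\<lambda>x. g x * cnj (h x)) \<in> borel_measurable \<mu>" using that(1) by (rule borel_measurable_times[rotated])
    then show ?thesis unfolding L2_inner_def by (rule integral_emp[OF m \<xi>])
  qed
  have main: "emp.sq m \<xi> (f (4 * b * v)) \<le> 7 * emp.sq m \<xi> (\<lambda>x. f0 x - (\<Sum>j\<in>J. a j * \<phi> j x)) \<and>
     (\<integral>\<^sup>+x. ennreal ((cmod (f (4 * b * v) x - (f0 x - (\<Sum>j\<in>J. a j * \<phi> j x))))\<^sup>2) \<partial>\<mu>)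
       \<le> ennreal (86 * emp.sq m \<xi> (\<lambda>x. f (4 * b * v) x - (f0 x - (\<Sum>j\<in>J. a j * \<phi> j x))))"
    if J: "J \<subseteq> {1..N}" "card J \<le> v" and a: "\<forall>j\<in>J. a j \<in> F" for J a
  proof (cases "v = 0")
    case True
    then have "J = {}" using J finite_subset[OF J(1)] by simp
    then show ?thesis using emp.sq_nonneg[of m \<xi> f0] by (simp add: True f_0)
  next
    case False
    with rip have rip1: "(\<integral>x. (cmod (\<Sum>j\<in>J. a j * \<phi> j x))\<^sup>2 \<partial>\<mu>) \<le> 86 * emp_avg m \<xi> (\<lambda>x. (cmod (\<Sum>j\<in>J. a j * \<phi> j x))\<^sup>2)"
      and rip2: "emp_avg m \<xi> (\<lambda>x. (cmod (\<Sum>j\<in>J. a j * \<phi> j x))\<^sup>2) \<le> 44 * (\<integral>x. (cmod (\<Sum>j\<in>J. a j * \<phi> j x))\<^sup>2 \<partial>\<mu>)"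
      if "J \<subseteq> {1..N}" "card J \<le> s" "\<forall>j\<in>J. a j \<in> F" for J a
      using that by (auto simp: sparse_rip_def)
    have "0 < R\<^sub>2" using R by simp
    have ri1: "R\<^sub>1\<^sup>2 * (\<Sum>j\<in>J. (cmod (a j))\<^sup>2) \<le> (\<integral>x. (cmod (\<Sum>j\<in>J. a j * \<phi> j x))\<^sup>2 \<partial>\<mu>)"
      if "J \<subseteq> {1..N}" "card J \<le> s" "\<forall>j\<in>J. a j \<in> F" for J a
      by (rule riesz_integral(1)[OF riesz s(2) R(1) \<open>0 < R\<^sub>2\<close> sc.F_closed(1) \<mu> meas bound that])
    have ri2: "(\<integral>x. (cmod (\<Sum>j\<in>J. a j * \<phi> j x))\<^sup>2 \<partial>\<mu>) \<le> R\<^sub>2\<^sup>2 * (\<Sum>j\<in>J. (cmod (a j))\<^sup>2)"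
      if "J \<subseteq> {1..N}" "card J \<le> s" "\<forall>j\<in>J. a j \<in> F" for J a
      by (rule riesz_integral(2)[OF riesz s(2) R(1) \<open>0 < R\<^sub>2\<close> sc.F_closed(1) \<mu> meas bound that])
    interpret g: greedy ?ip F \<phi> N s "R\<^sub>1\<^sup>2 / 86" "44 * R\<^sub>2\<^sup>2" t k f
    proof unfold_locales
      show "0 < R\<^sub>1\<^sup>2 / 86" using R by simp
      have "R\<^sub>1\<^sup>2 \<le> R\<^sub>2\<^sup>2" using R by (intro power_mono) auto
      moreover have "0 \<le> R\<^sub>2\<^sup>2" by simp
      ultimately show "R\<^sub>1\<^sup>2 / 86 \<le> 44 * R\<^sub>2\<^sup>2" by linarith
      show "0 < t" "t \<le> 1" "1 \<le> s" using t s by auto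
      fix J :: "nat set" and a :: "nat \<Rightarrow> complex"
      assume J: "J \<subseteq> {1..N}" "card J \<le> s" "\<forall>j\<in>J. a j \<in> F"
      show "R\<^sub>1\<^sup>2 / 86 * (\<Sum>j\<in>J. (cmod (a j))\<^sup>2) \<le> emp.sq m \<xi> (\<lambda>x. \<Sum>j\<in>J. a j * \<phi> j x)"
        using rip1[OF J] ri1[OF J] by (simp add: emp_sq)
      show "emp.sq m \<xi> (\<lambda>x. \<Sum>j\<in>J. a j * \<phi> j x) \<le> 44 * R\<^sub>2\<^sup>2 * (\<Sum>j\<in>J. (cmod (a j))\<^sup>2)"
        using rip2[OF J] ri2[OF J] by (simp add: emp_sq)
    next
      fix n
      show kn: "k (Suc n) \<in> {1..N}" by (rule k) simp
      \<comment> \<open>For \<open>F = \<real>\<close> the inner product must be real, since it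
        enters the coefficient of the corrected approximant in \<open>E_Suc_le\<close>.\<close>
      show "?ip (f n) (\<phi> (k (Suc n))) \<in> F"
      proof -
        have "(\<Sum>\<nu>=1..m. f n (\<xi> \<nu>) * cnj (\<phi> (k (Suc n)) (\<xi> \<nu>))) \<in> F"
          using \<xi> kn by (intro sc.F_sum sc.F_closed(5,8) fF \<phi>F) auto
        then show ?thesis using sc.F_closed(9)[of _ "real m"] by (simp add: emp_avg_def)
      qed
      show "(\<lambda>x. f 0 x - f n x) \<in> lin_span F \<phi> (k ` {1..n})" by (rule approx)
      show "?ip (f n) h = 0" if "h \<in> lin_span F \<phi> (k ` {1..n})" for h
        using orth[OF that] inner[OF fm lin_meas[OF that \<Gamma>]] by simp
      fix j assume j: "j \<in> {1..N}"
      have "cmod (L2_inner (emp_measure \<mu> m \<xi>) (f n) (\<phi> j))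
          \<le> (SUP j\<in>{1..N}. cmod (L2_inner (emp_measure \<mu> m \<xi>) (f n) (\<phi> j)))"
        using j by (intro cSUP_upper) auto
      then have "t * cmod (L2_inner (emp_measure \<mu> m \<xi>) (f n) (\<phi> j))
          \<le> t * (SUP j\<in>{1..N}. cmod (L2_inner (emp_measure \<mu> m \<xi>) (f n) (\<phi> j)))"
        using t by (intro mult_left_mono) auto
      also have "\<dots> \<le> cmod (L2_inner (emp_measure \<mu> m \<xi>) (f n) (\<phi> (k (Suc n))))"
      proof -
        have "\<forall>n\<ge>1. t * (SUP j\<in>{1..N}. cmod (L2_inner (emp_measure \<mu> m \<xi>) (f (n - 1)) (\<phi> j)))
          \<le> cmod (L2_inner (emp_measure \<mu> m \<xi>) (f (n - 1)) (\<phi> (k n)))"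
          using womp unfolding womp_def by blast
        from this[rule_format, of "Suc n"] show ?thesis by simp
      qed
      finally show "t * cmod (?ip (f n) (\<phi> j)) \<le> cmod (?ip (f n) (\<phi> (k (Suc n))))"
        by (simp only: inner[OF fm meas[OF j]] inner[OF fm meas[OF kn]])
    qed
    define \<rho> where "\<rho> = R\<^sub>2 / R\<^sub>1"
    have \<rho>: "1 \<le> \<rho>" using R by (simp add: \<rho>_def)
    then have \<rho>2: "1 \<le> \<rho>\<^sup>2" by (simp add: one_le_power)
    have \<mu>_eq: "121088 * \<rho>\<^sup>2 = 32 * (44 * R\<^sub>2\<^sup>2) / (R\<^sub>1\<^sup>2 / 86)" using R by (simp add: \<rho>_def power_divide)
    have exp_b: "exp (- g.\<kappa> * real b) \<le> 1 / (2 * (121088 * \<rho>\<^sup>2))"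
    proof -
      have \<kappa>: "g.\<kappa> = t\<^sup>2 / (3784 * \<rho>\<^sup>2)"
        using R unfolding g.\<kappa>_def by (simp add: \<rho>_def power_divide)
      have b_large: "ln (2 * (121088 * \<rho>\<^sup>2)) * (3784 * \<rho>\<^sup>2) / t\<^sup>2 \<le> real b"
        unfolding b phase_factor_def \<rho>_def[symmetric] by linarith
      have solve: "X \<le> t\<^sup>2 / Y * real b" if "X * Y / t\<^sup>2 \<le> real b" "0 < Y" for X Y :: real
        using that t by (simp add: pos_divide_le_eq pos_le_divide_eq mult.commute)
      have "ln (2 * (121088 * \<rho>\<^sup>2)) \<le> g.\<kappa> * real b"
        unfolding \<kappa> by (rule solve[OF b_large]) (use \<rho> in simp)
      then have "exp (- g.\<kappa> * real b) \<le> exp (- ln (2 * (121088 * \<rho>\<^sup>2)))"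
        by (simp only: exp_le_cancel_iff mult_minus_left neg_le_iff_le)
      also have "\<dots> = 1 / (2 * (121088 * \<rho>\<^sup>2))"
        using \<rho>2 by (simp only: exp_minus exp_ln inverse_eq_divide)
      finally show ?thesis .
    qed
    have vs: "v + 4 * b * v \<le> s" using v by (simp add: distrib_right)
    have first: "emp.sq m \<xi> (f (4 * b * v)) \<le> 7 * emp.sq m \<xi> (\<lambda>x. f0 x - (\<Sum>j\<in>J. a j * \<phi> j x))"
      using g.greedy_bound[OF J(1) a refl \<mu>_eq exp_b J(2) vs] unfolding f_0 .
    define H where "H = f (4 * b * v)"
    \<comment> \<open>These indices carry the difference between the residual and the competitor's
      error; there are at most \<open>4 * b * v + v\<close> of them, which the condition on
      \<open>v\<close> keeps within \<open>s\<close>.\<close>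
    define \<Gamma>' where "\<Gamma>' = k ` {1..4 * b * v} \<union> J"
    have finG: "finite \<Gamma>'" using finite_subset[OF J(1)] by (simp add: \<Gamma>'_def)
    have in1: "(\<lambda>x. f 0 x - H x) \<in> lin_span F \<phi> \<Gamma>'"
      unfolding H_def by (rule sc.lin_span_mono[OF _ finG approx]) (simp add: \<Gamma>'_def)
    have in2: "(\<lambda>x. \<Sum>j\<in>J. a j * \<phi> j x) \<in> lin_span F \<phi> \<Gamma>'"
      by (rule sc.lin_span_mono[OF _ finG, of J]) (use a in \<open>auto simp: \<Gamma>'_def lin_span_def\<close>)
    from sc.lin_span_diff[OF in2 in1] obtain d where d: "\<forall>j\<in>\<Gamma>'. d j \<in> F"
      "(\<lambda>x. (\<Sum>j\<in>J. a j * \<phi> j x) - (f 0 x - H x)) = (\<lambda>x. \<Sum>j\<in>\<Gamma>'. d j * \<phi> j x)"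
      by (auto simp: lin_span_def)
    have diff: "(\<lambda>x. H x - (f0 x - (\<Sum>j\<in>J. a j * \<phi> j x))) = (\<lambda>x. \<Sum>j\<in>\<Gamma>'. d j * \<phi> j x)"
      unfolding d(2)[symmetric] by (simp add: f_0 algebra_simps)
    have \<Gamma>'N: "\<Gamma>' \<subseteq> {1..N}" using \<Gamma> J(1) by (auto simp: \<Gamma>'_def)
    have "card \<Gamma>' \<le> card (k ` {1..4 * b * v}) + card J" unfolding \<Gamma>'_def by (rule card_Un_le)
    also have "\<dots> \<le> 4 * b * v + v" using g.card_\<Gamma> J(2) by (intro add_mono) auto
    also have "\<dots> \<le> s" using vs by simp
    finally have card: "card \<Gamma>' \<le> s" .
    have "(\<integral>\<^sup>+x. ennreal ((cmod (\<Sum>j\<in>\<Gamma>'. d j * \<phi> j x))\<^sup>2) \<partial>\<mu>)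
        = ennreal (\<integral>x. (cmod (\<Sum>j\<in>\<Gamma>'. d j * \<phi> j x))\<^sup>2 \<partial>\<mu>)"
      using \<Gamma>'N meas bound by (intro bounded_combination(2)[OF \<mu> finG]) auto
    also have "\<dots> \<le> ennreal (86 * emp.sq m \<xi> (\<lambda>x. \<Sum>j\<in>\<Gamma>'. d j * \<phi> j x))"
      unfolding emp_sq by (intro ennreal_leI rip1[OF \<Gamma>'N card d(1)])
    finally have "(\<integral>\<^sup>+x. ennreal ((cmod (H x - (f0 x - (\<Sum>j\<in>J. a j * \<phi> j x))))\<^sup>2) \<partial>\<mu>)
       \<le> ennreal (86 * emp.sq m \<xi> (\<lambda>x. H x - (f0 x - (\<Sum>j\<in>J. a j * \<phi> j x))))"
      unfolding diff fun_cong[OF diff] .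
    with first show ?thesis by (simp add: H_def)
  qed
  have "L2_norm (emp_measure \<mu> m \<xi>) (f (4 * b * v)) \<le> ennreal 3 * L2_norm (emp_measure \<mu> m \<xi>) (\<lambda>x. f0 x - g x) \<and>
     L2_norm \<mu> (f (4 * b * v)) \<le> ennreal 53 * sup_norm (space \<mu>) (\<lambda>x. f0 x - g x) \<and>
     L2_norm \<mu> (f (4 * b * v)) \<le> ennreal 75 * L2_norm (mix_measure \<mu> m \<xi>) (\<lambda>x. f0 x - g x)"
    if g: "g \<in> sparse F \<phi> N v" for g
  proof -
    obtain J a where J: "J \<subseteq> {1..N}" "card J \<le> v" "\<forall>j\<in>J. a j \<in> F" and g: "g = (\<lambda>x. \<Sum>j\<in>J. a j * \<phi> j x)"
      using g by (auto simp: sparse_def lin_span_def)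
    have "g \<in> lin_span F \<phi> J" using J(3) g by (auto simp: lin_span_def)
    then have "(\<lambda>x. f0 x - g x) \<in> borel_measurable \<mu>"
      by (intro borel_measurable_diff f0(1) lin_meas[OF _ J(1)])
    from error_transfer[OF \<mu> m \<xi> fm this, of "4 * b * v"] main[OF J] show ?thesis unfolding g by simp
  qed
  then show "L2_norm (emp_measure \<mu> m \<xi>) (f (4 * b * v)) \<le> ennreal 3 * sigma_best F \<phi> N (L2_norm (emp_measure \<mu> m \<xi>)) v f0"
    and "L2_norm \<mu> (f (4 * b * v)) \<le> ennreal 53 * sigma_best F \<phi> N (sup_norm (space \<mu>)) v f0"
    and "L2_norm \<mu> (f (4 * b * v)) \<le> ennreal 75 * sigma_best F \<phi> N (L2_norm (mix_measure \<mu> m \<xi>)) v f0"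
    unfolding sigma_best_def by (intro le_mult_INF_ennreal; simp)+
qed

text \<open>Tested on a single element, whose norm is at most 1. The resulting
  \<open>K \<ge> 1\<close> keeps \<open>ln (2 * K * s)\<close> away from zero.\<close>

lemma riesz_lower_le_1:
  fixes \<mu> :: "'a measure"
  assumes riesz: "riesz F \<mu> \<phi> N s R\<^sub>1 R\<^sub>2" and s: "1 \<le> s" "s \<le> N" and R: "0 < R\<^sub>1" "0 < R\<^sub>2" and F: "F = \<real> \<or> F = UNIV"
    and \<mu>: "prob_space \<mu>"
    and meas: "\<And>j. j \<in> {1..N} \<Longrightarrow> \<phi> j \<in> borel_measurable \<mu>"
    and bound: "\<And>j x. j \<in> {1..N} \<Longrightarrow> x \<in> space \<mu> \<Longrightarrow> cmod (\<phi> j x) \<le> 1"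
  shows "R\<^sub>1\<^sup>2 \<le> 1"
proof -
  interpret prob_space \<mu> by fact
  have "1 \<in> {1..N}" using s by auto
  have F01: "0 \<in> F" "1 \<in> F" using F by auto
  have "R\<^sub>1\<^sup>2 * (\<Sum>j\<in>{1::nat}. (cmod 1)\<^sup>2) \<le> (\<integral>x. (cmod (\<Sum>j\<in>{1}. 1 * \<phi> j x))\<^sup>2 \<partial>\<mu>)"
    by (rule riesz_integral(1)[OF riesz s(2) R F01(1) \<mu> meas bound, where J = "{1}" and a = "\<lambda>_. 1"])
      (use s F01 in auto)
  also have "\<dots> \<le> (\<integral>x. 1 \<partial>\<mu>)"
    using bound[OF \<open>1 \<in> {1..N}\<close>] meas[OF \<open>1 \<in> {1..N}\<close>]
    by (intro integral_mono integrable_const_bound[where B = 1]) (auto simp: power_le_one)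
  also have "\<dots> = 1" by (simp add: prob_space)
  finally show ?thesis by simp
qed

lemma random_sparse_rip:
  fixes \<mu> :: "'a measure"
  assumes F: "F = \<real> \<or> F = UNIV" and \<mu>: "prob_space \<mu>"
    and meas: "\<And>j. j \<in> {1..N} \<Longrightarrow> \<phi> j \<in> borel_measurable \<mu>"
    and bound: "\<And>j x. j \<in> {1..N} \<Longrightarrow> x \<in> space \<mu> \<Longrightarrow> cmod (\<phi> j x) \<le> 1"
    and s: "2 \<le> s" "s \<le> N" and R: "0 < R\<^sub>1" "R\<^sub>1 \<le> R\<^sub>2" and riesz: "riesz F \<mu> \<phi> N s R\<^sub>1 R\<^sub>2" and m: "1 \<le> m"
    and Q_def: "Q = 1 / R\<^sub>1\<^sup>2 * real s"
    and m_large: "128000000 * Q * ln (real N) * (ln (2 * Q))\<^sup>2 * (ln (2 * Q) + ln (ln (real N))) \<le> real m"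
  defines "P \<equiv> (\<Pi>\<^sub>M \<nu>\<in>{1..m}. \<mu>)"
  shows "\<exists>E\<in>sets P. 1 - 2 * exp (- (1 / 5632) * real m / (Q * (ln (2 * Q))\<^sup>2)) \<le> measure P E \<and>
      (\<forall>\<xi>\<in>E. sparse_rip F \<mu> \<phi> N s m \<xi>)"
proof -
  have F0: "0 \<in> F" and s1: "1 \<le> s" using F s by auto
  have "R\<^sub>1\<^sup>2 \<le> 1" by (rule riesz_lower_le_1[OF riesz s1 s(2) R(1) _ F \<mu> meas bound]) (use R in auto)
  then have K: "1 \<le> 1 / R\<^sub>1\<^sup>2" using R by simp
  have N2: "2 \<le> N" using s by simp
  have "1 * 2 \<le> 1 / R\<^sub>1\<^sup>2 * real s" using K s by (intro mult_mono) auto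
  then have Q: "2 \<le> Q" by (simp add: Q_def)
  have lnN: "2 / 3 \<le> ln (real N)"
  proof -
    have "ln 2 \<le> ln (real N)" using N2 by simp
    with ln2_ge_two_thirds show ?thesis by linarith
  qed
  \<comment> \<open>This iterated logarithm is negative for \<open>N = 2\<close>. Together with
    \<open>ln (2 * Q) \<ge> 1\<close> the last factor in the bound for \<open>m\<close> is still at
    least \<open>1 / 2\<close>, which turns 128000000 into 64000000.\<close>
  have "- (1 / 2) \<le> ln (ln (real N))"
  proof -
    have "ln (1 + 1 / 2) \<le> (1 / 2 :: real)" by (rule ln_add_one_self_le_self) simp
    then have "- (1 / 2) \<le> ln (2 / 3 :: real)" using ln_inverse[of "3 / 2 :: real"] by simp
    also have "\<dots> \<le> ln (ln (real N))" using lnN by simp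
    finally show ?thesis .
  qed
  moreover have "1 \<le> ln (2 * Q)"
  proof -
    have "ln 4 = 2 * ln (2::real)" using ln_realpow[of 2 2] by simp
    moreover have "ln 4 \<le> ln (2 * Q)" using Q by simp
    ultimately show ?thesis using ln2_ge_two_thirds by linarith
  qed
  ultimately have half: "1 / 2 \<le> ln (2 * Q) + ln (ln (real N))" by linarith
  have "64000000 * Q * ln (real N) * (ln (2 * Q))\<^sup>2
      = 128000000 * Q * ln (real N) * (ln (2 * Q))\<^sup>2 * (1 / 2)" by simp
  also have "\<dots> \<le> 128000000 * Q * ln (real N) * (ln (2 * Q))\<^sup>2 * (ln (2 * Q) + ln (ln (real N)))"
    using half Q lnN by (intro mult_left_mono) auto
  also have "\<dots> \<le> real m" by (rule m_large)
  finally have mQ: "64000000 * Q * ln (real N) * (ln (2 * Q))\<^sup>2 \<le> real m" .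
  define L where "L = nat \<lceil>ln (4096 * Q)\<rceil>"
  define \<eta> where "\<eta> = 1 / (64 * Q)"
  have \<eta>: "0 < \<eta>" using Q by (simp add: \<eta>_def)
  have card_I: "card ({1..N} \<times> units) \<le> 5 * N"
    using card_units by (simp add: card_cartesian_product)
  note fb = failure_bound[OF Q N2 L_def card_I mQ, folded \<eta>_def]
  \<comment> \<open>\<open>L\<close> serves both as cutoff of the levels and as sampling parameter;
    \<open>(0, 0)\<close> is an arbitrary default value.\<close>
  define E where "E = good_samples \<mu> (dict \<phi>) ({1..N} \<times> units) (0, 0) m L L \<eta>"
  have dict_meas: "dict \<phi> i \<in> borel_measurable \<mu>" if "i \<in> {1..N} \<times> units" for i
    by (rule dict_measurable[OF meas that])
  have dict_bound: "cmod (dict \<phi> i x) \<le> 2" if "i \<in> {1..N} \<times> units" "x \<in> space \<mu>" for i x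
    by (rule dict_le_2[OF bound that])
  note gp = good_samples_prob[OF \<mu> _ dict_meas dict_bound m fb(1) \<eta>, where d = "(0, 0)" and t = L]
  show ?thesis
  proof (intro bexI[of _ E] conjI impI ballI allI)
    show "E \<in> sets P" unfolding E_def P_def by (rule gp(1)) (auto simp: finite_units)
    have "1 - (\<Sum>i\<le>L. real (card ({1..N} \<times> units) ^ samples L i) * (2 * exp (- real m * slack L \<eta> i / 2))) \<le> measure P E"
      unfolding E_def P_def by (rule gp(2)) (auto simp: finite_units)
    with fb(3) show "1 - 2 * exp (- (1 / 5632) * real m / (Q * (ln (2 * Q))\<^sup>2)) \<le> measure P E" by linarith
    fix \<xi> assume \<xi>: "\<xi> \<in> E"
    show "sparse_rip F \<mu> \<phi> N s m \<xi>"
      unfolding sparse_rip_def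
    proof (intro allI impI)
      fix J a assume J: "J \<subseteq> {1..N}" "card J \<le> s" "\<forall>j\<in>J. a j \<in> F"
      have low: "R\<^sub>1\<^sup>2 * (\<Sum>j\<in>J. (cmod (a j))\<^sup>2) \<le> (\<integral>x. (cmod (\<Sum>j\<in>J. a j * \<phi> j x))\<^sup>2 \<partial>\<mu>)"
        by (rule riesz_integral(1)[OF riesz s(2) R(1) _ F0 \<mu> meas bound J]) (use R in auto)
      have "1 \<le> N" using N2 by simp
      have slackQ: "4 * (1 / 4) ^ L + 16 * \<eta> + 512 * exp (- real L) \<le> R\<^sub>1\<^sup>2 / (2 * real s)"
        using fb(2) by (simp add: Q_def)
      have "0 < R\<^sub>1\<^sup>2" using R by simp
      note rip = good_samples_rip[OF \<mu> \<open>1 \<le> N\<close> s1 m fb(1) \<eta> meas bound \<open>0 < R\<^sub>1\<^sup>2\<close> slackQ \<xi>[unfolded E_def] J(1,2) low]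
      show "(\<integral>x. (cmod (\<Sum>j\<in>J. a j * \<phi> j x))\<^sup>2 \<partial>\<mu>) \<le> 86 * emp_avg m \<xi> (\<lambda>x. (cmod (\<Sum>j\<in>J. a j * \<phi> j x))\<^sup>2) \<and>
        emp_avg m \<xi> (\<lambda>x. (cmod (\<Sum>j\<in>J. a j * \<phi> j x))\<^sup>2) \<le> 44 * (\<integral>x. (cmod (\<Sum>j\<in>J. a j * \<phi> j x))\<^sup>2 \<partial>\<mu>)"
        using rip by auto
    qed
  qed
qed

theorem theorem1p1:
  shows "\<exists>(C\<^sub>0::real) (c\<^sub>0::real) (C::real) (C'::real) (C''::real) (c :: real \<Rightarrow> real \<Rightarrow> nat).
    C\<^sub>0 > 0 \<and> c\<^sub>0 > 0 \<and> C > 0 \<and> C' > 0 \<and> C'' > 0 \<and> (\<forall>t \<rho>. c t \<rho> \<ge> 1) \<and>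
    (\<forall>(d::nat) (\<Omega> :: (nat \<Rightarrow> real) set) (\<mu> :: (nat \<Rightarrow> real) measure) (F :: complex set)
      (\<phi> :: nat \<Rightarrow> (nat \<Rightarrow> real) \<Rightarrow> complex) (N::nat) (s::nat) (R\<^sub>1::real) (R\<^sub>2::real) (t::real) (m::nat).
      \<Omega> \<subseteq> topspace (Euclidean_space d) \<and> \<Omega> \<noteq> {} \<and>
      prob_space \<mu> \<and> space \<mu> = \<Omega> \<and> sets (restrict_space borel \<Omega>) \<subseteq> sets \<mu> \<and>
      (F = \<real> \<or> F = UNIV) \<and>
      1 \<le> s \<and> s \<le> N \<and>
      (\<forall>j\<in>{1..N}. \<phi> j \<in> borel_measurable \<mu> \<and> \<phi> j ` \<Omega> \<subseteq> F \<and> sup_norm \<Omega> (\<phi> j) \<le> 1) \<and>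
      0 < R\<^sub>1 \<and> R\<^sub>1 \<le> R\<^sub>2 \<and> riesz F \<mu> \<phi> N s R\<^sub>1 R\<^sub>2 \<and>
      0 < t \<and> t \<le> 1 \<and>
      1 \<le> m \<and>
      (let K = 1 / R\<^sub>1\<^sup>2 in
        real m \<ge> C\<^sub>0 * K * real s * ln (real N) * (ln (2 * K * real s))\<^sup>2
                  * (ln (2 * K * real s) + ln (ln (real N))))
      \<longrightarrow>
      (let K = 1 / R\<^sub>1\<^sup>2; P = (\<Pi>\<^sub>M \<nu>\<in>{1..m}. \<mu>); cc = c t (R\<^sub>2 / R\<^sub>1) in
        \<exists>E \<in> sets P.
          measure P E \<ge> 1 - 2 * exp (- c\<^sub>0 * real m / (K * real s * (ln (2 * K * real s))\<^sup>2)) \<and>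
          (\<forall>\<xi>\<in>E. \<forall>(v::nat) f\<^sub>0 k f.
            (1 + cc) * v \<le> s \<and> continuous_on \<Omega> f\<^sub>0 \<and> f\<^sub>0 ` \<Omega> \<subseteq> F \<and>
            womp F (emp_measure \<mu> m \<xi>) \<phi> N t f\<^sub>0 k f
            \<longrightarrow>
            L2_norm (emp_measure \<mu> m \<xi>) (f (cc * v))
              \<le> ennreal C * sigma_best F \<phi> N (L2_norm (emp_measure \<mu> m \<xi>)) v f\<^sub>0 \<and>
            L2_norm \<mu> (f (cc * v))
              \<le> ennreal C' * sigma_best F \<phi> N (sup_norm \<Omega>) v f\<^sub>0 \<and>
            L2_norm \<mu> (f (cc * v))
              \<le> ennreal C'' * sigma_best F \<phi> N (L2_norm (mix_measure \<mu> m \<xi>)) v f\<^sub>0)))"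
proof -
  define c where "c t \<rho> = 4 * phase_factor t \<rho>" for t \<rho>
  \<comment> \<open>The summand 1 in \<open>phase_factor\<close> guarantees this for all arguments;
    it is what forces \<open>v = 0\<close> when \<open>s = 1\<close>.\<close>
  have c1: "\<forall>t \<rho>. 1 \<le> c t \<rho>" by (simp add: c_def phase_factor_def)
  show ?thesis
  proof (rule exI[of _ 128000000], rule exI[of _ "1 / 5632"], rule exI[of _ 3], rule exI[of _ 53],
      rule exI[of _ 75], rule exI[of _ c], intro conjI c1 allI impI, goal_cases)
    case (6 d \<Omega> \<mu> F \<phi> N s R\<^sub>1 R\<^sub>2 t m)
    define K where "K = 1 / R\<^sub>1\<^sup>2"
    define P where "P = (\<Pi>\<^sub>M \<nu>\<in>{1..m}. \<mu>)"
    define Q where "Q = K * real s"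
    from 6 have \<mu>: "prob_space \<mu>" and sp: "space \<mu> = \<Omega>" and borel: "sets (restrict_space borel \<Omega>) \<subseteq> sets \<mu>"
      and F: "F = \<real> \<or> F = UNIV" and s: "1 \<le> s" "s \<le> N" and R: "0 < R\<^sub>1" "R\<^sub>1 \<le> R\<^sub>2"
      and riesz: "riesz F \<mu> \<phi> N s R\<^sub>1 R\<^sub>2" and t: "0 < t" "t \<le> 1" and m: "1 \<le> m" by auto
    from 6 have m_large: "128000000 * K * real s * ln (real N) * (ln (2 * K * real s))\<^sup>2
        * (ln (2 * K * real s) + ln (ln (real N))) \<le> real m" by (simp add: Let_def K_def)
    have meas: "\<phi> j \<in> borel_measurable \<mu>" if "j \<in> {1..N}" for j using 6 that by auto
    have \<phi>F: "\<phi> j x \<in> F" if "j \<in> {1..N}" "x \<in> space \<mu>" for j x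
    proof -
      have "\<phi> j ` \<Omega> \<subseteq> F" using 6 that(1) by blast
      then show ?thesis using that(2) sp by auto
    qed
    have bound: "cmod (\<phi> j x) \<le> 1" if j: "j \<in> {1..N}" and x: "x \<in> space \<mu>" for j x
    proof -
      have "ennreal (cmod (\<phi> j x)) \<le> sup_norm \<Omega> (\<phi> j)"
        unfolding sup_norm_def using x sp by (intro SUP_upper) auto
      also have "\<dots> \<le> 1" using 6 j by auto
      finally show ?thesis by simp
    qed
    interpret P: prob_space P unfolding P_def by (intro prob_space_PiM \<mu>)
    have "\<exists>E\<in>sets P. 1 - 2 * exp (- (1 / 5632) * real m / (Q * (ln (2 * Q))\<^sup>2)) \<le> measure P E \<and>
      (s \<noteq> 1 \<longrightarrow> (\<forall>\<xi>\<in>E. sparse_rip F \<mu> \<phi> N s m \<xi>))"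
    \<comment> \<open>With \<open>s = 1\<close> only \<open>v = 0\<close> is admissible and no
      isometry is required, so the whole space serves as the event; this includes
      \<open>N = 1\<close>.\<close>
    proof (cases "s = 1")
      case True
      then show ?thesis by (intro bexI[of _ "space P"]) (auto simp: P.prob_space)
    next
      case False
      with s have s2: "2 \<le> s" by simp
      have "128000000 * Q * ln (real N) * (ln (2 * Q))\<^sup>2 * (ln (2 * Q) + ln (ln (real N))) \<le> real m"
        using m_large by (simp add: Q_def mult.assoc)
      from random_sparse_rip[OF F \<mu> meas bound s2 s(2) R riesz m Q_def[unfolded K_def] this, folded P_def]
      show ?thesis by auto
    qed
    then obtain E where E: "E \<in> sets P" "1 - 2 * exp (- (1 / 5632) * real m / (Q * (ln (2 * Q))\<^sup>2)) \<le> measure P E"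
      and rip: "\<forall>\<xi>\<in>E. s \<noteq> 1 \<longrightarrow> sparse_rip F \<mu> \<phi> N s m \<xi>"
      by blast
    show ?case
      unfolding Let_def K_def[symmetric] P_def[symmetric]
    proof (rule bexI[OF _ E(1)], intro conjI ballI allI impI)
      show "1 - 2 * exp (- (1 / 5632) * real m / (K * real s * (ln (2 * K * real s))\<^sup>2)) \<le> measure P E"
        using E(2) by (simp add: Q_def mult.assoc)
      fix \<xi> v f\<^sub>0 k f
      assume \<xi>E: "\<xi> \<in> E" and *: "(1 + c t (R\<^sub>2 / R\<^sub>1)) * v \<le> s \<and> continuous_on \<Omega> f\<^sub>0 \<and> f\<^sub>0 ` \<Omega> \<subseteq> F \<and>
            womp F (emp_measure \<mu> m \<xi>) \<phi> N t f\<^sub>0 k f"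
      have \<xi>: "\<xi> \<in> {1..m} \<rightarrow> space \<mu>"
        using sets.sets_into_space[OF E(1)] \<xi>E by (auto simp: P_def space_PiM)
      have v: "(1 + 4 * phase_factor t (R\<^sub>2 / R\<^sub>1)) * v \<le> s" using * by (simp add: c_def)
      have v0: "v = 0" if "s = 1"
        using v c1[rule_format, of t "R\<^sub>2 / R\<^sub>1"] that by (cases v) (auto simp: c_def)
      have f0: "f\<^sub>0 \<in> borel_measurable \<mu>"
      proof -
        have "f\<^sub>0 \<in> borel_measurable (restrict_space borel \<Omega>)"
          using * by (intro borel_measurable_continuous_on_restrict) auto
        moreover have "space (restrict_space borel \<Omega>) = space \<mu>" by (simp add: sp space_restrict_space)
        ultimately show ?thesis using borel by (auto simp: measurable_def)
      qed
      have "v = 0 \<or> sparse_rip F \<mu> \<phi> N s m \<xi>"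
        using v0 rip \<xi>E by blast
      note rip_v = this
      have system: "\<forall>j\<in>{1..N}. \<phi> j \<in> borel_measurable \<mu> \<and> (\<forall>x\<in>space \<mu>. \<phi> j x \<in> F \<and> cmod (\<phi> j x) \<le> 1)"
        using meas bound \<phi>F by blast
      have f0F: "f\<^sub>0 ` space \<mu> \<subseteq> F" and womp: "womp F (emp_measure \<mu> m \<xi>) \<phi> N t f\<^sub>0 k f"
        using * sp by auto
      note err = womp_errors[OF F \<mu> system s R riesz t m \<xi> rip_v f0 f0F womp refl v, unfolded sp, folded c_def]
      show "L2_norm (emp_measure \<mu> m \<xi>) (f (c t (R\<^sub>2 / R\<^sub>1) * v))
              \<le> ennreal 3 * sigma_best F \<phi> N (L2_norm (emp_measure \<mu> m \<xi>)) v f\<^sub>0"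
        by (rule err(1))
      show "L2_norm \<mu> (f (c t (R\<^sub>2 / R\<^sub>1) * v)) \<le> ennreal 53 * sigma_best F \<phi> N (sup_norm \<Omega>) v f\<^sub>0"
        by (rule err(2))
      show "L2_norm \<mu> (f (c t (R\<^sub>2 / R\<^sub>1) * v))
              \<le> ennreal 75 * sigma_best F \<phi> N (L2_norm (mix_measure \<mu> m \<xi>)) v f\<^sub>0"
        by (rule err(3))
    qed
  qed simp_all
qed

end
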